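(* Let $\mathscr{C}$ be a class of graphs. If $\mathscr{C}$ contains all partial matchings, then $\mathrm{MC}(\mathrm{FO}[{<}],\mathscr{C})$ is $\mathrm{AW}[*]$-hard. If $\mathscr{C}$ contains all star forests, then $\mathrm{MC}(\mathrm{FO}[{+1}],\mathscr{C})$ is $\mathrm{AW}[*]$-hard.
   Context: A partial matching is a graph of maximum degree at most $1$ (a disjoint union of edges and isolated vertices). A star forest is a disjoint union of stars $K_{1,n}$ with $n\ge 0$. A successor relation on a finite set $V$ is a binary relation $S\subseteq V\times V$ such that $(V,S)$ is a directed path of length $|V|-1$. The parameterised problem $\mathrm{MC}(\mathrm{FO}[{<}],\mathscr{C})$ has as input a graph $G\in\mathscr{C}$, a linear order $<$ on $V(G)$, and a first-order sentence $\phi$ over the signature $\{E,<\}$; the parameter is $|\phi|$ (the length of $\phi$); the question is whether $(G,<)\models\phi$. The problem $\mathrm{MC}(\mathrm{FO}[{+1}],\mathscr{C})$ is defined in the same way, except that the input contains a successor relation $S$ on $V(G)$ instead of a linear order and $\phi$ is a first-order sentence over $\{E,S\}$; the question is whether $(G,S)\models\phi$. Hardness is with respect to parameterised (fpt) reductions, and $\mathrm{AW}[*]$ is the usual parameterised complexity class (for which first-order model checking on all graphs is complete). *)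

theory Defs
  imports Complex_Main "HOL-Library.Disjoint_Sets"
begin

section \<open>Computable functions on the naturals\<close>

datatype recf =
    Rec_Zero
  | Rec_Succ
  | Rec_Proj nat
  | Rec_Comp recf "recf list"
  | Rec_Prim recf recf
  | Rec_Mu recf

text \<open>
  Graph of the partial recursive function denoted by a term: zero, successor, projections,
  composition, primitive recursion (on the first argument) and unbounded minimisation.
\<close>

inductive rec_eval :: "recf \<Rightarrow> nat list \<Rightarrow> nat \<Rightarrow> bool" where
  zero: "rec_eval Rec_Zero xs 0"
| succ: "rec_eval Rec_Succ [x] (Suc x)"
| proj: "i < length xs \<Longrightarrow> rec_eval (Rec_Proj i) xs (xs ! i)"
| comp: "length ys = length gs \<Longrightarrow> (\<And>i. i < length gs \<Longrightarrow> rec_eval (gs ! i) xs (ys ! i)) \<Longrightarrow>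
    rec_eval f ys z \<Longrightarrow> rec_eval (Rec_Comp f gs) xs z"
| prim_0: "rec_eval f xs y \<Longrightarrow> rec_eval (Rec_Prim f g) (0 # xs) y"
| prim_Suc: "rec_eval (Rec_Prim f g) (n # xs) r \<Longrightarrow> rec_eval g (n # r # xs) y \<Longrightarrow>
    rec_eval (Rec_Prim f g) (Suc n # xs) y"
| mu: "rec_eval f (n # xs) 0 \<Longrightarrow> (\<And>m. m < n \<Longrightarrow> \<exists>y. rec_eval f (m # xs) (Suc y)) \<Longrightarrow>
    rec_eval (Rec_Mu f) xs n"

definition computable :: "(nat \<Rightarrow> nat) \<Rightarrow> bool" where
  "computable f \<longleftrightarrow> (\<exists>p. \<forall>n. rec_eval p [n] (f n))"


section \<open>Multi-tape Turing machines\<close>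

type_synonym word = "bool list"

datatype move = Move_Left | Stay | Move_Right

text \<open>
  A deterministic machine has tapes \<open>0..<tapes\<close>, non-halting states \<open>0..<states\<close> with initial
  state 0, the single halting state \<open>states\<close>, and tape symbols \<open>0..<symbols\<close>, where 0 is
  the blank.  The transition function takes the state and the list of scanned symbols (one per tape)
  to the new state and, for each tape, the symbol to be written and the head movement.
\<close>

record tm =
  tapes :: nat
  states :: nat
  symbols :: nat
  trans_fun :: "nat \<Rightarrow> nat list \<Rightarrow> nat \<times> (nat \<times> move) list"

definition wf_tm :: "tm \<Rightarrow> bool" where
  "wf_tm M \<longleftrightarrow> 2 \<le> tapes M \<and> 3 \<le> symbols M \<and>
    (\<forall>q ss. q < states M \<and> length ss = tapes M \<and> set ss \<subseteq> {..<symbols M} \<longrightarrow>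
      (case trans_fun M q ss of (q', acts) \<Rightarrow>
        q' \<le> states M \<and> length acts = tapes M \<and> fst ` set acts \<subseteq> {..<symbols M}))"

text \<open>A tape is two-way infinite and is given by its content together with the head position.\<close>

type_synonym tape = "(int \<Rightarrow> nat) \<times> int"

type_synonym tm_config = "nat \<times> tape list"

definition scanned :: "tape \<Rightarrow> nat" where
  "scanned t = fst t (snd t)"

fun act :: "nat \<times> move \<Rightarrow> tape \<Rightarrow> tape" where
  "act (s, m) (c, p) =
    (c(p := s), case m of Move_Left \<Rightarrow> p - 1 | Stay \<Rightarrow> p | Move_Right \<Rightarrow> p + 1)"

text \<open>Halting configurations are fixed points of the step function.\<close>

fun tm_step :: "tm \<Rightarrow> tm_config \<Rightarrow> tm_config" where
  "tm_step M (q, ts) =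
    (if q < states M
     then (case trans_fun M q (map scanned ts) of (q', acts) \<Rightarrow> (q', map2 act acts ts))
     else (q, ts))"

definition bit_symbol :: "bool \<Rightarrow> nat" where
  "bit_symbol b = (if b then 2 else 1)"

definition blank_tape :: tape where
  "blank_tape = (\<lambda>_. 0, 0)"

definition input_tape :: "word \<Rightarrow> tape" where
  "input_tape x = (\<lambda>i. if 0 \<le> i \<and> i < int (length x) then bit_symbol (x ! nat i) else 0, 0)"

definition tm_init :: "tm \<Rightarrow> word \<Rightarrow> tm_config" where
  "tm_init M x = (0, input_tape x # replicate (tapes M - 1) blank_tape)"

text \<open>The word on a tape starts at the head and extends to the right up to the first blank.\<close>

fun tape_word :: "tape \<Rightarrow> word \<Rightarrow> bool" where
  "tape_word (c, p) y \<longleftrightarrow>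
    (\<forall>i < length y. c (p + int i) = bit_symbol (y ! i)) \<and> c (p + int (length y)) = 0"

text \<open>The input is on tape 0 and the output on tape 1.\<close>

definition tm_computes :: "tm \<Rightarrow> word \<Rightarrow> word \<Rightarrow> nat \<Rightarrow> bool" where
  "tm_computes M x y t \<longleftrightarrow>
    (case (tm_step M ^^ t) (tm_init M x) of (q, ts) \<Rightarrow> q = states M \<and> tape_word (ts ! 1) y)"


section \<open>Parameterised problems and fpt reductions\<close>

text \<open>
  The words in \<open>instances\<close> are the admissible inputs (for a model checking problem on a class
  of structures, the codes of inputs whose structure is in the class); the behaviour of a reduction on
  other words is irrelevant.
\<close>

record pproblem =
  instances :: "word set"
  yes_instances :: "word set"
  parameter :: "word \<Rightarrow> nat"

text \<open>
  Time \<open>f(\<kappa>(x)) \<cdot> |x|\<^sup>O\<^sup>(\<^sup>1\<^sup>)\<close> for a computable \<open>f\<close>; \<open>|x| + 1\<close> only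
  serves to avoid a zero bound for the empty word, and constant factors are absorbed by \<open>f\<close>.
\<close>

definition fpt_computable_on :: "word set \<Rightarrow> (word \<Rightarrow> nat) \<Rightarrow> (word \<Rightarrow> word) \<Rightarrow> bool" where
  "fpt_computable_on I \<kappa> R \<longleftrightarrow>
    (\<exists>M f c. wf_tm M \<and> computable f \<and>
      (\<forall>x\<in>I. tm_computes M x (R x) (f (\<kappa> x) * (length x + 1) ^ c)))"

definition fpt_reduction :: "(word \<Rightarrow> word) \<Rightarrow> pproblem \<Rightarrow> pproblem \<Rightarrow> bool" where
  "fpt_reduction R P Q \<longleftrightarrow>
    (\<forall>x\<in>instances P. R x \<in> instances Q \<and> (x \<in> yes_instances P \<longleftrightarrow> R x \<in> yes_instances Q)) \<and>
    fpt_computable_on (instances P) (parameter P) R \<and>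
    (\<exists>g. computable g \<and> (\<forall>x\<in>instances P. parameter Q (R x) \<le> g (parameter P x)))"

definition fpt_reducible :: "pproblem \<Rightarrow> pproblem \<Rightarrow> bool"  (infix \<open>\<le>\<^sub>f\<^sub>p\<^sub>t\<close> 50) where
  "P \<le>\<^sub>f\<^sub>p\<^sub>t Q \<longleftrightarrow> (\<exists>R. fpt_reduction R P Q)"

text \<open>
  The problem with abstract inputs \<open>I\<close>, property \<open>Y\<close> and parameter \<open>k\<close>, presented
  through a coding of the inputs by words that is injective on \<open>I\<close>.
\<close>

definition coded_problem :: "'i set \<Rightarrow> ('i \<Rightarrow> word) \<Rightarrow> ('i \<Rightarrow> bool) \<Rightarrow> ('i \<Rightarrow> nat) \<Rightarrow> pproblem" where
  "coded_problem I code Y k =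
    \<lparr>instances = code ` I, yes_instances = code ` {i \<in> I. Y i},
     parameter = (\<lambda>w. k (inv_into I code w))\<rparr>"


section \<open>First-order logic on finite relational structures\<close>

text \<open>
  A structure with universe \<open>{..<universe A}\<close>; the relation symbol with index \<open>i\<close> is given by
  its arity and a repetition-free list of its tuples.  The order of that list is irrelevant for the
  semantics; it only makes structures suitable as inputs.
\<close>

record struct =
  universe :: nat
  rels :: "(nat \<times> nat list list) list"

definition wf_struct :: "struct \<Rightarrow> bool" where
  "wf_struct A \<longleftrightarrow> 0 < universe A \<and>
    (\<forall>(r, ts) \<in> set (rels A). 0 < r \<and> distinct ts \<and>
      (\<forall>t \<in> set ts. length t = r \<and> set t \<subseteq> {..<universe A}))"

datatype fo =
    Eq nat nat
  | Rel nat "nat list"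
  | Neg fo
  | Conj fo fo
  | Disj fo fo
  | Ex nat fo
  | All nat fo

primrec free_vars :: "fo \<Rightarrow> nat set" where
  "free_vars (Eq x y) = {x, y}"
| "free_vars (Rel i xs) = set xs"
| "free_vars (Neg \<phi>) = free_vars \<phi>"
| "free_vars (Conj \<phi> \<psi>) = free_vars \<phi> \<union> free_vars \<psi>"
| "free_vars (Disj \<phi> \<psi>) = free_vars \<phi> \<union> free_vars \<psi>"
| "free_vars (Ex x \<phi>) = free_vars \<phi> - {x}"
| "free_vars (All x \<phi>) = free_vars \<phi> - {x}"

primrec over_arities :: "nat list \<Rightarrow> fo \<Rightarrow> bool" where
  "over_arities as (Eq x y) \<longleftrightarrow> True"
| "over_arities as (Rel i xs) \<longleftrightarrow> i < length as \<and> length xs = as ! i"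
| "over_arities as (Neg \<phi>) \<longleftrightarrow> over_arities as \<phi>"
| "over_arities as (Conj \<phi> \<psi>) \<longleftrightarrow> over_arities as \<phi> \<and> over_arities as \<psi>"
| "over_arities as (Disj \<phi> \<psi>) \<longleftrightarrow> over_arities as \<phi> \<and> over_arities as \<psi>"
| "over_arities as (Ex x \<phi>) \<longleftrightarrow> over_arities as \<phi>"
| "over_arities as (All x \<phi>) \<longleftrightarrow> over_arities as \<phi>"

definition sentence_for :: "struct \<Rightarrow> fo \<Rightarrow> bool" where
  "sentence_for A \<phi> \<longleftrightarrow> over_arities (map fst (rels A)) \<phi> \<and> free_vars \<phi> = {}"

primrec sat :: "struct \<Rightarrow> (nat \<Rightarrow> nat) \<Rightarrow> fo \<Rightarrow> bool" where
  "sat A \<sigma> (Eq x y) \<longleftrightarrow> \<sigma> x = \<sigma> y"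
| "sat A \<sigma> (Rel i xs) \<longleftrightarrow> map \<sigma> xs \<in> set (snd (rels A ! i))"
| "sat A \<sigma> (Neg \<phi>) \<longleftrightarrow> \<not> sat A \<sigma> \<phi>"
| "sat A \<sigma> (Conj \<phi> \<psi>) \<longleftrightarrow> sat A \<sigma> \<phi> \<and> sat A \<sigma> \<psi>"
| "sat A \<sigma> (Disj \<phi> \<psi>) \<longleftrightarrow> sat A \<sigma> \<phi> \<or> sat A \<sigma> \<psi>"
| "sat A \<sigma> (Ex x \<phi>) \<longleftrightarrow> (\<exists>a < universe A. sat A (\<sigma>(x := a)) \<phi>)"
| "sat A \<sigma> (All x \<phi>) \<longleftrightarrow> (\<forall>a < universe A. sat A (\<sigma>(x := a)) \<phi>)"

text \<open>For a sentence the assignment is irrelevant.\<close>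

definition models :: "struct \<Rightarrow> fo \<Rightarrow> bool"  (infix \<open>\<Turnstile>\<close> 50) where
  "A \<Turnstile> \<phi> \<longleftrightarrow> sat A (\<lambda>_. 0) \<phi>"


section \<open>Coding of inputs and model checking problems\<close>

definition code_nats :: "nat list \<Rightarrow> word" where
  "code_nats ns = concat (map (\<lambda>n. replicate n True @ [False]) ns)"

primrec fo_tokens :: "fo \<Rightarrow> nat list" where
  "fo_tokens (Eq x y) = [0, x, y]"
| "fo_tokens (Rel i xs) = 1 # i # length xs # xs"
| "fo_tokens (Neg \<phi>) = 2 # fo_tokens \<phi>"
| "fo_tokens (Conj \<phi> \<psi>) = 3 # fo_tokens \<phi> @ fo_tokens \<psi>"
| "fo_tokens (Disj \<phi> \<psi>) = 4 # fo_tokens \<phi> @ fo_tokens \<psi>"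
| "fo_tokens (Ex x \<phi>) = 5 # x # fo_tokens \<phi>"
| "fo_tokens (All x \<phi>) = 6 # x # fo_tokens \<phi>"

definition struct_tokens :: "struct \<Rightarrow> nat list" where
  "struct_tokens A = universe A # length (rels A) #
    concat (map (\<lambda>(r, ts). r # length ts # concat ts) (rels A))"

definition mc_code :: "struct \<times> fo \<Rightarrow> word" where
  "mc_code = (\<lambda>(A, \<phi>). code_nats (struct_tokens A @ fo_tokens \<phi>))"

lemma code_nats_simps:
  "code_nats [] = []" "code_nats (n # ns) = replicate n True @ False # code_nats ns"
  by (simp_all add: code_nats_def)

lemma replicate_True_cancel:
  "replicate m True @ False # u = replicate n True @ False # v \<longleftrightarrow> m = n \<and> u = v"
proof (induction m arbitrary: n)
  case 0
  then show ?case by (cases n) auto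
next
  case (Suc m)
  then show ?case by (cases n) auto
qed

lemma code_nats_inject: "code_nats ms = code_nats ns \<Longrightarrow> ms = ns"
proof (induction ms arbitrary: ns)
  case Nil
  then show ?case by (cases ns) (auto simp: code_nats_simps)
next
  case (Cons m ms)
  then show ?case by (cases ns) (auto simp: code_nats_simps replicate_True_cancel)
qed

lemma fo_tokens_prefix_free:
  "fo_tokens \<phi> @ u = fo_tokens \<psi> @ v \<Longrightarrow> \<phi> = \<psi> \<and> u = v"
proof (induction \<phi> arbitrary: \<psi> u v)
  case (Conj \<phi>1 \<phi>2)
  from Conj.prems show ?case by (cases \<psi>) (auto dest!: Conj.IH)
next
  case (Disj \<phi>1 \<phi>2)
  from Disj.prems show ?case by (cases \<psi>) (auto dest!: Disj.IH)
next
  case (Eq x y)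
  then show ?case by (cases \<psi>) auto
next
  case (Rel i xs)
  then show ?case by (cases \<psi>) auto
next
  case (Neg \<phi>)
  then show ?case by (cases \<psi>) auto
next
  case (Ex x \<phi>)
  then show ?case by (cases \<psi>) auto
next
  case (All x \<phi>)
  then show ?case by (cases \<psi>) auto
qed

lemma concat_cancel:
  assumes "length ss = length ts" "\<forall>t \<in> set ss \<union> set ts. length t = r"
    and "concat ss @ u = concat ts @ v"
  shows "ss = ts \<and> u = v"
  using assms by (induction ss ts rule: list_induct2) auto

lemma rels_tokens_cancel:
  assumes "length rs = length rs'"
    and "\<forall>(r, ts) \<in> set rs \<union> set rs'. \<forall>t \<in> set ts. length t = r"
    and "concat (map (\<lambda>(r, ts). r # length ts # concat ts) rs) @ u =
         concat (map (\<lambda>(r, ts). r # length ts # concat ts) rs') @ v"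
  shows "rs = rs' \<and> u = v"
  using assms
proof (induction rs rs' rule: list_induct2)
  case Nil
  then show ?case by simp
next
  case (Cons p ps q qs)
  obtain r ts r' ts' where [simp]: "p = (r, ts)" "q = (r', ts')" by (cases p, cases q)
  have "ts = ts' \<and> concat (map (\<lambda>(r, ts). r # length ts # concat ts) ps) @ u =
         concat (map (\<lambda>(r, ts). r # length ts # concat ts) qs) @ v"
    using Cons.prems by (intro concat_cancel[where r = r]) auto
  with Cons.IH Cons.prems show ?case by simp
qed

text \<open>Hence an input can be recovered from its code, as needed for the parameter of a coded problem.\<close>

lemma mc_code_inj: "inj_on mc_code {(A, \<phi>). wf_struct A \<and> sentence_for A \<phi>}"
proof (rule inj_onI, clarify)
  fix A \<phi> B \<psi>
  assume A: "wf_struct A" and B: "wf_struct B" and eq: "mc_code (A, \<phi>) = mc_code (B, \<psi>)"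
  from eq have *: "universe A = universe B" "length (rels A) = length (rels B)"
    "concat (map (\<lambda>(r, ts). r # length ts # concat ts) (rels A)) @ fo_tokens \<phi> =
     concat (map (\<lambda>(r, ts). r # length ts # concat ts) (rels B)) @ fo_tokens \<psi>"
    by (auto simp: mc_code_def struct_tokens_def code_nats_simps replicate_True_cancel dest: code_nats_inject)
  have tuple_lengths: "\<forall>(r, ts) \<in> set (rels S). \<forall>t \<in> set ts. length t = r" if "wf_struct S" for S
    using that by (simp add: wf_struct_def case_prod_unfold)
  have "rels A = rels B \<and> fo_tokens \<phi> = fo_tokens \<psi>"
    by (rule rels_tokens_cancel[OF *(2) _ *(3)]) (use tuple_lengths[OF A] tuple_lengths[OF B] in \<open>simp only: ball_Un simp_thms\<close>)
  with * fo_tokens_prefix_free[of \<phi> "[]" \<psi> "[]"] show "A = B \<and> \<phi> = \<psi>" by simp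
qed

text \<open>The length of a formula is the length of the word that codes it.\<close>

definition fo_length :: "fo \<Rightarrow> nat" where
  "fo_length \<phi> = length (code_nats (fo_tokens \<phi>))"

definition MC_FO :: "struct set \<Rightarrow> pproblem" where
  "MC_FO K = coded_problem {(A, \<phi>). A \<in> K \<and> sentence_for A \<phi>} mc_code
    (\<lambda>(A, \<phi>). A \<Turnstile> \<phi>) (\<lambda>(A, \<phi>). fo_length \<phi>)"

text \<open>
  AW[*] is the closure under fpt reductions of first-order model checking on all finite relational
  structures.
\<close>

definition AW_star :: "pproblem set" where
  "AW_star = {P. P \<le>\<^sub>f\<^sub>p\<^sub>t MC_FO {A. wf_struct A}}"

definition AW_star_hard :: "pproblem \<Rightarrow> bool" where
  "AW_star_hard Q \<longleftrightarrow> (\<forall>P \<in> AW_star. P \<le>\<^sub>f\<^sub>p\<^sub>t Q)"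


section \<open>Graphs with a linear order or a successor relation\<close>

text \<open>
  Finite simple graphs, up to isomorphism: vertex set \<open>{..<order G}\<close>, nonempty, with the
  adjacency relation \<open>adj G\<close>.
\<close>

record ugraph =
  order :: nat
  adj :: "nat rel"

definition simple_graph :: "ugraph \<Rightarrow> bool" where
  "simple_graph G \<longleftrightarrow> 0 < order G \<and> adj G \<subseteq> {..<order G} \<times> {..<order G} \<and>
    sym (adj G) \<and> irrefl (adj G)"

definition partial_matching :: "ugraph \<Rightarrow> bool" where
  "partial_matching G \<longleftrightarrow> simple_graph G \<and> (\<forall>v < order G. card {u. (v, u) \<in> adj G} \<le> 1)"

text \<open>The vertex set is partitioned into stars; each part \<open>S\<close> has a centre \<open>c S\<close>.\<close>

definition star_forest :: "ugraph \<Rightarrow> bool" where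
  "star_forest G \<longleftrightarrow> simple_graph G \<and>
    (\<exists>\<S> c. partition_on {..<order G} \<S> \<and> (\<forall>S\<in>\<S>. c S \<in> S) \<and>
      adj G = (\<Union>S\<in>\<S>. {c S} \<times> (S - {c S}) \<union> (S - {c S}) \<times> {c S}))"

definition linear_order_of :: "ugraph \<Rightarrow> nat rel \<Rightarrow> bool" where
  "linear_order_of G L \<longleftrightarrow> L \<subseteq> {..<order G} \<times> {..<order G} \<and>
    strict_linear_order_on {..<order G} L"

definition successor_relation_of :: "ugraph \<Rightarrow> nat rel \<Rightarrow> bool" where
  "successor_relation_of G S \<longleftrightarrow>
    (\<exists>vs. distinct vs \<and> set vs = {..<order G} \<and>
      S = {(vs ! i, vs ! Suc i) | i. Suc i < length vs})"

text \<open>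
  Structures for \<open>(G, X)\<close> with a second binary relation \<open>X\<close>, the tuples of the two
  relations being listed in any order; symbol 0 is \<open>E\<close> and symbol 1 is \<open><\<close> or
  \<open>S\<close>.
\<close>

definition lists_rel :: "nat list list \<Rightarrow> nat rel \<Rightarrow> bool" where
  "lists_rel ts X \<longleftrightarrow> distinct ts \<and> set ts = (\<lambda>(u, v). [u, v]) ` X"

definition expansions :: "ugraph \<Rightarrow> nat rel \<Rightarrow> struct set" where
  "expansions G X =
    {\<lparr>universe = order G, rels = [(2, es), (2, xs)]\<rparr> | es xs. lists_rel es (adj G) \<and> lists_rel xs X}"

definition MC_FO_order :: "ugraph set \<Rightarrow> pproblem" where
  "MC_FO_order C = MC_FO (\<Union>G\<in>C. \<Union>L\<in>{L. linear_order_of G L}. expansions G L)"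

definition MC_FO_succ :: "ugraph set \<Rightarrow> pproblem" where
  "MC_FO_succ C = MC_FO (\<Union>G\<in>C. \<Union>S\<in>{S. successor_relation_of G S}. expansions G S)"

end

theory Submission
  imports Defs
begin

text \<open>
  A relational structure becomes a star forest by letting its elements and its relation symbols be the centres of stars and
  writing every tuple as a block of consecutive leaves of the star of its relation symbol and of those of its entries; the
  successor relation links the leaves of a block.  The universe is added as a unary relation, so that
  the quantifiers can be relativised.  In a linear order, intervals take over the role of stars, and
  with them every graph with a successor relation can be coded by an ordered matching: vertices become intervals,
  each with one position for every possible neighbour.

  Both reductions are computed by a program whose loops are bounded by numbers read from the input
  and which only increments counters otherwise.  Such programs run in polynomial time and are
  translated to stack machines.  A tape is a stack whose top is under the head: whatever is left of the head or beyond the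
  first blank does not matter, so the output of an arbitrary machine can serve as a stack, and the program
  can continue on the tapes that the machine leaves behind.
\<close>

text \<open>The vocabulary of the given structures is unbounded, while the target has two binary
  symbols. A relation symbol is therefore addressed by its place on the successor path: the
  translated formula walks to it from the first vertex. Indices of symbols are written in unary, so
  this lengthens a formula only by a constant factor.

  The obstacle in a partial matching is that a vertex has at most one neighbour, so its adjacencies
  must be spread over many vertices and the order alone must say which of them belong together. An
  edge between vertices consecutive in the order can serve as a separator, because no edge that
  codes an adjacency has this form.

  Hardness concerns every problem that reduces to model checking, and of such a reduction only a
  machine is given. The new programs thus have to be run after a machine of which nothing but time
  and output is known. Its time also bounds the length of its output, which turns polynomial time in
  that output into fpt time in the original input.\<close>

lemma computable_const: "computable (\<lambda>_. K)"
proof -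
  have "\<exists>p. \<forall>xs. rec_eval p xs K"
  proof (induction K)
    case 0
    show ?case by (meson rec_eval.zero)
  next
    case (Suc K)
    then obtain p where p: "\<And>xs. rec_eval p xs K" by blast
    have "rec_eval (Rec_Comp Rec_Succ [p]) xs (Suc K)" for xs
      by (rule rec_eval.comp[where ys = "[K]"]) (auto simp: p rec_eval.succ)
    then show ?case by blast
  qed
  then show ?thesis unfolding computable_def by blast
qed

lemma computable_comp2:
  assumes h: "\<And>x y. rec_eval p [x, y] (h x y)" and "computable f" "computable g"
  shows "computable (\<lambda>k. h (f k) (g k))"
proof -
  from assms obtain pf pg where "\<And>n. rec_eval pf [n] (f n)" "\<And>n. rec_eval pg [n] (g n)"
    unfolding computable_def by blast
  then have "rec_eval (Rec_Comp p [pf, pg]) [n] (h (f n) (g n))" for n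
    by (intro rec_eval.comp[where ys = "[f n, g n]"]) (auto simp: h less_Suc_eq)
  then show ?thesis unfolding computable_def by blast
qed

text \<open>The step function of a primitive recursion receives the counter, the previous value and
  the parameters in this order, so \<open>Rec_Proj 1\<close> is the previous value.\<close>

definition rec_add :: recf where
  "rec_add = Rec_Prim (Rec_Proj 0) (Rec_Comp Rec_Succ [Rec_Proj 1])"

lemma rec_proj: "i < length xs \<Longrightarrow> y = xs ! i \<Longrightarrow> rec_eval (Rec_Proj i) xs y"
  using rec_eval.proj by simp

lemma rec_eval_add: "rec_eval rec_add [x, y] (x + y)"
proof (induction x)
  case 0
  show ?case unfolding rec_add_def by (auto intro!: rec_eval.prim_0 rec_proj)
next
  case (Suc x)
  have "rec_eval (Rec_Comp Rec_Succ [Rec_Proj 1]) [x, x + y, y] (Suc (x + y))"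
    by (rule rec_eval.comp[where ys = "[x + y]"]) (auto intro!: rec_proj simp: rec_eval.succ)
  with Suc show ?case unfolding rec_add_def by (auto intro: rec_eval.prim_Suc)
qed

definition rec_mult :: recf where
  "rec_mult = Rec_Prim Rec_Zero (Rec_Comp rec_add [Rec_Proj 1, Rec_Proj 2])"

lemma rec_eval_mult: "rec_eval rec_mult [x, y] (x * y)"
proof (induction x)
  case 0
  show ?case unfolding rec_mult_def by (auto intro!: rec_eval.prim_0 rec_eval.zero)
next
  case (Suc x)
  have "rec_eval (Rec_Comp rec_add [Rec_Proj 1, Rec_Proj 2]) [x, x * y, y] (x * y + y)"
    by (rule rec_eval.comp[where ys = "[x * y, y]"])
      (auto intro!: rec_proj rec_eval_add simp: less_Suc_eq)
  with Suc show ?case unfolding rec_mult_def by (auto intro: rec_eval.prim_Suc simp: add.commute)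
qed

text \<open>The shape of both bounds needed for a reduction: the running time of a machine extended
  by a program, and, with \<open>a = 0\<close> and \<open>d = 1\<close>, the new parameter.\<close>

lemma computable_poly:
  assumes "computable f"
  shows "computable (\<lambda>k. K * (f k + a) ^ d)"
proof (rule computable_comp2[OF rec_eval_mult computable_const])
  have fa: "computable (\<lambda>k. f k + a)"
    by (rule computable_comp2[OF rec_eval_add assms computable_const])
  show "computable (\<lambda>k. (f k + a) ^ d)"
    by (induction d) (simp_all add: computable_const computable_comp2[OF rec_eval_mult fa])
qed


section \<open>Stack programs\<close>

datatype 'r stk =
    Nop
  | Push 'r bool
  | Pop 'r
  | Seq "'r stk" "'r stk"
  | Cond 'r "bool option \<Rightarrow> bool" "'r stk" "'r stk"
  | While 'r "bool option \<Rightarrow> bool" "'r stk"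

definition peek :: "word \<Rightarrow> bool option" where
  "peek w = (case w of [] \<Rightarrow> None | b # _ \<Rightarrow> Some b)"

lemma peek_simps [simp]: "peek [] = None" "peek (b # w) = Some b"
  by (simp_all add: peek_def)

text \<open>The numbers are those of the machine code below: a push takes two steps, and
  leaving the first branch of a conditional or the body of a loop costs a jump.\<close>

inductive stk_exec :: "'r stk \<Rightarrow> ('r \<Rightarrow> word) \<Rightarrow> nat \<Rightarrow> ('r \<Rightarrow> word) \<Rightarrow> bool" where
  Nop: "stk_exec Nop s 0 s"
| Push: "stk_exec (Push r b) s 2 (s(r := b # s r))"
| Pop: "stk_exec (Pop r) s 1 (s(r := tl (s r)))"
| Seq: "stk_exec c s t s' \<Longrightarrow> stk_exec d s' t' s'' \<Longrightarrow> stk_exec (Seq c d) s (t + t') s''"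
| Cond_True: "P (peek (s r)) \<Longrightarrow> stk_exec c s t s' \<Longrightarrow> stk_exec (Cond r P c d) s (t + 2) s'"
| Cond_False: "\<not> P (peek (s r)) \<Longrightarrow> stk_exec d s t s' \<Longrightarrow> stk_exec (Cond r P c d) s (t + 1) s'"
| While_False: "\<not> P (peek (s r)) \<Longrightarrow> stk_exec (While r P c) s 1 s"
| While_True: "P (peek (s r)) \<Longrightarrow> stk_exec c s t s' \<Longrightarrow> stk_exec (While r P c) s' t' s'' \<Longrightarrow>
    stk_exec (While r P c) s (t + t' + 2) s''"

primrec stk_regs :: "'r stk \<Rightarrow> 'r set" where
  "stk_regs Nop = {}"
| "stk_regs (Push r b) = {r}"
| "stk_regs (Pop r) = {r}"
| "stk_regs (Seq c d) = stk_regs c \<union> stk_regs d"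
| "stk_regs (Cond r P c d) = insert r (stk_regs c \<union> stk_regs d)"
| "stk_regs (While r P c) = insert r (stk_regs c)"

lemma finite_stk_regs: "finite (stk_regs c)"
  by (induction c) auto

text \<open>A push costs more than the one symbol it adds. This bounds the output stacks by the
  running time, and hence the cost of copying them at the end.\<close>

lemma stk_exec_length:
  "stk_exec c s t s' \<Longrightarrow> length (s' r) \<le> length (s r) + t"
  by (induction rule: stk_exec.induct) auto

section \<open>Machine code for stack programs\<close>

datatype 'r instr =
    IMove 'r "bool option \<Rightarrow> move"
  | IWrite 'r bool
  | IBranch 'r "bool option \<Rightarrow> bool" nat
  | IJump nat

primrec code_len :: "'r stk \<Rightarrow> nat" where
  "code_len Nop = 0"
| "code_len (Push r b) = 2"
| "code_len (Pop r) = 1"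
| "code_len (Seq c d) = code_len c + code_len d"
| "code_len (Cond r P c d) = code_len c + code_len d + 2"
| "code_len (While r P c) = code_len c + 2"

text \<open>A push moves left and writes in a second instruction, because a machine step writes
  before it moves. A branch falls through when its test succeeds, so the address in it is the target
  for failure.\<close>

primrec code :: "'r stk \<Rightarrow> nat \<Rightarrow> 'r instr list" where
  "code Nop a = []"
| "code (Push r b) a = [IMove r (\<lambda>_. Move_Left), IWrite r b]"
| "code (Pop r) a = [IMove r (\<lambda>v. if v = None then Stay else Move_Right)]"
| "code (Seq c d) a = code c a @ code d (a + code_len c)"
| "code (Cond r P c d) a = IBranch r P (a + code_len c + 2) # code c (a + 1) @
     IJump (a + code_len c + code_len d + 2) # code d (a + code_len c + 2)"
| "code (While r P c) a = IBranch r P (a + code_len c + 2) # code c (a + 1) @ [IJump a]"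

lemma length_code [simp]: "length (code c a) = code_len c"
  by (induction c arbitrary: a) auto

primrec instr_ok :: "'r set \<Rightarrow> nat \<Rightarrow> 'r instr \<Rightarrow> bool" where
  "instr_ok R e (IMove r g) \<longleftrightarrow> r \<in> R"
| "instr_ok R e (IWrite r b) \<longleftrightarrow> r \<in> R"
| "instr_ok R e (IBranch r P a) \<longleftrightarrow> r \<in> R \<and> a \<le> e"
| "instr_ok R e (IJump a) \<longleftrightarrow> a \<le> e"

lemma code_ok:
  "stk_regs c \<subseteq> R \<Longrightarrow> a + code_len c \<le> e \<Longrightarrow> i \<in> set (code c a) \<Longrightarrow> instr_ok R e i"
proof (induction c arbitrary: a)
  case (Cond r P c d)
  then show ?case using Cond.IH(1)[of "a + 1"] Cond.IH(2)[of "a + code_len c + 2"] by auto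
next
  case (While r P c)
  then show ?case using While.IH[of "a + 1"] by auto
next
  case (Seq c d)
  then show ?case using Seq.IH(1)[of a] Seq.IH(2)[of "a + code_len c"] by auto
qed auto

text \<open>The given machine may use more than three symbols. Those above 2 occur only outside the
  stored words, so it does not matter that they are read as \<open>Some False\<close>.\<close>

definition sym_bit :: "nat \<Rightarrow> bool option" where
  "sym_bit x = (if x = 0 then None else Some (x = 2))"

primrec instr_trans :: "('r \<Rightarrow> nat) \<Rightarrow> 'r instr \<Rightarrow> nat \<Rightarrow> nat list \<Rightarrow> nat \<times> (nat \<times> move) list" where
  "instr_trans \<rho> (IMove r g) q ss =
     (Suc q, (map (\<lambda>x. (x, Stay)) ss)[\<rho> r := (ss ! \<rho> r, g (sym_bit (ss ! \<rho> r)))])"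
| "instr_trans \<rho> (IWrite r b) q ss =
     (Suc q, (map (\<lambda>x. (x, Stay)) ss)[\<rho> r := (bit_symbol b, Stay)])"
| "instr_trans \<rho> (IBranch r P a) q ss =
     (if P (sym_bit (ss ! \<rho> r)) then Suc q else a, map (\<lambda>x. (x, Stay)) ss)"
| "instr_trans \<rho> (IJump a) q ss = (a, map (\<lambda>x. (x, Stay)) ss)"

text \<open>\<open>M\<close> followed by the program: the halting state of \<open>M\<close> is the first address
  of the code, and \<open>\<rho>\<close> assigns tapes to registers.\<close>

definition tm_then :: "tm \<Rightarrow> nat \<Rightarrow> ('r \<Rightarrow> nat) \<Rightarrow> 'r stk \<Rightarrow> tm" where
  "tm_then M k \<rho> c = \<lparr>tapes = tapes M + k, states = states M + code_len c, symbols = symbols M,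
     trans_fun = (\<lambda>q ss. if q < states M
       then (case trans_fun M q (take (tapes M) ss) of
          (q', acts) \<Rightarrow> (q', acts @ map (\<lambda>x. (x, Stay)) (drop (tapes M) ss)))
       else instr_trans \<rho> (code c (states M) ! (q - states M)) q ss)\<rparr>"

lemma tm_then_simps [simp]:
  "tapes (tm_then M k \<rho> c) = tapes M + k" "states (tm_then M k \<rho> c) = states M + code_len c"
  "symbols (tm_then M k \<rho> c) = symbols M"
  by (simp_all add: tm_then_def)

lemma bit_symbol_less: "3 \<le> n \<Longrightarrow> bit_symbol b < n"
  by (simp add: bit_symbol_def)

lemma symbols_update:
  assumes "set ss \<subseteq> {..<n}" "y < n"
  shows "fst ` set ((map (\<lambda>x. (x, Stay)) ss)[j := (y, m)]) \<subseteq> {..<n}"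
proof -
  have "fst ` set ((map (\<lambda>x. (x, Stay)) ss)[j := (y, m)]) \<subseteq>
      fst ` insert (y, m) (set (map (\<lambda>x. (x, Stay)) ss))"
    by (intro image_mono set_update_subset_insert)
  also have "\<dots> \<subseteq> {..<n}" using assms by auto
  finally show ?thesis .
qed

lemma instr_trans_ok:
  assumes "instr_ok R e i" "q < e" "\<forall>r\<in>R. \<rho> r < length ss" "set ss \<subseteq> {..<n}" "3 \<le> n"
  shows "case instr_trans \<rho> i q ss of (q', acts) \<Rightarrow>
    q' \<le> e \<and> length acts = length ss \<and> fst ` set acts \<subseteq> {..<n}"
proof -
  have id: "fst ` set (map (\<lambda>x. (x, Stay)) ss) \<subseteq> {..<n}" using assms(4) by auto
  show ?thesis
  proof (cases i)
    case (IMove r g)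
    then have "\<rho> r < length ss" using assms(1,3) by simp
    then have "ss ! \<rho> r < n" using subsetD[OF assms(4) nth_mem] by simp
    with symbols_update[OF assms(4)] IMove assms(2) show ?thesis by simp
  next
    case (IWrite r b)
    with symbols_update[OF assms(4) bit_symbol_less[OF assms(5)]] assms(2) show ?thesis by simp
  next
    case (IBranch r P a)
    with id assms(1,2) show ?thesis by simp
  next
    case (IJump a)
    with id assms(1,2) show ?thesis by simp
  qed
qed

lemma wf_tm_then:
  assumes M: "wf_tm M" and \<rho>: "\<forall>r \<in> stk_regs c. \<rho> r < tapes M + k"
  shows "wf_tm (tm_then M k \<rho> c)"
proof -
  let ?M = "tm_then M k \<rho> c"
  have main: "case trans_fun ?M q ss of (q', acts) \<Rightarrow> q' \<le> states ?M \<and> length acts = tapes ?M \<and>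
      fst ` set acts \<subseteq> {..<symbols ?M}"
    if q: "q < states ?M" and ss: "length ss = tapes ?M" "set ss \<subseteq> {..<symbols ?M}" for q ss
  proof (cases "q < states M")
    case True
    obtain q' acts where tr: "trans_fun M q (take (tapes M) ss) = (q', acts)" by fastforce
    have sub: "set (take (tapes M) ss) \<subseteq> {..<symbols M}" "set (drop (tapes M) ss) \<subseteq> {..<symbols M}"
      using order_trans[OF set_take_subset ss(2)] order_trans[OF set_drop_subset ss(2)] by simp_all
    have len: "length (take (tapes M) ss) = tapes M" using ss(1) by simp
    have "case trans_fun M q (take (tapes M) ss) of (q', acts) \<Rightarrow>
        q' \<le> states M \<and> length acts = tapes M \<and> fst ` set acts \<subseteq> {..<symbols M}"
      by (rule M[unfolded wf_tm_def, THEN conjunct2, THEN conjunct2, THEN spec, THEN spec, THEN mp])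
        (intro conjI True len sub(1))
    with True tr ss(1) sub(2) show ?thesis by (simp add: tm_then_def image_Un image_image)
  next
    case False
    define i where "i = code c (states M) ! (q - states M)"
    have "i \<in> set (code c (states M))" unfolding i_def using False q by (intro nth_mem) simp
    then have i: "instr_ok (stk_regs c) (states M + code_len c) i"
      by (intro code_ok[OF subset_refl order_refl])
    have tr: "trans_fun ?M q ss = instr_trans \<rho> i q ss" using False by (simp add: tm_then_def i_def)
    have "3 \<le> symbols M" using M by (simp add: wf_tm_def)
    then show ?thesis unfolding tr
      using instr_trans_ok[OF i, of q \<rho> ss "symbols M"] q \<rho> ss by simp
  qed
  have "2 \<le> tapes ?M" "3 \<le> symbols ?M" using M by (simp_all add: wf_tm_def)
  moreover have "\<forall>q ss. q < states ?M \<and> length ss = tapes ?M \<and> set ss \<subseteq> {..<symbols ?M} \<longrightarrow>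
      (case trans_fun ?M q ss of (q', acts) \<Rightarrow> q' \<le> states ?M \<and> length acts = tapes ?M \<and>
        fst ` set acts \<subseteq> {..<symbols ?M})"
    using main by (intro allI impI) (elim conjE)
  ultimately show ?thesis unfolding wf_tm_def by (intro conjI)
qed

section \<open>Simulation of stack programs on tapes\<close>

lemma act_id [simp]: "act (scanned t, Stay) t = t"
  by (cases t) (simp add: scanned_def)

lemma map2_act_id: "map2 act (map (\<lambda>t. (scanned t, Stay)) ts) ts = ts"
  by (rule nth_equalityI) auto

lemma map2_act_update:
  "j < length ts \<Longrightarrow>
   map2 act ((map (\<lambda>t. (scanned t, Stay)) ts)[j := a]) ts = ts[j := act a (ts ! j)]"
  by (rule nth_equalityI) (auto simp: nth_list_update)

primrec instr_step :: "('r \<Rightarrow> nat) \<Rightarrow> 'r instr \<Rightarrow> nat \<Rightarrow> tape list \<Rightarrow> tm_config" where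
  "instr_step \<rho> (IMove r g) q ts = (Suc q,
     ts[\<rho> r := act (scanned (ts ! \<rho> r), g (sym_bit (scanned (ts ! \<rho> r)))) (ts ! \<rho> r)])"
| "instr_step \<rho> (IWrite r b) q ts = (Suc q, ts[\<rho> r := act (bit_symbol b, Stay) (ts ! \<rho> r)])"
| "instr_step \<rho> (IBranch r P a) q ts =
     (if P (sym_bit (scanned (ts ! \<rho> r))) then Suc q else a, ts)"
| "instr_step \<rho> (IJump a) q ts = (a, ts)"

lemma instr_step_eq:
  assumes "\<forall>r\<in>R. \<rho> r < length ts" "instr_ok R e i"
  shows "(case instr_trans \<rho> i q (map scanned ts) of (q', acts) \<Rightarrow> (q', map2 act acts ts)) =
    instr_step \<rho> i q ts"
  using assms by (cases i) (simp_all add: map2_act_id map2_act_update o_def)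

lemma scanned_tape_word: "tape_word t w \<Longrightarrow> sym_bit (scanned t) = peek w"
  by (cases t; cases w) (auto simp: scanned_def sym_bit_def bit_symbol_def split: if_splits)

definition stacks_on :: "('r \<Rightarrow> nat) \<Rightarrow> 'r set \<Rightarrow> ('r \<Rightarrow> word) \<Rightarrow> tape list \<Rightarrow> bool" where
  "stacks_on \<rho> R s ts \<longleftrightarrow> (\<forall>r\<in>R. \<rho> r < length ts \<and> tape_word (ts ! \<rho> r) (s r))"

text \<open>Injectivity of \<open>\<rho>\<close> is what keeps the other stacks unchanged.\<close>

lemma stacks_on_update:
  assumes "stacks_on \<rho> R s ts" "inj_on \<rho> R" "r \<in> R" "tape_word t w"
  shows "stacks_on \<rho> R (s(r := w)) (ts[\<rho> r := t])"
  using assms unfolding stacks_on_def by (auto simp: nth_list_update inj_on_def)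

text \<open>The new bit replaces whatever stood left of the head, so nothing has to be known about
  that cell.\<close>

lemma tape_word_push:
  assumes "tape_word t w"
  shows "tape_word (act (bit_symbol b, Stay) (act (scanned t, Move_Left) t)) (b # w)"
proof -
  obtain h p where [simp]: "t = (h, p)" by fastforce
  have *: "p - 1 + int (Suc i) = p + int i" for i by simp
  show ?thesis using assms
    by (auto simp: scanned_def nth_Cons' less_Suc_eq_0_disj * simp del: of_nat_Suc)
qed

text \<open>On an empty stack the head has to stay on the blank: the cells behind it may hold
  leftovers of the given machine.\<close>

lemma tape_word_pop:
  assumes "tape_word t w"
  shows "tape_word (act (scanned t, if peek w = None then Stay else Move_Right) t) (tl w)"
proof -
  obtain h p where [simp]: "t = (h, p)" by fastforce
  show ?thesis
  proof (cases w)
    case (Cons b w')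
    have "h (p + 1 + int i) = bit_symbol (w' ! i)" if "i < length w'" for i
      using assms Cons that by (auto simp: add.assoc dest: spec[of _ "Suc i"])
    moreover have "h (p + 1 + int (length w')) = 0" using assms Cons by (simp add: add.assoc)
    ultimately show ?thesis using Cons by (simp add: scanned_def)
  qed (use assms in \<open>simp add: scanned_def\<close>)
qed

lemma peek_eq_None [simp]: "peek w = None \<longleftrightarrow> w = []"
  by (cases w) auto

text \<open>Locates the code of a subprogram inside the whole program, so that an induction can pass
  to subprograms while the machine stays the same.\<close>

definition code_at :: "tm \<Rightarrow> 'r stk \<Rightarrow> nat \<Rightarrow> 'r stk \<Rightarrow> bool" where
  "code_at M p a c \<longleftrightarrow> (\<exists>pre post. code p (states M) = pre @ code c a @ post \<and> a = states M + length pre)"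

lemma code_at_step:
  assumes "code_at M p a c" "j < code_len c" "length ts = tapes M + k"
    and "\<forall>r\<in>R. \<rho> r < tapes M + k" "stk_regs c \<subseteq> R"
  shows "tm_step (tm_then M k \<rho> p) (a + j, ts) = instr_step \<rho> (code c a ! j) (a + j) ts"
proof -
  from assms(1) obtain pre post where
    p: "code p (states M) = pre @ code c a @ post" "a = states M + length pre"
    unfolding code_at_def by blast
  have len: "code_len p = length pre + code_len c + length post"
    using arg_cong[OF p(1), of length] by simp
  have nth: "code p (states M) ! (length pre + j) = code c a ! j"
    using assms(2) by (simp add: p(1) nth_append)
  have "tm_step (tm_then M k \<rho> p) (a + j, ts) =
      (case instr_trans \<rho> (code c a ! j) (a + j) (map scanned ts) of (q', acts) \<Rightarrow> (q', map2 act acts ts))"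
    using assms(2) p(2) len nth by (simp add: tm_then_def)
  also have "\<dots> = instr_step \<rho> (code c a ! j) (a + j) ts"
  proof (rule instr_step_eq)
    show "\<forall>r\<in>R. \<rho> r < length ts" using assms(3,4) by simp
    show "instr_ok R (a + code_len c) (code c a ! j)"
      by (rule code_ok[OF assms(5) order_refl]) (simp add: assms(2))
  qed
  finally show ?thesis .
qed

lemma code_at_self: "code_at M p (states M) p"
  unfolding code_at_def by (rule exI[of _ "[]"]) simp

lemma code_at_Seq:
  assumes "code_at M p a (Seq c d)"
  shows "code_at M p a c" "code_at M p (a + code_len c) d"
proof -
  from assms obtain pre post where
    p: "code p (states M) = pre @ (code c a @ code d (a + code_len c)) @ post" "a = states M + length pre"
    unfolding code_at_def by auto
  show "code_at M p a c" unfolding code_at_def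
    by (rule exI[of _ pre], rule exI[of _ "code d (a + code_len c) @ post"]) (simp add: p)
  show "code_at M p (a + code_len c) d" unfolding code_at_def
    by (rule exI[of _ "pre @ code c a"], rule exI[of _ post]) (simp add: p)
qed

lemma code_at_Cond:
  assumes "code_at M p a (Cond r P c d)"
  shows "code_at M p (a + 1) c" "code_at M p (a + code_len c + 2) d"
proof -
  from assms obtain pre post where
    p: "code p (states M) = pre @ code (Cond r P c d) a @ post" "a = states M + length pre"
    unfolding code_at_def by blast
  show "code_at M p (a + 1) c" unfolding code_at_def
    by (rule exI[of _ "pre @ [hd (code (Cond r P c d) a)]"], rule exI) (simp add: p)
  show "code_at M p (a + code_len c + 2) d" unfolding code_at_def
    by (rule exI[of _ "pre @ take (code_len c + 2) (code (Cond r P c d) a)"], rule exI[of _ post])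
      (simp add: p)
qed

lemma code_at_While:
  assumes "code_at M p a (While r P c)"
  shows "code_at M p (a + 1) c"
proof -
  from assms obtain pre post where
    p: "code p (states M) = pre @ code (While r P c) a @ post" "a = states M + length pre"
    unfolding code_at_def by blast
  show "code_at M p (a + 1) c" unfolding code_at_def
    by (rule exI[of _ "pre @ [hd (code (While r P c) a)]"], rule exI) (simp add: p)
qed

lemma code_at_branch:
  assumes "code_at M p a c" "length ts = tapes M + k" "\<forall>r\<in>R. \<rho> r < tapes M + k" "stk_regs c \<subseteq> R"
    and "code c a = IBranch r P e # is" "r \<in> R" "stacks_on \<rho> R s ts"
  shows "tm_step (tm_then M k \<rho> p) (a, ts) = (if P (peek (s r)) then a + 1 else e, ts)"
proof -
  have "0 < code_len c" using arg_cong[OF assms(5), of length] by simp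
  moreover have "sym_bit (scanned (ts ! \<rho> r)) = peek (s r)"
    using assms(6,7) by (intro scanned_tape_word) (simp add: stacks_on_def)
  ultimately show ?thesis
    using code_at_step[OF assms(1) _ assms(2,3,4), of 0] assms(5) by simp
qed

text \<open>The costs in \<open>stk_exec\<close> are exactly the numbers of machine steps, so the
  induction on the execution carries an equality of configurations and no estimates.\<close>

lemma tm_simulates_stk:
  assumes "stk_exec c s t s'" and inj: "inj_on \<rho> R" and \<rho>: "\<forall>r\<in>R. \<rho> r < tapes M + k"
    and "stk_regs c \<subseteq> R" "code_at M p a c" "length ts = tapes M + k" "stacks_on \<rho> R s ts"
  shows "\<exists>ts'. (tm_step (tm_then M k \<rho> p) ^^ t) (a, ts) = (a + code_len c, ts') \<and>
    length ts' = tapes M + k \<and> stacks_on \<rho> R s' ts'"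
  using assms(1,4-)
proof (induction arbitrary: a ts rule: stk_exec.induct)
  case (Nop s)
  then show ?case by simp
next
  case (Push r b s)
  have r: "r \<in> R" "tape_word (ts ! \<rho> r) (s r)" "\<rho> r < length ts"
    using Push.prems by (auto simp: stacks_on_def)
  define t1 where "t1 = act (scanned (ts ! \<rho> r), Move_Left) (ts ! \<rho> r)"
  let ?ts = "ts[\<rho> r := act (bit_symbol b, Stay) t1]"
  have "tm_step (tm_then M k \<rho> p) (a, ts) = (a + 1, ts[\<rho> r := t1])"
    using code_at_step[OF Push.prems(2) _ Push.prems(3) \<rho> Push.prems(1), of 0] by (simp add: t1_def)
  moreover have "tm_step (tm_then M k \<rho> p) (a + 1, ts[\<rho> r := t1]) = (a + 2, ?ts)"
    using code_at_step[OF Push.prems(2) _ _ \<rho> Push.prems(1), of 1 "ts[\<rho> r := t1]"] Push.prems(3) r(3)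
    by simp
  moreover have "stacks_on \<rho> R (s(r := b # s r)) ?ts"
    unfolding t1_def using Push.prems(4) inj r by (intro stacks_on_update tape_word_push)
  ultimately show ?case using Push.prems(3)
    by (simp add: eval_nat_numeral del: fun_upd_apply tm_step.simps)
next
  case (Pop r s)
  have r: "r \<in> R" "tape_word (ts ! \<rho> r) (s r)" "\<rho> r < length ts"
    using Pop.prems by (auto simp: stacks_on_def)
  let ?t = "act (scanned (ts ! \<rho> r), if peek (s r) = None then Stay else Move_Right) (ts ! \<rho> r)"
  have "tm_step (tm_then M k \<rho> p) (a, ts) = (a + 1, ts[\<rho> r := ?t])"
    using code_at_step[OF Pop.prems(2) _ Pop.prems(3) \<rho> Pop.prems(1), of 0]
    by (simp add: scanned_tape_word[OF r(2)])
  moreover have "stacks_on \<rho> R (s(r := tl (s r))) (ts[\<rho> r := ?t])"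
    using Pop.prems(4) inj r by (intro stacks_on_update tape_word_pop)
  ultimately show ?case using Pop.prems(3) by (simp del: fun_upd_apply tm_step.simps peek_eq_None)
next
  case (Seq c s t s' d t' s'')
  from Seq.IH(1)[OF _ code_at_Seq(1)[OF Seq.prems(2)] Seq.prems(3,4)] Seq.prems(1)
  obtain ts1 where ts1: "(tm_step (tm_then M k \<rho> p) ^^ t) (a, ts) = (a + code_len c, ts1)"
    "length ts1 = tapes M + k" "stacks_on \<rho> R s' ts1" by auto
  from Seq.IH(2)[OF _ code_at_Seq(2)[OF Seq.prems(2)] ts1(2,3)] Seq.prems(1)
  obtain ts2 where "(tm_step (tm_then M k \<rho> p) ^^ t') (a + code_len c, ts1) =
      (a + code_len c + code_len d, ts2)"
    "length ts2 = tapes M + k" "stacks_on \<rho> R s'' ts2" by auto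
  with ts1(1) show ?case by (simp add: add.commute[of t t'] funpow_add add.assoc)
next
  case (Cond_True P s r c t s' d)
  have 1: "tm_step (tm_then M k \<rho> p) (a, ts) = (a + 1, ts)"
    using code_at_branch[OF Cond_True.prems(2,3) \<rho> Cond_True.prems(1) code.simps(5) _ Cond_True.prems(4)]
      Cond_True.prems(1) Cond_True.hyps by simp
  from Cond_True.IH[OF _ code_at_Cond(1)[OF Cond_True.prems(2)] Cond_True.prems(3,4)] Cond_True.prems(1)
  obtain ts1 where ts1: "(tm_step (tm_then M k \<rho> p) ^^ t) (a + 1, ts) = (a + 1 + code_len c, ts1)"
    "length ts1 = tapes M + k" "stacks_on \<rho> R s' ts1" by auto
  have 2: "tm_step (tm_then M k \<rho> p) (a + 1 + code_len c, ts1) = (a + code_len (Cond r P c d), ts1)"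
    using code_at_step[OF Cond_True.prems(2) _ ts1(2) \<rho> Cond_True.prems(1), of "1 + code_len c"]
    by (simp add: nth_append add.assoc)
  \<comment> \<open>From right to left: the branch, the code of \<open>c\<close>, and the jump over
    the code of \<open>d\<close>.\<close>
  have "(tm_step (tm_then M k \<rho> p) ^^ (1 + (t + 1))) (a, ts) = (a + code_len (Cond r P c d), ts1)"
    unfolding funpow_add[of 1] funpow_Suc_right Suc_eq_plus1[symmetric] o_apply 1
    using ts1(1) 2 by simp
  with ts1 show ?case by auto
next
  case (Cond_False P s r d t s' c)
  have 1: "tm_step (tm_then M k \<rho> p) (a, ts) = (a + code_len c + 2, ts)"
    using code_at_branch[OF Cond_False.prems(2,3) \<rho> Cond_False.prems(1) code.simps(5) _ Cond_False.prems(4)]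
      Cond_False.prems(1) Cond_False.hyps by simp
  from Cond_False.IH[OF _ code_at_Cond(2)[OF Cond_False.prems(2)] Cond_False.prems(3,4)] Cond_False.prems(1)
  obtain ts1 where "(tm_step (tm_then M k \<rho> p) ^^ t) (a + code_len c + 2, ts) =
      (a + code_len c + 2 + code_len d, ts1)"
    "length ts1 = tapes M + k" "stacks_on \<rho> R s' ts1" by auto
  with 1 show ?case
    by (intro exI[of _ ts1]) (simp add: funpow_Suc_right add_ac del: funpow.simps tm_step.simps)
next
  case (While_False P s r c)
  have "tm_step (tm_then M k \<rho> p) (a, ts) = (a + code_len c + 2, ts)"
    using code_at_branch[OF While_False.prems(2,3) \<rho> While_False.prems(1) code.simps(6) _ While_False.prems(4)]
      While_False.prems(1) While_False.hyps by simp
  with While_False.prems show ?case by (simp add: add.assoc del: tm_step.simps)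
next
  case (While_True P s r c t s' t' s'')
  have 1: "tm_step (tm_then M k \<rho> p) (a, ts) = (a + 1, ts)"
    using code_at_branch[OF While_True.prems(2,3) \<rho> While_True.prems(1) code.simps(6) _ While_True.prems(4)]
      While_True.prems(1) While_True.hyps by simp
  from While_True.IH(1)[OF _ code_at_While[OF While_True.prems(2)] While_True.prems(3,4)] While_True.prems(1)
  obtain ts1 where ts1: "(tm_step (tm_then M k \<rho> p) ^^ t) (a + 1, ts) = (a + 1 + code_len c, ts1)"
    "length ts1 = tapes M + k" "stacks_on \<rho> R s' ts1" by auto
  have 2: "tm_step (tm_then M k \<rho> p) (a + 1 + code_len c, ts1) = (a, ts1)"
    using code_at_step[OF While_True.prems(2) _ ts1(2) \<rho> While_True.prems(1), of "1 + code_len c"]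
    by (simp add: nth_append add.assoc)
  from While_True.IH(2)[OF While_True.prems(1,2) ts1(2,3)]
  obtain ts2 where ts2: "(tm_step (tm_then M k \<rho> p) ^^ t') (a, ts1) = (a + code_len (While r P c), ts2)"
    "length ts2 = tapes M + k" "stacks_on \<rho> R s'' ts2" by blast
  \<comment> \<open>From right to left: the branch, the body, the jump back, and the remaining
    rounds.\<close>
  have "(tm_step (tm_then M k \<rho> p) ^^ (t' + (1 + (t + 1)))) (a, ts) = (a + code_len (While r P c), ts2)"
    unfolding funpow_add[of t'] funpow_add[of 1] funpow_Suc_right Suc_eq_plus1[symmetric] o_apply 1
    using ts1(1) 2 ts2(1) by simp
  moreover have "t' + (1 + (t + 1)) = t + t' + 2" by simp
  ultimately show ?case using ts2(2,3) by metis
qed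


section \<open>Configurations and output length of an arbitrary machine\<close>

definition wf_config :: "tm \<Rightarrow> tm_config \<Rightarrow> bool" where
  "wf_config M = (\<lambda>(q, ts). q \<le> states M \<and> length ts = tapes M \<and>
    (\<forall>t\<in>set ts. \<forall>i. fst t i < symbols M))"

lemma wf_config_init:
  assumes "wf_tm M"
  shows "wf_config M (tm_init M x)"
proof -
  have "3 \<le> symbols M" "2 \<le> tapes M" using assms by (simp_all add: wf_tm_def)
  then show ?thesis
    by (auto simp: wf_config_def tm_init_def blank_tape_def input_tape_def bit_symbol_less)
qed

text \<open>\<open>wf_tm\<close> restricts the transition function only on lists of admissible
  symbols, so the contents of all tapes have to be tracked along a run.\<close>

lemma wf_config_step:
  assumes M: "wf_tm M" and cfg: "wf_config M (q, ts)" and q: "q < states M"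
  obtains q' acts where "trans_fun M q (map scanned ts) = (q', acts)"
    "tm_step M (q, ts) = (q', map2 act acts ts)" "length acts = tapes M"
    "wf_config M (q', map2 act acts ts)"
proof -
  obtain q' acts where tr: "trans_fun M q (map scanned ts) = (q', acts)" by fastforce
  have len: "length ts = tapes M" and rng: "\<And>t i. t \<in> set ts \<Longrightarrow> fst t i < symbols M"
    using cfg by (simp_all add: wf_config_def)
  have "set (map scanned ts) \<subseteq> {..<symbols M}"
    using rng by (auto simp: scanned_def)
  then have "case trans_fun M q (map scanned ts) of (q', acts) \<Rightarrow>
      q' \<le> states M \<and> length acts = tapes M \<and> fst ` set acts \<subseteq> {..<symbols M}"
    by (intro M[unfolded wf_tm_def, THEN conjunct2, THEN conjunct2, THEN spec, THEN spec, THEN mp]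
      conjI q) (simp_all add: len)
  then have acts: "q' \<le> states M" "length acts = tapes M" "fst ` set acts \<subseteq> {..<symbols M}"
    by (simp_all add: tr)
  have "fst (act a t) i < symbols M" if "(a, t) \<in> set (zip acts ts)" for a t i
  proof -
    have "fst a < symbols M" "fst t i < symbols M"
      using acts(3) rng set_zip_leftD[OF that] set_zip_rightD[OF that] by auto
    then show ?thesis by (cases a; cases t) auto
  qed
  then have "wf_config M (q', map2 act acts ts)"
    using acts(1,2) len by (auto simp: wf_config_def simp del: act.simps)
  with tr q acts(2) show ?thesis by (intro that) simp_all
qed

lemma wf_config_funpow:
  assumes "wf_tm M"
  shows "wf_config M ((tm_step M ^^ t) (tm_init M x))"
proof (induction t)
  case 0
  show ?case using wf_config_init[OF assms] by simp
next
  case (Suc t)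
  obtain q ts where cfg: "(tm_step M ^^ t) (tm_init M x) = (q, ts)" by fastforce
  show ?case
  proof (cases "q < states M")
    case True
    with Suc cfg show ?thesis by (auto elim: wf_config_step[OF assms] simp del: tm_step.simps)
  next
    case False
    with Suc cfg show ?thesis by simp
  qed
qed

lemma finite_support_act:
  assumes "finite {i. fst t i \<noteq> 0}"
  shows "finite {i. fst (act a t) i \<noteq> 0} \<and> card {i. fst (act a t) i \<noteq> 0} \<le> Suc (card {i. fst t i \<noteq> 0})"
proof -
  have sub: "{i. fst (act a t) i \<noteq> 0} \<subseteq> insert (snd t) {i. fst t i \<noteq> 0}"
    by (cases a; cases t) (auto split: if_splits)
  with assms have "card {i. fst (act a t) i \<noteq> 0} \<le> card (insert (snd t) {i. fst t i \<noteq> 0})"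
    by (intro card_mono) auto
  also have "\<dots> \<le> Suc (card {i. fst t i \<noteq> 0})" using assms by (simp add: card_insert_if)
  finally show ?thesis using finite_subset[OF sub] assms by simp
qed

text \<open>Tape 1 exists and is blank at the start because there are at least two tapes; after that
  every step writes a single cell of it.\<close>

lemma output_support:
  assumes "wf_tm M" "(tm_step M ^^ t) (tm_init M x) = (q, ts)"
  shows "finite {i. fst (ts ! 1) i \<noteq> 0} \<and> card {i. fst (ts ! 1) i \<noteq> 0} \<le> t"
  using assms(2)
proof (induction t arbitrary: q ts)
  case 0
  have "2 \<le> tapes M" using assms(1) by (simp add: wf_tm_def)
  with 0 show ?case by (auto simp: tm_init_def blank_tape_def)
next
  case (Suc t)
  obtain q0 ts0 where cfg: "(tm_step M ^^ t) (tm_init M x) = (q0, ts0)" by fastforce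
  note IH = Suc.IH[OF cfg]
  have wf: "wf_config M (q0, ts0)" using wf_config_funpow[OF assms(1), of t x] cfg by simp
  show ?case
  proof (cases "q0 < states M")
    case True
    from wf_config_step[OF assms(1) wf True] obtain q' acts where
      "tm_step M (q0, ts0) = (q', map2 act acts ts0)" "length acts = tapes M" by metis
    moreover have "2 \<le> tapes M" "length ts0 = tapes M"
      using assms(1) wf by (simp_all add: wf_tm_def wf_config_def)
    ultimately have "ts ! 1 = act (acts ! 1) (ts0 ! 1)"
      using Suc.prems cfg by (auto simp del: tm_step.simps)
    with finite_support_act[of "ts0 ! 1" "acts ! 1"] IH show ?thesis by simp
  next
    case False
    with Suc.prems cfg have "ts = ts0" by simp
    with IH show ?thesis by simp
  qed
qed

text \<open>Bits are nonblank symbols, so the cells of the output are among those counted in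
  \<open>output_support\<close>. This limits the input of a program that is run afterwards.\<close>

lemma output_length:
  assumes "wf_tm M" "tm_computes M x y t"
  shows "length y \<le> t"
proof -
  obtain q ts where cfg: "(tm_step M ^^ t) (tm_init M x) = (q, ts)" by fastforce
  obtain h p where hp: "ts ! 1 = (h, p)" by fastforce
  have word: "h (p + int i) = bit_symbol (y ! i)" if "i < length y" for i
    using assms(2) cfg hp that by (simp add: tm_computes_def)
  have "length y = card ((\<lambda>i. p + int i) ` {..<length y})"
    by (subst card_image) (auto simp: inj_on_def)
  also have "\<dots> \<le> card {i. fst (ts ! 1) i \<noteq> 0}"
    using output_support[OF assms(1) cfg] word
    by (intro card_mono) (auto simp: hp[simplified] bit_symbol_def)
  also have "\<dots> \<le> t" using output_support[OF assms(1) cfg] by simp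
  finally show ?thesis .
qed

lemma halted_funpow: "(tm_step M ^^ t) (states M, ts) = (states M, ts)"
  by (induction t) simp_all

lemma funpow_split:
  assumes "m \<le> n"
  shows "(f ^^ n) x = (f ^^ (n - m)) ((f ^^ m) x)"
  using funpow_add[of "n - m" m f] assms by simp

text \<open>The combined machine enters the program as soon as \<open>M\<close> halts; the two runs
  therefore agree only up to the first moment of halting.\<close>

lemma tm_then_init:
  assumes M: "wf_tm M" and run: "\<And>i. i < t \<Longrightarrow> fst ((tm_step M ^^ i) (tm_init M x)) < states M"
    and cfg: "(tm_step M ^^ t) (tm_init M x) = (q, ts)"
  shows "(tm_step (tm_then M k \<rho> c) ^^ t) (tm_init (tm_then M k \<rho> c) x) = (q, ts @ replicate k blank_tape)"
  using run cfg
proof (induction t arbitrary: q ts)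
  case 0
  have "2 \<le> tapes M" using M by (simp add: wf_tm_def)
  then have "tapes M + k - 1 = (tapes M - 1) + k" by simp
  then have "tm_init (tm_then M k \<rho> c) x = (fst (tm_init M x), snd (tm_init M x) @ replicate k blank_tape)"
    by (simp only: tm_init_def tm_then_simps replicate_add append.simps fst_conv snd_conv)
  with 0 show ?case by simp
next
  case (Suc t)
  obtain q0 ts0 where cfg: "(tm_step M ^^ t) (tm_init M x) = (q0, ts0)" by fastforce
  have q0: "q0 < states M" using Suc.prems(1)[of t] cfg by simp
  have wf: "wf_config M (q0, ts0)" using wf_config_funpow[OF M, of t x] cfg by simp
  then have len: "length ts0 = tapes M" by (simp add: wf_config_def)
  from wf_config_step[OF M wf q0] obtain q' acts where step:
    "trans_fun M q0 (map scanned ts0) = (q', acts)"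
    "tm_step M (q0, ts0) = (q', map2 act acts ts0)" "length acts = tapes M" by metis
  have "map2 act (map (\<lambda>x. (x, Stay)) (map scanned (replicate k blank_tape))) (replicate k blank_tape) =
      replicate k blank_tape"
    using map2_act_id[of "replicate k blank_tape"] by (simp add: o_def)
  then have "tm_step (tm_then M k \<rho> c) (q0, ts0 @ replicate k blank_tape) =
      (q', map2 act acts ts0 @ replicate k blank_tape)"
    using q0 step len by (simp add: tm_then_def)
  moreover have "(tm_step (tm_then M k \<rho> c) ^^ t) (tm_init (tm_then M k \<rho> c) x) =
      (q0, ts0 @ replicate k blank_tape)"
    using Suc.prems(1) by (intro Suc.IH cfg) simp
  ultimately show ?case using Suc.prems(2) cfg step(2) by (simp del: tm_step.simps)
qed

text \<open>The register \<open>io\<close> lives on tape 1, the output tape of the given machine and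
  of the combined one, so nothing is copied in between. All other registers get new tapes, which are
  still blank when the program starts.\<close>

theorem fpt_computable_stk:
  fixes c :: "'r stk"
  assumes R: "fpt_computable_on I \<kappa> R"
    and c: "\<And>x. x \<in> I \<Longrightarrow> \<exists>t s. stk_exec c (\<lambda>r. if r = io then R x else []) t s \<and> s io = R' x \<and>
      t \<le> K * (length (R x) + 1) ^ d"
  shows "fpt_computable_on I \<kappa> R'"
proof -
  from R obtain M f e where M: "wf_tm M" and f: "computable f"
    and comp: "\<And>x. x \<in> I \<Longrightarrow> tm_computes M x (R x) (f (\<kappa> x) * (length x + 1) ^ e)"
    unfolding fpt_computable_on_def by blast
  have M2: "2 \<le> tapes M" using M by (simp add: wf_tm_def)
  define k where "k = card (stk_regs c - {io})"
  obtain g where g: "bij_betw g (stk_regs c - {io}) {..<k}"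
    using ex_bij_betw_finite_nat[of "stk_regs c - {io}"] finite_stk_regs[of c]
    by (auto simp: k_def atLeast0LessThan)
  define \<rho> where "\<rho> r = (if r = io then 1 else tapes M + g r)" for r
  let ?R = "insert io (stk_regs c)"
  have gk: "g r < k" if "r \<in> ?R" "r \<noteq> io" for r
    using that bij_betwE[OF g] by auto
  have inj: "inj_on \<rho> ?R"
    using g M2 by (auto simp: inj_on_def \<rho>_def bij_betw_def)
  have \<rho>: "\<forall>r\<in>?R. \<rho> r < tapes M + k" using gk M2 by (auto simp: \<rho>_def)
  let ?M = "tm_then M k \<rho> c"
  \<comment> \<open>If the machine takes time \<open>T\<close>, the program adds at most
    \<open>K * (T + 1) ^ d\<close>. Both summands fit into
    \<open>(K + 1) * (T + 1) ^ (d + 1)\<close>, and \<open>T + 1\<close> is at most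
    \<open>(f (\<kappa> x) + 1) * (length x + 1) ^ e\<close>.\<close>
  let ?f = "\<lambda>n. (K + 1) * (f n + 1) ^ (d + 1)"
  have "tm_computes ?M x (R' x) (?f (\<kappa> x) * (length x + 1) ^ (e * (d + 1)))" if x: "x \<in> I" for x
  proof -
    define T where "T = f (\<kappa> x) * (length x + 1) ^ e"
    let ?halted = "\<lambda>t. fst ((tm_step M ^^ t) (tm_init M x)) = states M"
    have T: "tm_computes M x (R x) T" using comp[OF x] by (simp add: T_def)
    then have "?halted T" by (auto simp: tm_computes_def)
    \<comment> \<open>\<open>T\<close> is only a time at which the machine has halted; the program
      starts at the first such time.\<close>
    define t0 where "t0 = (LEAST t. ?halted t)"
    have t0: "?halted t0" "t0 \<le> T"
      unfolding t0_def using \<open>?halted T\<close> by (rule LeastI, rule Least_le)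
    have run: "fst ((tm_step M ^^ i) (tm_init M x)) < states M" if "i < t0" for i
      using not_less_Least[of i ?halted] that wf_config_funpow[OF M, of i x]
      unfolding t0_def by (auto simp: wf_config_def)
    obtain ts where ts: "(tm_step M ^^ t0) (tm_init M x) = (states M, ts)"
      using t0(1) by (metis prod.collapse)
    note funpow_split[OF t0(2), of "tm_step M" "tm_init M x"]
    then have out: "tape_word (ts ! 1) (R x)"
      using T by (simp add: tm_computes_def ts halted_funpow)
    have len: "length ts = tapes M" using wf_config_funpow[OF M, of t0 x] ts by (simp add: wf_config_def)
    note init = tm_then_init[OF M run ts, where k = k and \<rho> = \<rho> and c = c]
    have on: "stacks_on \<rho> ?R (\<lambda>r. if r = io then R x else []) (ts @ replicate k blank_tape)"
      unfolding stacks_on_def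
    proof (intro ballI conjI)
      fix r assume r: "r \<in> ?R"
      show "\<rho> r < length (ts @ replicate k blank_tape)" using bspec[OF \<rho> r] len by simp
      show "tape_word ((ts @ replicate k blank_tape) ! \<rho> r) (if r = io then R x else [])"
        using gk[OF r] out M2 len by (auto simp: \<rho>_def nth_append blank_tape_def)
    qed
    from c[OF x] obtain t s where t: "stk_exec c (\<lambda>r. if r = io then R x else []) t s" "s io = R' x"
      "t \<le> K * (length (R x) + 1) ^ d" by blast
    from tm_simulates_stk[OF t(1) inj \<rho> _ code_at_self _ on] len
    obtain ts' where ts': "(tm_step ?M ^^ t) (states M, ts @ replicate k blank_tape) = (states ?M, ts')"
      "stacks_on \<rho> ?R s ts'" by auto
    have out': "tape_word (ts' ! 1) (R' x)" using ts'(2) t(2) by (auto simp: stacks_on_def \<rho>_def)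
    define T' where "T' = ?f (\<kappa> x) * (length x + 1) ^ (e * (d + 1))"
    have "t0 + t \<le> T + K * (T + 1) ^ d"
      using t0(2) t(3) output_length[OF M T]
      by (meson add_mono add_le_mono1 le_trans mult_le_mono2 power_mono zero_le)
    also have "\<dots> \<le> (T + 1) ^ (d + 1) + K * (T + 1) ^ (d + 1)"
    proof (intro add_mono mult_left_mono)
      show "T \<le> (T + 1) ^ (d + 1)" using self_le_power[of "T + 1" "d + 1"] by simp
      show "(T + 1) ^ d \<le> (T + 1) ^ (d + 1)" by (rule power_increasing) simp_all
    qed simp
    also have "\<dots> = (K + 1) * (T + 1) ^ (d + 1)" by simp
    also have "\<dots> \<le> (K + 1) * ((f (\<kappa> x) + 1) * (length x + 1) ^ e) ^ (d + 1)"
      by (intro mult_left_mono power_mono) (simp_all add: T_def)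
    also have "\<dots> = T'" by (simp only: T'_def power_mult_distrib power_mult mult.assoc)
    finally have le: "t0 + t \<le> T'" .
    \<comment> \<open>The output is required at exactly time \<open>T'\<close>; the run ends earlier
      and then rests in its halting configuration.\<close>
    have "(tm_step ?M ^^ T') (tm_init ?M x) =
        (tm_step ?M ^^ (T' - (t0 + t))) ((tm_step ?M ^^ t) ((tm_step ?M ^^ t0) (tm_init ?M x)))"
      by (simp only: funpow_split[OF le] add.commute[of t0] funpow_add o_apply)
    also have "\<dots> = (states ?M, ts')" using halted_funpow[where M = ?M] by (simp only: init ts'(1))
    finally show ?thesis using out' by (simp add: tm_computes_def T'_def)
  qed
  moreover have "computable ?f" by (rule computable_poly[OF f])
  moreover have "wf_tm ?M" using \<rho> by (intro wf_tm_then M) simp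
  ultimately show ?thesis unfolding fpt_computable_on_def by blast
qed


section \<open>Polynomial-time transducers\<close>

text \<open>
  \<open>rv\<close> are the read registers, \<open>ct\<close> the counters and \<open>out\<close> the output lists.
  Since only read registers control repetitions and only counters can be incremented, every such program runs in polynomial time.
\<close>

record st =
  inp :: "nat list"
  rv :: "nat \<Rightarrow> nat"
  ct :: "nat \<Rightarrow> nat"
  out :: "nat \<Rightarrow> nat list"

text \<open>\<open>(k, rs, cs)\<close> is the sum of \<open>k\<close>, the read registers \<open>rs\<close> and the counters \<open>cs\<close>.\<close>

type_synonym lexp = "nat \<times> nat list \<times> nat list"

definition leval :: "st \<Rightarrow> lexp \<Rightarrow> nat" where
  "leval s = (\<lambda>(k, rs, cs). k + sum_list (map (rv s) rs) + sum_list (map (ct s) cs))"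

datatype prg =
    Read nat
  | Clear nat
  | Inc nat
  | Emit nat "lexp list"
  | Then prg prg  (infixr \<open>;;\<close> 60)
  | Repeat nat prg
  | IfLess lexp lexp prg prg
  | WhileRead nat prg

definition read :: "nat \<Rightarrow> st \<Rightarrow> st" where
  "read r s = s\<lparr>inp := tl (inp s), rv := (rv s)(r := (case inp s of [] \<Rightarrow> 0 | n # _ \<Rightarrow> n))\<rparr>"

primrec sem :: "prg \<Rightarrow> st \<Rightarrow> st" where
  "sem (Read r) s = read r s"
| "sem (Clear c) s = s\<lparr>ct := (ct s)(c := 0)\<rparr>"
| "sem (Inc c) s = s\<lparr>ct := (ct s)(c := Suc (ct s c))\<rparr>"
| "sem (Emit i es) s = s\<lparr>out := (out s)(i := out s i @ map (leval s) es)\<rparr>"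
| "sem (p ;; q) s = sem q (sem p s)"
| "sem (Repeat r p) s = (sem p ^^ rv s r) s"
| "sem (IfLess d e p q) s = (if leval s d < leval s e then sem p s else sem q s)"
| "sem (WhileRead r p) s = ((\<lambda>s. if inp s = [] then s else sem p (read r s)) ^^ length (inp s)) s"

definition st_init :: "nat list \<Rightarrow> st" where
  "st_init ns = \<lparr>inp = ns, rv = \<lambda>_. 0, ct = \<lambda>_. 0, out = \<lambda>_. []\<rparr>"

text \<open>There are several output lists because the number of tuples of a relation stands in
  front of them but is known only after they have been written.\<close>

definition result :: "nat \<Rightarrow> prg \<Rightarrow> nat list \<Rightarrow> nat list" where
  "result k p ns = concat (map (out (sem p (st_init ns))) [0..<k])"


subsection \<open>Translation to stack programs\<close>

datatype reg = Inp | TmpA | TmpB | TmpC | RV nat | CT nat | OUT nat | LP nat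

abbreviation nonempty :: "bool option \<Rightarrow> bool" where
  "nonempty v \<equiv> v \<noteq> None"

definition clear_stk :: "reg \<Rightarrow> reg stk" where
  "clear_stk r = While r nonempty (Pop r)"

definition read_stk :: "reg \<Rightarrow> reg stk" where
  "read_stk r = Seq (clear_stk r)
     (Seq (While Inp (\<lambda>v. v = Some True) (Seq (Pop Inp) (Push r True))) (Pop Inp))"

text \<open>A stack can be read only by emptying it, so its content is parked on \<open>TmpC\<close>
  and then restored.\<close>

definition add_stk :: "reg \<Rightarrow> reg \<Rightarrow> reg stk" where
  "add_stk r d = Seq (While r nonempty (Seq (Pop r) (Seq (Push TmpC True) (Push d True))))
     (While TmpC nonempty (Seq (Pop TmpC) (Push r True)))"

primrec const_stk :: "nat \<Rightarrow> reg \<Rightarrow> reg stk" where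
  "const_stk 0 d = Nop"
| "const_stk (Suc k) d = Seq (Push d True) (const_stk k d)"

primrec adds_stk :: "reg list \<Rightarrow> reg \<Rightarrow> reg stk" where
  "adds_stk [] d = Nop"
| "adds_stk (r # rs) d = Seq (add_stk r d) (adds_stk rs d)"

definition lexp_stk :: "lexp \<Rightarrow> reg \<Rightarrow> reg stk" where
  "lexp_stk = (\<lambda>(k, rs, cs) d. Seq (const_stk k d) (adds_stk (map RV rs @ map CT cs) d))"

primrec emit_stk :: "lexp list \<Rightarrow> reg \<Rightarrow> reg stk" where
  "emit_stk [] d = Nop"
| "emit_stk (e # es) d = Seq (lexp_stk e d) (Seq (Push d False) (emit_stk es d))"

text \<open>The number is the nesting depth of repetitions, each of which has its own loop stack.\<close>

primrec prg_stk :: "prg \<Rightarrow> nat \<Rightarrow> reg stk" where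
  "prg_stk (Read r) n = read_stk (RV r)"
| "prg_stk (Clear c) n = clear_stk (CT c)"
| "prg_stk (Inc c) n = Push (CT c) True"
| "prg_stk (Emit i es) n = emit_stk es (OUT i)"
| "prg_stk (p ;; q) n = Seq (prg_stk p n) (prg_stk q n)"
| "prg_stk (Repeat r p) n = Seq (add_stk (RV r) (LP n))
     (While (LP n) nonempty (Seq (Pop (LP n)) (prg_stk p (Suc n))))"
| "prg_stk (IfLess d e p q) n = Seq (lexp_stk d TmpA) (Seq (lexp_stk e TmpB)
     (Seq (While TmpA nonempty (Seq (Pop TmpA) (Pop TmpB)))
       (Cond TmpB nonempty (Seq (clear_stk TmpB) (prg_stk p n)) (prg_stk q n))))"
| "prg_stk (WhileRead r p) n = While Inp nonempty (Seq (read_stk (RV r)) (prg_stk p n))"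

section \<open>Time bounds for the translated programs\<close>

definition runs :: "'r stk \<Rightarrow> ('r \<Rightarrow> word) \<Rightarrow> nat \<Rightarrow> ('r \<Rightarrow> word) \<Rightarrow> bool" where
  "runs c s T s' \<longleftrightarrow> (\<exists>t\<le>T. stk_exec c s t s')"

lemma runsI: "stk_exec c s t s' \<Longrightarrow> t \<le> T \<Longrightarrow> runs c s T s'"
  by (auto simp: runs_def)

lemma runsE:
  assumes "runs c s T s'"
  obtains t where "stk_exec c s t s'" "t \<le> T"
  using assms by (auto simp: runs_def)

lemma runs_weaken: "runs c s T s' \<Longrightarrow> T \<le> T' \<Longrightarrow> s' = s'' \<Longrightarrow> runs c s T' s''"
  by (elim runsE) (auto intro: runsI)

lemma runs_Nop: "runs Nop s 0 s"
  by (rule runsI[OF stk_exec.Nop order_refl])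

lemma runs_Push: "runs (Push r b) s 2 (s(r := b # s r))"
  by (rule runsI[OF stk_exec.Push order_refl])

lemma runs_Pop: "runs (Pop r) s 1 (s(r := tl (s r)))"
  by (rule runsI[OF stk_exec.Pop order_refl])

lemma runs_Seq: "runs c s T s' \<Longrightarrow> runs d s' T' s'' \<Longrightarrow> runs (Seq c d) s (T + T') s''"
  by (elim runsE) (rule runsI[OF stk_exec.Seq add_mono])

lemma runs_Cond:
  assumes "P (peek (s r)) \<Longrightarrow> runs c s T s'" "\<not> P (peek (s r)) \<Longrightarrow> runs d s T s'"
  shows "runs (Cond r P c d) s (T + 2) s'"
proof (cases "P (peek (s r))")
  case True
  from assms(1)[OF True] show ?thesis
    by (rule runsE) (rule runsI, rule stk_exec.Cond_True[where P = P], simp_all add: True)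
next
  case False
  from assms(2)[OF False] show ?thesis
    by (rule runsE) (rule runsI, rule stk_exec.Cond_False[where P = P], use False in auto)
qed

text \<open>\<open>S\<close> is the sequence of states between rounds. A round costs two steps
  beyond its body, for the test and the jump back, and the failing test costs one.\<close>

lemma runs_While:
  assumes "\<And>i. i < n \<Longrightarrow> P (peek (S i r))" "\<And>i. i < n \<Longrightarrow> runs c (S i) X (S (Suc i))"
    and "\<not> P (peek (S n r))"
  shows "runs (While r P c) (S 0) (n * (X + 2) + 1) (S n)"
  using assms
proof (induction n arbitrary: S)
  case 0
  then show ?case by (simp add: runsI[OF stk_exec.While_False])
next
  case (Suc n)
  have "runs (While r P c) (S (Suc 0)) (n * (X + 2) + 1) (S (Suc n))"
    using Suc.prems by (intro Suc.IH[of "\<lambda>i. S (Suc i)"]) auto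
  then obtain t' where t': "stk_exec (While r P c) (S (Suc 0)) t' (S (Suc n))" "t' \<le> n * (X + 2) + 1"
    by (rule runsE)
  from Suc.prems(2)[of 0] obtain t where t: "stk_exec c (S 0) t (S (Suc 0))" "t \<le> X"
    by (auto elim: runsE)
  from t t' show ?case
    by (intro runsI[OF stk_exec.While_True[OF Suc.prems(1) t(1) t'(1)]]) simp_all
qed

lemma runs_clear: "runs (clear_stk r) s (3 * length (s r) + 1) (s(r := []))"
proof -
  have "runs (While r nonempty (Pop r)) ((\<lambda>i. s(r := drop i (s r))) 0) (length (s r) * (1 + 2) + 1)
      ((\<lambda>i. s(r := drop i (s r))) (length (s r)))"
    by (rule runs_While) (auto intro!: runs_weaken[OF runs_Pop] simp: drop_Suc tl_drop)
  from runs_weaken[OF this] show ?thesis by (simp add: clear_stk_def)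
qed

lemma replicate_diff_Suc: "i < n \<Longrightarrow> replicate (n - i) x = x # replicate (n - Suc i) x"
  by (metis Suc_diff_Suc replicate_Suc)

lemma runs_read:
  assumes "r \<noteq> Inp" "s Inp = code_nats ns"
  shows "runs (read_stk r) s (3 * length (s r) + 5 * length (s Inp) + 3)
    (s(r := replicate (case ns of [] \<Rightarrow> 0 | n # _ \<Rightarrow> n) True, Inp := code_nats (tl ns)))"
proof -
  \<comment> \<open>On an exhausted input \<open>n\<close> is 0, \<open>w\<close> is empty and the
    final pop has no effect, which matches the value 0 given by \<open>read\<close>.\<close>
  define n where "n = (case ns of [] \<Rightarrow> 0 | n # _ \<Rightarrow> n)"
  define w where "w = (case ns of [] \<Rightarrow> [] | _ # ns \<Rightarrow> False # code_nats ns)"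
  have sInp: "s Inp = replicate n True @ w" "tl w = code_nats (tl ns)"
    using assms(2) by (auto simp: n_def w_def code_nats_simps split: list.splits)
  have w: "peek w \<noteq> Some True" by (auto simp: w_def split: list.splits)
  define S where "S i = s(r := replicate i True, Inp := replicate (n - i) True @ w)" for i
  have "runs (While Inp (\<lambda>v. v = Some True) (Seq (Pop Inp) (Push r True))) (S 0) (n * ((1 + 2) + 2) + 1) (S n)"
  proof (rule runs_While)
    show "runs (Seq (Pop Inp) (Push r True)) (S i) (1 + 2) (S (Suc i))" if "i < n" for i
      using assms(1) that
      by (intro runs_weaken[OF runs_Seq[OF runs_Pop runs_Push]])
        (auto simp: S_def replicate_diff_Suc fun_eq_iff)
  qed (use assms(1) w in \<open>auto simp: S_def replicate_diff_Suc\<close>)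
  moreover have "S 0 = s(r := [])" using assms(1) sInp(1) by (auto simp: S_def fun_eq_iff)
  ultimately have "runs (While Inp (\<lambda>v. v = Some True) (Seq (Pop Inp) (Push r True)))
      (s(r := [])) (n * ((1 + 2) + 2) + 1) (S n)" by simp
  note runs_Seq[OF runs_clear[of r s] runs_Seq[OF this runs_Pop[of Inp]]]
  then show ?thesis unfolding read_stk_def n_def[symmetric]
    by (rule runs_weaken) (use sInp assms(1) in \<open>auto simp: S_def\<close>)
qed

lemma replicate_append_commute:
  "replicate m x @ replicate n x @ xs = replicate n x @ replicate m x @ xs"
  by (metis add.commute append_assoc replicate_add)

lemma runs_add:
  assumes "s r = replicate n True" "s TmpC = []" "r \<noteq> TmpC" "d \<noteq> TmpC" "r \<noteq> d"
  shows "runs (add_stk r d) s (12 * n + 2) (s(d := replicate n True @ s d))"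
proof -
  define S where "S i = s(r := replicate (n - i) True, TmpC := replicate i True,
    d := replicate i True @ s d)" for i
  have 1: "runs (While r nonempty (Seq (Pop r) (Seq (Push TmpC True) (Push d True)))) (S 0)
      (n * ((1 + (2 + 2)) + 2) + 1) (S n)"
  proof (rule runs_While)
    show "runs (Seq (Pop r) (Seq (Push TmpC True) (Push d True))) (S i) (1 + (2 + 2)) (S (Suc i))"
      if "i < n" for i
      using assms that
      by (intro runs_weaken[OF runs_Seq[OF runs_Pop runs_Seq[OF runs_Push runs_Push]]])
        (auto simp: S_def replicate_diff_Suc fun_eq_iff)
  qed (use assms in \<open>auto simp: S_def replicate_diff_Suc\<close>)
  define S' where "S' i = s(r := replicate i True, TmpC := replicate (n - i) True,
    d := replicate n True @ s d)" for i
  have 2: "runs (While TmpC nonempty (Seq (Pop TmpC) (Push r True))) (S' 0) (n * ((1 + 2) + 2) + 1) (S' n)"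
  proof (rule runs_While)
    show "runs (Seq (Pop TmpC) (Push r True)) (S' i) (1 + 2) (S' (Suc i))" if "i < n" for i
      using assms that
      by (intro runs_weaken[OF runs_Seq[OF runs_Pop runs_Push]])
        (auto simp: S'_def replicate_diff_Suc fun_eq_iff)
  qed (use assms in \<open>auto simp: S'_def replicate_diff_Suc\<close>)
  have "S n = S' 0" "S 0 = s" "S' n = s(d := replicate n True @ s d)"
    using assms by (auto simp: S_def S'_def fun_eq_iff)
  with runs_Seq[OF 1[unfolded this] 2] show ?thesis unfolding add_stk_def
    by (auto intro: runs_weaken)
qed

lemma runs_const: "runs (const_stk k d) s (2 * k) (s(d := replicate k True @ s d))"
proof (induction k arbitrary: s)
  case 0
  show ?case by (auto intro: runs_weaken[OF runs_Nop])
next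
  case (Suc k)
  show ?case unfolding const_stk.simps
    by (rule runs_weaken[OF runs_Seq[OF runs_Push Suc]]) (auto simp: replicate_app_Cons_same)
qed

lemma runs_adds:
  assumes "\<And>r. r \<in> set rs \<Longrightarrow> s r = replicate (f r) True \<and> r \<noteq> TmpC \<and> r \<noteq> d"
    "s TmpC = []" "d \<noteq> TmpC"
  shows "runs (adds_stk rs d) s (\<Sum>r\<leftarrow>rs. 12 * f r + 2)
    (s(d := replicate (\<Sum>r\<leftarrow>rs. f r) True @ s d))"
  using assms
proof (induction rs arbitrary: s)
  case Nil
  show ?case by (auto intro: runs_weaken[OF runs_Nop])
next
  case (Cons r rs)
  let ?s = "s(d := replicate (f r) True @ s d)"
  have 1: "runs (add_stk r d) s (12 * f r + 2) ?s"
    using Cons.prems(1)[of r] Cons.prems(2,3) by (intro runs_add) auto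
  have "runs (adds_stk rs d) ?s (\<Sum>r\<leftarrow>rs. 12 * f r + 2)
      (?s(d := replicate (\<Sum>r\<leftarrow>rs. f r) True @ ?s d))"
    using Cons.prems by (intro Cons.IH) auto
  from runs_Seq[OF 1 this] show ?case unfolding adds_stk.simps
    by (rule runs_weaken) (auto simp: replicate_add fun_eq_iff replicate_append_commute)
qed

text \<open>Output stacks hold their codes backwards, since symbols are pushed in the order in which
  they are to be read. Scratch stacks are empty between statements, and \<open>ls\<close> gives the
  rounds left in the enclosing loops.\<close>

primrec enc :: "(nat \<Rightarrow> nat) \<Rightarrow> st \<Rightarrow> reg \<Rightarrow> word" where
  "enc ls s Inp = code_nats (inp s)"
| "enc ls s TmpA = []"
| "enc ls s TmpB = []"
| "enc ls s TmpC = []"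
| "enc ls s (RV r) = replicate (rv s r) True"
| "enc ls s (CT c) = replicate (ct s c) True"
| "enc ls s (OUT i) = rev (code_nats (out s i))"
| "enc ls s (LP n) = replicate (ls n) True"

definition lexp_time :: "nat \<Rightarrow> nat \<Rightarrow> lexp \<Rightarrow> nat" where
  "lexp_time m c = (\<lambda>(k, rs, cs). 2 * k + length rs * (12 * m + 2) + length cs * (12 * c + 2))"

text \<open>Read registers only ever receive numbers from the input, so \<open>m\<close> is kept
  throughout a run. The bound \<open>c\<close> on the counters grows and is therefore a separate
  parameter.\<close>

definition bounded :: "nat \<Rightarrow> nat \<Rightarrow> st \<Rightarrow> bool" where
  "bounded m c s \<longleftrightarrow> length (code_nats (inp s)) \<le> m \<and> (\<forall>r. rv s r \<le> m) \<and> (\<forall>i. ct s i \<le> c)"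

lemma sum_list_bounded: "(\<And>x. x \<in> set xs \<Longrightarrow> f x \<le> (B::nat)) \<Longrightarrow> (\<Sum>x\<leftarrow>xs. f x) \<le> length xs * B"
  by (induction xs) (auto simp: add_mono)

lemma runs_lexp:
  assumes "bounded m c s" "d \<in> {TmpA, TmpB} \<union> range OUT"
    and S: "\<And>r. r \<in> range RV \<union> range CT \<union> {TmpC} \<Longrightarrow> S r = enc ls s r"
  shows "runs (lexp_stk e d) S (lexp_time m c e) (S(d := replicate (leval s e) True @ S d))"
proof -
  obtain k rs cs where e: "e = (k, rs, cs)" by (cases e)
  let ?S = "S(d := replicate k True @ S d)"
  define f where "f r = (case r of RV i \<Rightarrow> rv s i | CT i \<Rightarrow> ct s i | _ \<Rightarrow> 0)" for r
  have "runs (adds_stk (map RV rs @ map CT cs) d) ?S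
      (\<Sum>r\<leftarrow>map RV rs @ map CT cs. 12 * f r + 2)
      (?S(d := replicate (\<Sum>r\<leftarrow>map RV rs @ map CT cs. f r) True @ ?S d))"
    using assms(2) S by (intro runs_adds) (auto simp: f_def)
  moreover have "(\<Sum>r\<leftarrow>map RV rs @ map CT cs. 12 * f r + 2) \<le> length rs * (12 * m + 2) + length cs * (12 * c + 2)"
    using assms(1) sum_list_bounded[of rs "\<lambda>i. 12 * rv s i + 2" "12 * m + 2"]
      sum_list_bounded[of cs "\<lambda>i. 12 * ct s i + 2" "12 * c + 2"]
    by (simp add: f_def o_def bounded_def)
  ultimately show ?thesis unfolding e lexp_stk_def lexp_time_def prod.case
    by (intro runs_weaken[OF runs_Seq[OF runs_const]])
      (auto simp: leval_def f_def o_def replicate_add fun_eq_iff replicate_append_commute)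
qed

lemma code_nats_append [simp]: "code_nats (ms @ ns) = code_nats ms @ code_nats ns"
  by (simp add: code_nats_def)

lemma runs_emit:
  assumes "bounded m c s"
    and S: "\<And>r. r \<in> range RV \<union> range CT \<union> {TmpC} \<Longrightarrow> S r = enc ls s r" "S (OUT i) = rev (code_nats ns)"
  shows "runs (emit_stk es (OUT i)) S (\<Sum>e\<leftarrow>es. lexp_time m c e + 2)
    (S(OUT i := rev (code_nats (ns @ map (leval s) es))))"
  using S
proof (induction es arbitrary: S ns)
  case Nil
  then show ?case by (auto intro: runs_weaken[OF runs_Nop] simp: fun_eq_iff)
next
  case (Cons e es)
  let ?S = "S(OUT i := rev (code_nats (ns @ [leval s e])))"
  have "runs (emit_stk es (OUT i)) ?S (\<Sum>e\<leftarrow>es. lexp_time m c e + 2)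
      (?S(OUT i := rev (code_nats ((ns @ [leval s e]) @ map (leval s) es))))"
    using Cons.prems by (intro Cons.IH) auto
  moreover have "runs (lexp_stk e (OUT i)) S (lexp_time m c e)
      (S(OUT i := replicate (leval s e) True @ S (OUT i)))"
    using Cons.prems by (intro runs_lexp[OF assms(1)]) auto
  moreover have "(S(OUT i := replicate (leval s e) True @ S (OUT i)))
      (OUT i := False # (S(OUT i := replicate (leval s e) True @ S (OUT i))) (OUT i)) = ?S"
    using Cons.prems(2) by (simp add: code_nats_simps fun_eq_iff)
  ultimately show ?case
    using runs_Push[of "OUT i" False "S(OUT i := replicate (leval s e) True @ S (OUT i))"]
    by (auto intro!: runs_weaken[OF runs_Seq[OF _ runs_Seq]] simp del: fun_upd_apply)
qed

primrec incs :: "prg \<Rightarrow> nat \<Rightarrow> nat" where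
  "incs (Read r) m = 0"
| "incs (Clear c) m = 0"
| "incs (Inc c) m = 1"
| "incs (Emit i es) m = 0"
| "incs (p ;; q) m = incs p m + incs q m"
| "incs (Repeat r p) m = m * incs p m"
| "incs (IfLess d e p q) m = incs p m + incs q m"
| "incs (WhileRead r p) m = m * incs p m"

text \<open>Every round of a loop is charged with the counter bound that holds at its end. In
  \<open>IfLess\<close>, a value is computed once and then popped again: the comparison takes 4
  steps for each unit of the first value, and clearing 3 for each unit of the second, hence the
  factors 5 and 4.\<close>

primrec prg_time :: "prg \<Rightarrow> nat \<Rightarrow> nat \<Rightarrow> nat" where
  "prg_time (Read r) m c = 8 * m + 3"
| "prg_time (Clear i) m c = 3 * c + 1"
| "prg_time (Inc i) m c = 2"
| "prg_time (Emit i es) m c = (\<Sum>e\<leftarrow>es. lexp_time m c e + 2)"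
| "prg_time (p ;; q) m c = prg_time p m c + prg_time q m (c + incs p m)"
| "prg_time (Repeat r p) m c = 12 * m + 2 + (m * (prg_time p m (c + m * incs p m) + 3) + 1)"
| "prg_time (IfLess d e p q) m c = 5 * lexp_time m c d + 4 * lexp_time m c e + 4 +
     prg_time p m c + prg_time q m c"
| "prg_time (WhileRead r p) m c = m * (8 * m + prg_time p m (c + m * incs p m) + 5) + 1"

lemma length_le_code_nats: "length ns \<le> length (code_nats ns)"
  by (induction ns) (auto simp: code_nats_simps)

lemma length_inp_bounded: "bounded m c s \<Longrightarrow> length (inp s) \<le> m"
  using length_le_code_nats[of "inp s"] by (simp add: bounded_def)

lemma bounded_mono: "bounded m c s \<Longrightarrow> c \<le> c' \<Longrightarrow> bounded m c' s"
  unfolding bounded_def by (meson order_trans)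

lemma bounded_read:
  assumes "bounded m c s"
  shows "bounded m c (read r s)"
  using assms by (auto simp: bounded_def read_def code_nats_simps split: list.split)

text \<open>A comparison pops the values bit by bit, so its cost needs a bound on the values as well
  as on their computation.\<close>

lemma leval_le_lexp_time:
  assumes "bounded m c s"
  shows "leval s e \<le> lexp_time m c e"
proof -
  obtain k rs cs where "e = (k, rs, cs)" by (cases e)
  moreover have "(\<Sum>i\<leftarrow>rs. rv s i) \<le> length rs * (12 * m + 2)"
    using assms by (intro sum_list_bounded) (auto simp: bounded_def intro: le_trans[of _ m])
  moreover have "(\<Sum>i\<leftarrow>cs. ct s i) \<le> length cs * (12 * c + 2)"
    using assms by (intro sum_list_bounded) (auto simp: bounded_def intro: le_trans[of _ c])
  ultimately show ?thesis by (simp add: leval_def lexp_time_def)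
qed

definition read_step :: "nat \<Rightarrow> prg \<Rightarrow> st \<Rightarrow> st" where
  "read_step r p s = (if inp s = [] then s else sem p (read r s))"

lemma sem_WhileRead: "sem (WhileRead r p) s = (read_step r p ^^ length (inp s)) s"
  by (simp add: read_step_def[abs_def])

lemma funpow_bounded:
  assumes "\<And>c s. bounded m c s \<Longrightarrow> bounded m (c + k) (f s)" "bounded m c s"
  shows "bounded m (c + n * k) ((f ^^ n) s)"
proof (induction n)
  case (Suc n)
  from assms(1)[OF Suc] show ?case by (simp add: add_ac)
qed (use assms(2) in simp)

lemma bounded_sem: "bounded m c s \<Longrightarrow> bounded m (c + incs p m) (sem p s)"
proof (induction p arbitrary: c s)
  case (Inc i)
  then show ?case by (auto simp: bounded_def le_SucI)
next
  case (Then p q)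
  then show ?case by (simp add: add.assoc[symmetric])
next
  case (Repeat r p)
  have "bounded m (c + rv s r * incs p m) ((sem p ^^ rv s r) s)"
    by (rule funpow_bounded[OF Repeat.IH Repeat.prems])
  moreover have "rv s r \<le> m" using Repeat.prems by (simp add: bounded_def)
  ultimately show ?case by (auto elim!: bounded_mono)
next
  case (IfLess d e p q)
  from IfLess.IH(1)[OF IfLess.prems] IfLess.IH(2)[OF IfLess.prems]
  show ?case by (auto elim!: bounded_mono)
next
  case (WhileRead r p)
  have "bounded m (c + incs p m) (read_step r p s)" if "bounded m c s" for c s
    using WhileRead.IH[OF bounded_read[OF that]] that by (auto simp: read_step_def elim: bounded_mono)
  from funpow_bounded[of m, OF this WhileRead.prems]
  have "bounded m (c + length (inp s) * incs p m) (sem (WhileRead r p) s)"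
    unfolding sem_WhileRead .
  moreover note length_inp_bounded[OF WhileRead.prems]
  ultimately show ?case by (auto elim!: bounded_mono)
qed (auto simp: bounded_read, auto simp: bounded_def)

text \<open>Ensures that the initial read of a \<open>WhileRead\<close> round shortens the input for
  good, whatever the body does.\<close>

lemma length_inp_sem: "length (inp (sem p s)) \<le> length (inp s)"
proof (induction p arbitrary: s)
  case (Then p q)
  then show ?case by (auto intro: le_trans)
next
  case (Repeat r p)
  have "length (inp ((sem p ^^ n) s)) \<le> length (inp s)" for n
    by (induction n) (auto intro: le_trans Repeat.IH)
  then show ?case by simp
next
  case (WhileRead r p)
  have "length (inp (read_step r p s)) \<le> length (inp s)" for s
    using WhileRead.IH[of "read r s"] by (auto simp: read_step_def read_def)
  then have "length (inp ((read_step r p ^^ n) s)) \<le> length (inp s)" for n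
    by (induction n) (auto intro: le_trans)
  then show ?case unfolding sem_WhileRead .
qed (auto simp: read_def)

lemma read_step_shorter:
  assumes "inp s \<noteq> []"
  shows "length (inp (read_step r p s)) < length (inp s)"
  using assms length_inp_sem[of p "read r s"] by (cases "inp s") (auto simp: read_step_def read_def)

lemma read_steps_exhaust: "length (inp s) \<le> n \<Longrightarrow> inp ((read_step r p ^^ n) s) = []"
proof (induction n arbitrary: s)
  case (Suc n)
  show ?case
  proof (cases "inp s = []")
    case True
    then have "read_step r p s = s" by (simp add: read_step_def)
    with Suc.IH[of s] True show ?thesis by (simp add: funpow_swap1)
  next
    case False
    with read_step_shorter[OF False, of r p] Suc.prems show ?thesis
      by (simp add: funpow_swap1 Suc.IH)
  qed
qed simp

lemma read_step_fix: "inp s = [] \<Longrightarrow> (read_step r p ^^ n) s = s"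
  by (induction n) (simp_all add: read_step_def)

text \<open>Both \<open>n\<close> rounds and as many rounds as the input is long exhaust the input,
  and a round without input changes nothing. As powers of one function commute, both lead to the
  same state.\<close>

lemma read_steps_eq:
  assumes "inp ((read_step r p ^^ n) s) = []"
  shows "sem (WhileRead r p) s = (read_step r p ^^ n) s"
proof -
  let ?f = "read_step r p" and ?k = "length (inp s)"
  have "(?f ^^ n) s = (?f ^^ ?k) ((?f ^^ n) s)" using read_step_fix[OF assms] by simp
  also have "\<dots> = (?f ^^ n) ((?f ^^ ?k) s)" by (simp only: funpow_add[symmetric] add.commute flip: o_apply[of "?f ^^ _"])
  also have "\<dots> = (?f ^^ ?k) s" using read_step_fix[OF read_steps_exhaust[OF order_refl]] by simp
  finally show ?thesis unfolding sem_WhileRead ..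
qed

lemma enc_read:
  "(enc ls s)(RV r := replicate (case inp s of [] \<Rightarrow> 0 | n # _ \<Rightarrow> n) True, Inp := code_nats (tl (inp s))) =
   enc ls (read r s)"
  by (intro ext, rename_tac x, case_tac x) (auto simp: read_def)

text \<open>Loop stacks from depth \<open>n\<close> on must be empty, as \<open>prg_stk p n\<close>
  uses them; those below belong to the enclosing loops and are left alone.\<close>

lemma runs_prg:
  assumes "bounded m c s" "\<And>i. n \<le> i \<Longrightarrow> ls i = 0"
  shows "runs (prg_stk p n) (enc ls s) (prg_time p m c) (enc ls (sem p s))"
  using assms
proof (induction p arbitrary: n ls c s)
  case (Read r)
  have "3 * length (enc ls s (RV r)) + 5 * length (enc ls s Inp) + 3 \<le> 8 * m + 3"
    using Read.prems(1) add_mono[of "3 * rv s r" "3 * m" "5 * length (code_nats (inp s))" "5 * m"]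
    by (simp add: bounded_def)
  then show ?case
    using runs_weaken[OF runs_read[where s = "enc ls s" and r = "RV r" and ns = "inp s"], OF _ _ _ enc_read] by simp
next
  case (Clear i)
  have "(enc ls s)(CT i := []) = enc ls (sem (Clear i) s)"
    by (intro ext, rename_tac x, case_tac x) auto
  moreover have "3 * length (enc ls s (CT i)) + 1 \<le> 3 * c + 1" using Clear.prems(1) by (simp add: bounded_def)
  ultimately show ?case using runs_weaken[OF runs_clear[of "CT i" "enc ls s"]] by simp
next
  case (Inc i)
  have "(enc ls s)(CT i := True # enc ls s (CT i)) = enc ls (sem (Inc i) s)"
    by (intro ext, rename_tac x, case_tac x) auto
  then show ?case using runs_weaken[OF runs_Push[of "CT i" True "enc ls s"]] by simp
next
  case (Emit i es)
  have "(enc ls s)(OUT i := rev (code_nats (out s i @ map (leval s) es))) = enc ls (sem (Emit i es) s)"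
    by (intro ext, rename_tac x, case_tac x) auto
  then show ?case
    using runs_weaken[OF runs_emit[OF Emit.prems(1), where S = "enc ls s" and ls = ls and i = i and es = es and ns = "out s i"]]
    by simp
next
  case (Then p q)
  from runs_Seq[OF Then.IH(1)[OF Then.prems] Then.IH(2)[OF bounded_sem[OF Then.prems(1)] Then.prems(2)]]
  show ?case by simp
next
  case (Repeat r p)
  \<comment> \<open>The state after \<open>i\<close> rounds: the loop stack of depth
    \<open>n\<close> holds the rounds still to come.\<close>
  define S where "S i = enc (ls(n := rv s r - i)) ((sem p ^^ i) s)" for i
  have le: "rv s r \<le> m" using Repeat.prems(1) by (simp add: bounded_def)
  have "(enc ls s)(LP n := replicate (rv s r) True @ enc ls s (LP n)) = S 0"
    using Repeat.prems(2)[of n] by (intro ext, rename_tac x, case_tac x) (auto simp: S_def)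
  with runs_add[of "enc ls s" "RV r" "rv s r" "LP n"]
  have 1: "runs (add_stk (RV r) (LP n)) (enc ls s) (12 * rv s r + 2) (S 0)" by simp
  have 2: "runs (While (LP n) nonempty (Seq (Pop (LP n)) (prg_stk p (Suc n)))) (S 0)
      (rv s r * ((1 + prg_time p m (c + m * incs p m)) + 2) + 1) (S (rv s r))"
  proof (rule runs_While)
    fix i assume i: "i < rv s r"
    show "peek (S i (LP n)) \<noteq> None" using i by (simp add: S_def)
    let ?s = "(sem p ^^ i) s"
    have "(S i)(LP n := tl (S i (LP n))) = enc (ls(n := rv s r - Suc i)) ?s"
      using i by (intro ext, rename_tac x, case_tac x) (auto simp: S_def replicate_diff_Suc)
    with runs_Pop[of "LP n" "S i"] have 1: "runs (Pop (LP n)) (S i) 1 (enc (ls(n := rv s r - Suc i)) ?s)" by simp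
    have "bounded m (c + i * incs p m) ?s"
      by (rule funpow_bounded[OF bounded_sem Repeat.prems(1)])
    then have bd: "bounded m (c + m * incs p m) ?s"
      by (rule bounded_mono) (use i le in simp)
    have "(ls(n := rv s r - Suc i)) j = 0" if "Suc n \<le> j" for j using Repeat.prems(2) that by simp
    from Repeat.IH[OF bd this]
    have "runs (prg_stk p (Suc n)) (enc (ls(n := rv s r - Suc i)) ?s) (prg_time p m (c + m * incs p m)) (S (Suc i))"
      by (simp add: S_def del: fun_upd_apply)
    from runs_Seq[OF 1 this]
    show "runs (Seq (Pop (LP n)) (prg_stk p (Suc n))) (S i) (1 + prg_time p m (c + m * incs p m)) (S (Suc i))" .
  qed (simp add: S_def)
  have "S (rv s r) = enc ls (sem (Repeat r p) s)"
    using Repeat.prems(2)[of n] by (simp add: S_def fun_upd_idem)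
  moreover have "rv s r * ((1 + prg_time p m (c + m * incs p m)) + 2) \<le> m * (prg_time p m (c + m * incs p m) + 3)"
    using le by (intro mult_mono) auto
  ultimately show ?case using le unfolding prg_stk.simps prg_time.simps
    by (intro runs_weaken[OF runs_Seq[OF 1 2]]) auto
next
  case (IfLess d e p q)
  let ?x = "leval s d" and ?y = "leval s e"
  have IH: "runs (prg_stk p n) (enc ls s) (prg_time p m c) (enc ls (sem p s))"
    "runs (prg_stk q n) (enc ls s) (prg_time q m c) (enc ls (sem q s))"
    by (simp_all add: IfLess.IH IfLess.prems)
  \<comment> \<open>Popping both stacks \<open>?x\<close> times leaves the truncated difference on
    \<open>TmpB\<close>, which is nonempty exactly when \<open>?x < ?y\<close>.\<close>
  define S where "S i = (enc ls s)(TmpA := replicate (?x - i) True, TmpB := replicate (?y - i) True)" for i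
  have 1: "runs (lexp_stk d TmpA) (enc ls s) (lexp_time m c d) ((enc ls s)(TmpA := replicate ?x True))"
    using runs_lexp[OF IfLess.prems(1), of TmpA "enc ls s" ls d] by simp
  have 2: "runs (lexp_stk e TmpB) ((enc ls s)(TmpA := replicate ?x True)) (lexp_time m c e) (S 0)"
    by (rule runs_weaken[OF runs_lexp[OF IfLess.prems(1), of TmpB _ ls]]) (auto simp: S_def)
  have 3: "runs (While TmpA nonempty (Seq (Pop TmpA) (Pop TmpB))) (S 0) (?x * ((1 + 1) + 2) + 1) (S ?x)"
  proof (rule runs_While)
    fix i assume i: "i < ?x"
    show "runs (Seq (Pop TmpA) (Pop TmpB)) (S i) (1 + 1) (S (Suc i))"
      using i by (intro runs_weaken[OF runs_Seq[OF runs_Pop runs_Pop]]) (auto simp: S_def fun_eq_iff)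
    show "peek (S i TmpA) \<noteq> None" using i by (simp add: S_def)
  qed (simp add: S_def)
  let ?T = "3 * ?y + 1 + (prg_time p m c + prg_time q m c)"
  have 4: "runs (Cond TmpB nonempty (Seq (clear_stk TmpB) (prg_stk p n)) (prg_stk q n)) (S ?x) (?T + 2)
      (enc ls (sem (IfLess d e p q) s))"
  proof (rule runs_Cond)
    assume "peek (S ?x TmpB) \<noteq> None"
    then have less: "?x < ?y" by (simp add: S_def)
    have "(S ?x)(TmpB := []) = enc ls s" by (auto simp: S_def fun_eq_iff)
    with runs_clear[of TmpB "S ?x"]
    have "runs (clear_stk TmpB) (S ?x) (3 * (?y - ?x) + 1) (enc ls s)" by (simp add: S_def)
    from runs_Seq[OF this IH(1)] less
    show "runs (Seq (clear_stk TmpB) (prg_stk p n)) (S ?x) ?T (enc ls (sem (IfLess d e p q) s))"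
      by (auto elim!: runs_weaken)
  next
    assume "\<not> peek (S ?x TmpB) \<noteq> None"
    then have less: "\<not> ?x < ?y" by (simp add: S_def)
    then have "S ?x = enc ls s" by (auto simp: S_def fun_eq_iff)
    with IH(2) less
    show "runs (prg_stk q n) (S ?x) ?T (enc ls (sem (IfLess d e p q) s))"
      by (auto elim!: runs_weaken)
  qed
  note le = leval_le_lexp_time[OF IfLess.prems(1)]
  show ?case unfolding prg_stk.simps prg_time.simps
    by (rule runs_weaken[OF runs_Seq[OF 1 runs_Seq[OF 2 runs_Seq[OF 3 4]]]]) (use le[of d] le[of e] in simp_all)
next
  case (WhileRead r p)
  define S where "S i = enc ls ((read_step r p ^^ i) s)" for i
  let ?done = "\<lambda>i. inp ((read_step r p ^^ i) s) = []"
  \<comment> \<open>The stack program stops as soon as the input is empty, which may be before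
    \<open>length (inp s)\<close> rounds because the body can read too.\<close>
  define N where "N = (LEAST i. ?done i)"
  have "?done (length (inp s))" by (rule read_steps_exhaust) simp
  then have N: "?done N" "N \<le> length (inp s)" unfolding N_def by (rule LeastI, rule Least_le)
  have nonempty: "\<not> ?done i" if "i < N" for i using that not_less_Least unfolding N_def by blast
  have le: "N \<le> m" using N(2) length_inp_bounded[OF WhileRead.prems(1)] by simp
  have step: "bounded m (c + incs p m) (read_step r p s)" if "bounded m c s" for c s
    using bounded_sem[OF bounded_read[OF that]] that by (auto simp: read_step_def elim: bounded_mono)
  let ?X = "8 * m + 3 + prg_time p m (c + m * incs p m)"
  have "runs (While Inp nonempty (Seq (read_stk (RV r)) (prg_stk p n))) (S 0) (N * (?X + 2) + 1) (S N)"
  proof (rule runs_While)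
    fix i assume i: "i < N"
    let ?s = "(read_step r p ^^ i) s"
    show "peek (S i Inp) \<noteq> None" using nonempty[OF i] by (cases "inp ?s") (auto simp: S_def code_nats_simps)
    have "bounded m (c + i * incs p m) ?s"
      by (rule funpow_bounded[OF step WhileRead.prems(1)])
    then have bd: "bounded m (c + m * incs p m) ?s"
      by (rule bounded_mono) (use i le in simp)
    have "3 * length (enc ls ?s (RV r)) + 5 * length (enc ls ?s Inp) + 3 \<le> 8 * m + 3"
      using bd add_mono[of "3 * rv ?s r" "3 * m" "5 * length (code_nats (inp ?s))" "5 * m"]
      by (simp add: bounded_def)
    then have 1: "runs (read_stk (RV r)) (S i) (8 * m + 3) (enc ls (read r ?s))"
      using runs_weaken[OF runs_read[where s = "enc ls ?s" and r = "RV r" and ns = "inp ?s"], OF _ _ _ enc_read]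
      by (simp add: S_def)
    have "enc ls (sem p (read r ?s)) = S (Suc i)" using nonempty[OF i] by (simp add: S_def read_step_def)
    with runs_Seq[OF 1 WhileRead.IH[OF bounded_read[OF bd] WhileRead.prems(2)]]
    show "runs (Seq (read_stk (RV r)) (prg_stk p n)) (S i) ?X (S (Suc i))" by simp
  qed (use N(1) in \<open>simp add: S_def code_nats_simps\<close>)
  moreover have "N * (?X + 2) + 1 \<le> prg_time (WhileRead r p) m c"
    using le by (auto intro!: mult_mono)
  moreover have "S N = enc ls (sem (WhileRead r p) s)" using read_steps_eq[OF N(1)] by (simp add: S_def)
  ultimately have "runs (While Inp nonempty (Seq (read_stk (RV r)) (prg_stk p n))) (S 0)
    (prg_time (WhileRead r p) m c) (enc ls (sem (WhileRead r p) s))" by (rule runs_weaken)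
  then show ?case by (simp add: S_def)
qed

text \<open>Emptying an output stack onto \<open>Inp\<close> undoes the reversal, and starting with
  the last list leaves the first one on top. A symbol costs 7 steps: a pop, a push, and two each for
  the conditional and the loop.\<close>

primrec collect_stk :: "nat \<Rightarrow> reg stk" where
  "collect_stk 0 = Nop"
| "collect_stk (Suc k) = Seq
     (While (OUT k) nonempty (Cond (OUT k) (\<lambda>v. v = Some True)
       (Seq (Pop (OUT k)) (Push Inp True)) (Seq (Pop (OUT k)) (Push Inp False))))
     (collect_stk k)"

lemma runs_collect:
  assumes "\<And>i. i < k \<Longrightarrow> length (s (OUT i)) \<le> B"
  shows "\<exists>s'. runs (collect_stk k) s (k * (7 * B + 1)) s' \<and>
    s' Inp = concat (map (\<lambda>i. rev (s (OUT i))) [0..<k]) @ s Inp"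
  using assms
proof (induction k arbitrary: s)
  case 0
  show ?case by (auto intro!: exI[of _ s] runs_weaken[OF runs_Nop])
next
  case (Suc k)
  define w where "w = s (OUT k)"
  define S where "S i = s(OUT k := drop i w, Inp := rev (take i w) @ s Inp)" for i
  let ?c = "Cond (OUT k) (\<lambda>v. v = Some True)
       (Seq (Pop (OUT k)) (Push Inp True)) (Seq (Pop (OUT k)) (Push Inp False))"
  have 1: "runs (While (OUT k) nonempty ?c) (S 0) (length w * (((1 + 2) + 2) + 2) + 1) (S (length w))"
  proof (rule runs_While)
    fix i assume i: "i < length w"
    have drop: "drop i w = w ! i # drop (Suc i) w" using i by (simp add: Cons_nth_drop_Suc)
    show "peek (S i (OUT k)) \<noteq> None" using drop by (simp add: S_def)
    have eq: "S (Suc i) = ((S i)(OUT k := tl (S i (OUT k))))(Inp := (w ! i) # ((S i)(OUT k := tl (S i (OUT k)))) Inp)"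
      using drop i by (simp add: S_def fun_eq_iff take_Suc_conv_app_nth)
    have "peek (S i (OUT k)) = Some (w ! i)" using drop by (simp add: S_def)
    moreover have "runs (Seq (Pop (OUT k)) (Push Inp (w ! i))) (S i) (1 + 2) (S (Suc i))"
      unfolding eq by (rule runs_Seq[OF runs_Pop runs_Push])
    ultimately show "runs ?c (S i) ((1 + 2) + 2) (S (Suc i))"
      by (intro runs_Cond) (cases "w ! i"; simp)+
  qed (simp add: S_def)
  have 2: "S 0 = s" by (simp add: S_def w_def fun_eq_iff)
  have "length (S (length w) (OUT i)) \<le> B" if "i < k" for i using Suc.prems[of i] that by (simp add: S_def)
  from Suc.IH[of "S (length w)", OF this] obtain s' where s': "runs (collect_stk k) (S (length w)) (k * (7 * B + 1)) s'"
    "s' Inp = concat (map (\<lambda>i. rev (S (length w) (OUT i))) [0..<k]) @ S (length w) Inp" by blast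
  have "map (\<lambda>i. rev (S (length w) (OUT i))) [0..<k] = map (\<lambda>i. rev (s (OUT i))) [0..<k]"
    by (simp add: S_def)
  from s'(2)[unfolded this] have "s' Inp = concat (map (\<lambda>i. rev (s (OUT i))) [0..<Suc k]) @ s Inp"
    by (simp add: S_def w_def)
  moreover have "runs (collect_stk (Suc k)) s (Suc k * (7 * B + 1)) s'"
    using runs_weaken[OF runs_Seq[OF 1[unfolded 2] s'(1)]] Suc.prems[of k] by (simp add: w_def)
  ultimately show ?case by blast
qed

section \<open>Polynomial bounds in the input length and the counter bound\<close>

definition poly2 :: "(nat \<Rightarrow> nat \<Rightarrow> nat) \<Rightarrow> bool" where
  "poly2 f \<longleftrightarrow> (\<exists>K d. \<forall>m c. f m c \<le> K * (m + c + 1) ^ d)"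

lemma poly2I: "(\<And>m c. f m c \<le> K * (m + c + 1) ^ d) \<Longrightarrow> poly2 f"
  unfolding poly2_def by blast

lemma poly2_basic: "poly2 (\<lambda>m c. k)" "poly2 (\<lambda>m c. m)" "poly2 (\<lambda>m c. c)"
  by (rule poly2I[of _ k 0], simp, rule poly2I[of _ 1 1], simp, rule poly2I[of _ 1 1], simp)

lemma poly2_add:
  assumes "poly2 f" "poly2 g"
  shows "poly2 (\<lambda>m c. f m c + g m c)"
proof -
  obtain K d L e where *: "\<And>m c. f m c \<le> K * (m + c + 1) ^ d" "\<And>m c. g m c \<le> L * (m + c + 1) ^ e"
    using assms unfolding poly2_def by blast
  have "f m c + g m c \<le> (K + L) * (m + c + 1) ^ (d + e)" for m c
  proof -
    have "f m c \<le> K * (m + c + 1) ^ (d + e)" "g m c \<le> L * (m + c + 1) ^ (d + e)"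
      by (rule le_trans[OF *(1)] le_trans[OF *(2)], intro mult_le_mono2 power_increasing; simp)+
    then have "f m c + g m c \<le> K * (m + c + 1) ^ (d + e) + L * (m + c + 1) ^ (d + e)"
      by (rule add_mono)
    then show ?thesis by (simp only: add_mult_distrib)
  qed
  then show ?thesis by (rule poly2I)
qed

lemma poly2_mult:
  assumes "poly2 f" "poly2 g"
  shows "poly2 (\<lambda>m c. f m c * g m c)"
proof -
  obtain K d L e where *: "\<And>m c. f m c \<le> K * (m + c + 1) ^ d" "\<And>m c. g m c \<le> L * (m + c + 1) ^ e"
    using assms unfolding poly2_def by blast
  have "f m c * g m c \<le> (K * L) * (m + c + 1) ^ (d + e)" for m c
    using mult_le_mono[OF *, of m c m c] by (simp add: power_add mult_ac)
  then show ?thesis by (rule poly2I)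
qed

text \<open>Only the second argument is composed: this is how the growth of the counters enters
  \<open>prg_time\<close>, while \<open>m\<close> stays fixed.\<close>

lemma poly2_comp:
  assumes "poly2 f" "poly2 g"
  shows "poly2 (\<lambda>m c. f m (c + g m c))"
proof -
  obtain K d L e where *: "\<And>m c. f m c \<le> K * (m + c + 1) ^ d" "\<And>m c. g m c \<le> L * (m + c + 1) ^ e"
    using assms unfolding poly2_def by blast
  have "f m (c + g m c) \<le> (K * (L + 1) ^ d) * (m + c + 1) ^ (Suc e * d)" for m c
  proof -
    have "m + c + 1 \<le> (m + c + 1) ^ Suc e" by (rule self_le_power) simp_all
    moreover have "g m c \<le> L * (m + c + 1) ^ Suc e"
      using *(2)[of m c] by (rule le_trans) (intro mult_le_mono2 power_increasing; simp)
    ultimately have "m + (c + g m c) + 1 \<le> (L + 1) * (m + c + 1) ^ Suc e" by simp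
    then have "(m + (c + g m c) + 1) ^ d \<le> ((L + 1) * (m + c + 1) ^ Suc e) ^ d"
      by (rule power_mono) simp
    also have "\<dots> = (L + 1) ^ d * (m + c + 1) ^ (Suc e * d)"
      by (simp only: power_mult_distrib power_mult)
    finally have "K * (m + (c + g m c) + 1) ^ d \<le> K * ((L + 1) ^ d * (m + c + 1) ^ (Suc e * d))"
      by (rule mult_le_mono2)
    with *(1)[of m "c + g m c"] show ?thesis by (simp only: mult.assoc order_trans)
  qed
  then show ?thesis by (rule poly2I)
qed

lemma poly2_incs: "poly2 (\<lambda>m c. incs p m)"
  by (induction p) (auto intro!: poly2_basic poly2_add poly2_mult)

lemma poly2_lexp_time: "poly2 (\<lambda>m c. lexp_time m c e)"
  by (cases e) (auto simp: lexp_time_def intro!: poly2_basic poly2_add poly2_mult)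

lemma poly2_prg_time: "poly2 (prg_time p)"
proof (induction p)
  case (Emit i es)
  have "poly2 (\<lambda>m c. \<Sum>e\<leftarrow>es. lexp_time m c e + 2)"
    by (induction es) (auto intro!: poly2_basic poly2_add poly2_lexp_time simp del: add_Suc_right add_2_eq_Suc')
  then show ?case by simp
next
  case (Then p q)
  then show ?case using poly2_comp[OF Then.IH(2) poly2_incs[of p]] by (simp add: poly2_add)
next
  case (Repeat r p)
  have "poly2 (\<lambda>m c. prg_time p m (c + m * incs p m))"
    by (rule poly2_comp[OF Repeat poly2_mult[OF poly2_basic(2) poly2_incs]])
  then show ?case unfolding prg_time.simps
    by (intro poly2_add poly2_mult poly2_basic)
next
  case (WhileRead r p)
  have "poly2 (\<lambda>m c. prg_time p m (c + m * incs p m))"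
    by (rule poly2_comp[OF WhileRead poly2_mult[OF poly2_basic(2) poly2_incs]])
  then show ?case unfolding prg_time.simps
    by (intro poly2_add poly2_mult poly2_basic)
qed (simp_all only: prg_time.simps, (intro poly2_add poly2_mult poly2_basic poly2_lexp_time; assumption?)+)

definition main_stk :: "nat \<Rightarrow> prg \<Rightarrow> reg stk" where
  "main_stk k p = Seq (prg_stk p 0) (Seq (clear_stk Inp) (collect_stk k))"

lemma runs_main:
  fixes ns m
  defines "m \<equiv> length (code_nats ns)"
  shows "\<exists>s. runs (main_stk k p) (\<lambda>r. if r = Inp then code_nats ns else [])
    (prg_time p m 0 + (3 * m + 1 + k * (7 * prg_time p m 0 + 1))) s \<and>
    s Inp = code_nats (result k p ns)"
proof -
  let ?T = "prg_time p m 0"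
  define ls :: "nat \<Rightarrow> nat" where "ls = (\<lambda>_. 0)"
  define s0 where "s0 = enc ls (st_init ns)"
  define s1 where "s1 = enc ls (sem p (st_init ns))"
  have init: "(\<lambda>r. if r = Inp then code_nats ns else []) = s0"
    by (intro ext, rename_tac x, case_tac x) (auto simp: s0_def ls_def st_init_def code_nats_simps)
  have bd: "bounded m 0 (st_init ns)" by (simp add: bounded_def st_init_def m_def)
  have 1: "runs (prg_stk p 0) s0 ?T s1"
    unfolding s0_def s1_def by (rule runs_prg[OF bd]) (simp add: ls_def)
  have "length (s1 (OUT i)) \<le> ?T" for i
  proof -
    from 1 obtain t where t: "stk_exec (prg_stk p 0) s0 t s1" "t \<le> ?T" by (rule runsE)
    from stk_exec_length[OF t(1), of "OUT i"] t(2) show ?thesis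
      by (simp add: s0_def st_init_def code_nats_simps)
  qed
  then obtain s where s: "runs (collect_stk k) (s1(Inp := [])) (k * (7 * ?T + 1)) s"
    "s Inp = concat (map (\<lambda>i. rev ((s1(Inp := [])) (OUT i))) [0..<k]) @ (s1(Inp := [])) Inp"
    using runs_collect[of k "s1(Inp := [])" ?T] by auto
  have "length (s1 Inp) \<le> m"
    using bounded_sem[OF bd, of p] by (simp add: s1_def bounded_def)
  then have 2: "runs (clear_stk Inp) s1 (3 * m + 1) (s1(Inp := []))"
    by (intro runs_weaken[OF runs_clear]) simp_all
  have "concat (map (\<lambda>i. code_nats (f i)) is) = code_nats (concat (map f is))" for f and "is" :: "nat list"
    by (induction "is") (simp_all add: code_nats_simps)
  then have "s Inp = code_nats (result k p ns)" by (simp add: s(2) s1_def result_def)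
  then show ?thesis unfolding main_stk_def init using runs_Seq[OF 1 runs_Seq[OF 2 s(1)]] by blast
qed

text \<open>All counters start at 0, so the bound in two variables becomes a polynomial in the
  length of the code. From here on a reduction is a matter of rewriting lists of numbers.\<close>

theorem fpt_computable_transducer:
  assumes "fpt_computable_on I \<kappa> (\<lambda>x. code_nats (R x))"
  shows "fpt_computable_on I \<kappa> (\<lambda>x. code_nats (result k p (R x)))"
proof -
  let ?T = "\<lambda>m c. prg_time p m c + (3 * m + 1 + k * (7 * prg_time p m c + 1))"
  have "poly2 ?T" by (intro poly2_add poly2_mult poly2_basic poly2_prg_time)
  then obtain K d where Kd: "\<And>m c. ?T m c \<le> K * (m + c + 1) ^ d" unfolding poly2_def by blast
  show ?thesis
  proof (rule fpt_computable_stk[OF assms, where io = Inp and c = "main_stk k p" and K = K and d = d])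
    fix x assume "x \<in> I"
    from runs_main[where k = k and p = p and ns = "R x"] obtain s t where
      s: "s Inp = code_nats (result k p (R x))"
      "stk_exec (main_stk k p) (\<lambda>r. if r = Inp then code_nats (R x) else []) t s"
      "t \<le> ?T (length (code_nats (R x))) 0"
      by (auto elim!: runsE)
    from s(3) Kd[of "length (code_nats (R x))" 0]
    have "t \<le> K * (length (code_nats (R x)) + 1) ^ d" by simp
    with s show "\<exists>t s. stk_exec (main_stk k p) (\<lambda>r. if r = Inp then code_nats (R x) else []) t s \<and>
      s Inp = code_nats (result k p (R x)) \<and> t \<le> K * (length (code_nats (R x)) + 1) ^ d" by blast
  qed
qed


section \<open>Structures as star forests with a successor relation\<close>

text \<open>
  The centres are \<open>0\<close> for the universe, regarded as a unary relation, \<open>i + 1\<close> for the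
  relation with index \<open>i\<close>, and \<open>offset A + e\<close> for the element \<open>e\<close>.  All other vertices are leaves,
  and every tuple is given by consecutive leaves: one of its relation followed by those of its entries.
\<close>

definition offset :: "struct \<Rightarrow> nat" where
  "offset A = Suc (length (rels A))"

definition rel_leaves :: "nat \<Rightarrow> nat \<Rightarrow> nat \<times> nat list list \<Rightarrow> nat list" where
  "rel_leaves k i R = concat (map (\<lambda>t. Suc i # map ((+) k) t) (snd R))"

text \<open>A leaf is recorded by its centre: entry \<open>j\<close> is the centre of the vertex
  \<open>first_leaf A + j\<close>.\<close>

definition leaves :: "struct \<Rightarrow> nat list" where
  "leaves A = concat (map (\<lambda>e. [0, offset A + e]) [0..<universe A]) @
     concat (map (\<lambda>(i, R). rel_leaves (offset A) i R) (enumerate 0 (rels A)))"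

definition first_leaf :: "struct \<Rightarrow> nat" where
  "first_leaf A = offset A + universe A"

definition star_edges :: "struct \<Rightarrow> nat list list" where
  "star_edges A = concat (map (\<lambda>(j, c). [[c, j], [j, c]]) (enumerate (first_leaf A) (leaves A)))"

definition star_order :: "struct \<Rightarrow> nat" where
  "star_order A = first_leaf A + length (leaves A)"

definition path_edges :: "nat \<Rightarrow> nat list list" where
  "path_edges n = map (\<lambda>i. [i, Suc i]) [0..<n - 1]"

definition star_struct :: "struct \<Rightarrow> struct" where
  "star_struct A = \<lparr>universe = star_order A,
     rels = [(2, star_edges A), (2, path_edges (star_order A))]\<rparr>"

text \<open>Variable 0 is the current vertex and variable 1 is scratch.\<close>

primrec walk :: "nat \<Rightarrow> fo \<Rightarrow> fo" where
  "walk 0 \<phi> = \<phi>"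
| "walk (Suc k) \<phi> = Ex 1 (Conj (Rel 1 [0, 1]) (Ex 0 (Conj (Eq 0 1) (walk k \<phi>))))"

primrec slots :: "nat list \<Rightarrow> fo" where
  "slots [] = Eq 0 0"
| "slots (x # xs) = Ex 1 (Conj (Rel 1 [0, 1]) (Conj (Rel 0 [x, 1]) (Ex 0 (Conj (Eq 0 1) (slots xs)))))"

text \<open>The only vertex without predecessor is 0, and this makes the centre with number
  \<open>i\<close> definable although no symbol names it. A tuple may then be recognised at any leaf
  of this centre, wherever its block lies on the path.\<close>

definition tuple_fo :: "nat \<Rightarrow> nat list \<Rightarrow> fo" where
  "tuple_fo i xs = Ex 0 (Conj (Neg (Ex 1 (Rel 1 [1, 0])))
     (walk i (Ex 1 (Conj (Rel 0 [0, 1]) (Ex 0 (Conj (Eq 0 1) (slots xs)))))))"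

text \<open>The shift by two keeps variables 0 and 1 free for \<open>tuple_fo\<close>. Index
  \<open>i\<close> becomes \<open>Suc i\<close> because number 0 is taken by the universe.\<close>

primrec star_fo :: "fo \<Rightarrow> fo" where
  "star_fo (Eq x y) = Eq (x + 2) (y + 2)"
| "star_fo (Rel i xs) = tuple_fo (Suc i) (map (\<lambda>x. x + 2) xs)"
| "star_fo (Neg \<phi>) = Neg (star_fo \<phi>)"
| "star_fo (Conj \<phi> \<psi>) = Conj (star_fo \<phi>) (star_fo \<psi>)"
| "star_fo (Disj \<phi> \<psi>) = Disj (star_fo \<phi>) (star_fo \<psi>)"
| "star_fo (Ex x \<phi>) = Ex (x + 2) (Conj (tuple_fo 0 [x + 2]) (star_fo \<phi>))"
| "star_fo (All x \<phi>) = All (x + 2) (Disj (Neg (tuple_fo 0 [x + 2])) (star_fo \<phi>))"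

lemma free_vars_walk: "free_vars (walk k \<phi>) \<subseteq> insert 0 (free_vars \<phi>)"
  by (induction k) auto

lemma free_vars_slots: "free_vars (slots xs) \<subseteq> insert 0 (set xs)"
  by (induction xs) auto

lemma free_vars_tuple_fo: "free_vars (tuple_fo i xs) \<subseteq> set xs"
  using free_vars_walk[of i "Ex 1 (Conj (Rel 0 [0, 1]) (Ex 0 (Conj (Eq 0 1) (slots xs))))"]
    free_vars_slots[of xs]
  by (auto simp: tuple_fo_def)

lemma free_vars_star_fo: "free_vars (star_fo \<phi>) \<subseteq> (\<lambda>x. x + 2) ` free_vars \<phi>"
proof (induction \<phi>)
  case (Rel i xs)
  show ?case using free_vars_tuple_fo[of "Suc i" "map (\<lambda>x. x + 2) xs"] by auto
next
  case (Ex x \<phi>)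
  then show ?case using free_vars_tuple_fo[of 0 "[x + 2]"] by auto
next
  case (All x \<phi>)
  then show ?case using free_vars_tuple_fo[of 0 "[x + 2]"] by auto
qed auto

lemma over_arities_walk: "over_arities [2, 2] (walk k \<phi>) \<longleftrightarrow> over_arities [2, 2] \<phi>"
  by (induction k) auto

lemma over_arities_slots: "over_arities [2, 2] (slots xs)"
  by (induction xs) auto

lemma over_arities_star_fo: "over_arities [2, 2] (star_fo \<phi>)"
  by (induction \<phi>) (auto simp: tuple_fo_def over_arities_walk over_arities_slots)

lemma sentence_star:
  assumes "sentence_for A \<phi>"
  shows "sentence_for (star_struct A) (star_fo \<phi>)"
  using assms free_vars_star_fo[of \<phi>]
  by (auto simp: sentence_for_def star_struct_def over_arities_star_fo)

section \<open>Evaluation of the translated formulas in the star structure\<close>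

lemma set_path_edges: "[u, v] \<in> set (path_edges n) \<longleftrightarrow> v = Suc u \<and> v < n"
  by (auto simp: path_edges_def)

lemma set_enumerate: "(j, c) \<in> set (enumerate n cs) \<longleftrightarrow> n \<le> j \<and> j < n + length cs \<and> c = cs ! (j - n)"
  by (auto simp: in_set_enumerate_eq)

lemma set_star_edges:
  "[u, v] \<in> set (star_edges A) \<longleftrightarrow>
    (first_leaf A \<le> v \<and> v < star_order A \<and> u = leaves A ! (v - first_leaf A)) \<or>
    (first_leaf A \<le> u \<and> u < star_order A \<and> v = leaves A ! (u - first_leaf A))"
proof -
  have "[u, v] \<in> set (star_edges A) \<longleftrightarrow>
      (v, u) \<in> set (enumerate (first_leaf A) (leaves A)) \<or> (u, v) \<in> set (enumerate (first_leaf A) (leaves A))"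
    by (auto simp: star_edges_def simp del: in_set_enumerate_eq)
  then show ?thesis unfolding set_enumerate star_order_def by simp
qed

lemma wf_structD:
  assumes "wf_struct A" "R \<in> set (rels A)" "t \<in> set (snd R)"
  shows "length t = fst R" "set t \<subseteq> {..<universe A}"
proof -
  have "\<forall>t \<in> set (snd R). length t = fst R \<and> set t \<subseteq> {..<universe A}"
    using bspec[OF conjunct2[OF assms(1)[unfolded wf_struct_def]] assms(2)] by (simp add: case_prod_unfold)
  with assms(3) show "length t = fst R" "set t \<subseteq> {..<universe A}" by simp_all
qed

text \<open>Separates the numbers of centres from those of leaves, so that an edge shows which of
  its ends is the leaf.\<close>

lemma centre_less:
  assumes "wf_struct A" "c \<in> set (leaves A)"
  shows "c < first_leaf A"
proof -
  from assms(2) consider e where "e < universe A" "c = 0 \<or> c = offset A + e"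
    | i R t where "(i, R) \<in> set (enumerate 0 (rels A))" "t \<in> set (snd R)" "c \<in> set (Suc i # map ((+) (offset A)) t)"
    unfolding leaves_def rel_leaves_def by (auto simp del: in_set_enumerate_eq UN_simps)
  then show ?thesis
  proof cases
    case 1
    then show ?thesis by (auto simp: first_leaf_def offset_def)
  next
    case (2 i R t)
    then have i: "i < length (rels A)" "R \<in> set (rels A)" by (auto simp: in_set_enumerate_eq)
    with wf_structD(2)[OF assms(1) i(2) 2(2)] 2(3) show ?thesis
      by (auto simp: first_leaf_def offset_def)
  qed
qed

text \<open>A walk overwrites variable 1, hence the hypothesis that the formula at its end ignores
  it. Successors are the pairs of consecutive numbers, so a walk is an addition.\<close>

lemma sat_walk:
  assumes "\<And>\<sigma> a. sat (star_struct A) (\<sigma>(1 := a)) \<phi> \<longleftrightarrow> sat (star_struct A) \<sigma> \<phi>" "\<sigma> 0 < star_order A"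
  shows "sat (star_struct A) \<sigma> (walk k \<phi>) \<longleftrightarrow>
    \<sigma> 0 + k < star_order A \<and> sat (star_struct A) (\<sigma>(0 := \<sigma> 0 + k)) \<phi>"
  using assms(2)
proof (induction k arbitrary: \<sigma>)
  case 0
  then show ?case by simp
next
  case (Suc k)
  define \<tau> where "\<tau> = \<sigma>(1 := Suc (\<sigma> 0), 0 := Suc (\<sigma> 0))"
  have \<tau>0: "\<tau> 0 = Suc (\<sigma> 0)" by (simp add: \<tau>_def)
  have "sat (star_struct A) \<sigma> (walk (Suc k) \<phi>) \<longleftrightarrow>
      Suc (\<sigma> 0) < star_order A \<and> sat (star_struct A) \<tau> (walk k \<phi>)"
    unfolding \<tau>_def by (auto simp: star_struct_def set_path_edges)
  also have "\<dots> \<longleftrightarrow> \<sigma> 0 + Suc k < star_order A \<and> sat (star_struct A) (\<tau>(0 := \<tau> 0 + k)) \<phi>"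
    using Suc.IH[of \<tau>] \<tau>0 by (auto simp del: fun_upd_apply)
  also have "\<tau>(0 := \<tau> 0 + k) = (\<sigma>(0 := \<sigma> 0 + Suc k))(1 := Suc (\<sigma> 0))"
    by (auto simp: \<tau>_def fun_eq_iff)
  finally show ?case unfolding assms(1) .
qed

lemma sat_slots:
  assumes "\<forall>x \<in> set xs. 2 \<le> x" "\<sigma> 0 < star_order A"
  shows "sat (star_struct A) \<sigma> (slots xs) \<longleftrightarrow> \<sigma> 0 + length xs < star_order A \<and>
    (\<forall>j < length xs. [\<sigma> (xs ! j), \<sigma> 0 + Suc j] \<in> set (star_edges A))"
  using assms
proof (induction xs arbitrary: \<sigma>)
  case Nil
  then show ?case by simp
next
  case (Cons x xs)
  define \<tau> where "\<tau> = \<sigma>(1 := Suc (\<sigma> 0), 0 := Suc (\<sigma> 0))"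
  have x: "x \<noteq> 0" "x \<noteq> 1" "x \<noteq> Suc 0" using Cons.prems(1) by auto
  have xs: "\<tau> (xs ! j) = \<sigma> (xs ! j)" if "j < length xs" for j
    using Cons.prems(1) nth_mem[OF that] by (force simp: \<tau>_def)
  have \<tau>0: "\<tau> 0 = Suc (\<sigma> 0)" by (simp add: \<tau>_def)
  have "sat (star_struct A) \<sigma> (slots (x # xs)) \<longleftrightarrow> Suc (\<sigma> 0) < star_order A \<and>
      [\<sigma> x, Suc (\<sigma> 0)] \<in> set (star_edges A) \<and> sat (star_struct A) \<tau> (slots xs)"
    unfolding \<tau>_def using x by (auto simp: star_struct_def set_path_edges)
  also have "\<dots> \<longleftrightarrow> [\<sigma> x, Suc (\<sigma> 0)] \<in> set (star_edges A) \<and>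
      \<sigma> 0 + Suc (length xs) < star_order A \<and>
      (\<forall>j < length xs. [\<sigma> (xs ! j), \<sigma> 0 + Suc (Suc j)] \<in> set (star_edges A))"
    using Cons.IH[of \<tau>] Cons.prems(1) xs by (auto simp: \<tau>0)
  finally show ?case by (auto simp: All_less_Suc2)
qed

lemma sat_tuple_fo_edges:
  assumes "\<forall>x \<in> set xs. 2 \<le> x" "0 < star_order A"
  shows "sat (star_struct A) \<sigma> (tuple_fo i xs) \<longleftrightarrow> i < star_order A \<and>
    (\<exists>y. [i, y] \<in> set (star_edges A) \<and> y + length xs < star_order A \<and>
      (\<forall>j < length xs. [\<sigma> (xs ! j), y + Suc j] \<in> set (star_edges A)))"
proof -
  let ?B = "star_struct A"
  let ?\<phi> = "Ex 1 (Conj (Rel 0 [0, 1]) (Ex 0 (Conj (Eq 0 1) (slots xs))))"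
  have xs: "xs ! j \<noteq> 0 \<and> xs ! j \<noteq> 1 \<and> xs ! j \<noteq> Suc 0" if "j < length xs" for j
    using assms(1) nth_mem[OF that] by force
  have "sat ?B \<sigma> (tuple_fo i xs) \<longleftrightarrow> sat ?B (\<sigma>(0 := 0)) (walk i ?\<phi>)" (is "_ \<longleftrightarrow> sat ?B ?\<sigma> _")
  proof -
    have "(\<exists>b < star_order A. [b, a] \<in> set (path_edges (star_order A))) \<longleftrightarrow> a \<noteq> 0" if "a < star_order A" for a
      using that by (cases a) (auto simp: set_path_edges)
    then show ?thesis using assms(2) by (auto simp: tuple_fo_def star_struct_def)
  qed
  also have "\<dots> \<longleftrightarrow> i < star_order A \<and> sat ?B (\<sigma>(0 := i)) ?\<phi>"
    using assms(2) by (subst sat_walk) (simp_all add: fun_upd_twist)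
  also have "sat ?B (\<sigma>(0 := i)) ?\<phi> \<longleftrightarrow> (\<exists>y < star_order A. [i, y] \<in> set (star_edges A) \<and>
      sat ?B (\<sigma>(1 := y, 0 := y)) (slots xs))"
    by (auto simp: star_struct_def)
  also have "\<dots> \<longleftrightarrow> (\<exists>y. [i, y] \<in> set (star_edges A) \<and> y + length xs < star_order A \<and>
      (\<forall>j < length xs. [\<sigma> (xs ! j), y + Suc j] \<in> set (star_edges A)))"
  proof -
    have "sat ?B (\<sigma>(1 := y, 0 := y)) (slots xs) \<longleftrightarrow> y + length xs < star_order A \<and>
      (\<forall>j < length xs. [\<sigma> (xs ! j), y + Suc j] \<in> set (star_edges A))" if "y < star_order A" for y
      using sat_slots[OF assms(1), of "\<sigma>(1 := y, 0 := y)"] xs that by auto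
    then show ?thesis by (auto simp del: One_nat_def) (meson add_lessD1)
  qed
  finally show ?thesis .
qed

lemma infix_iff_nth:
  "(\<exists>pre post. cs = pre @ ds @ post) \<longleftrightarrow>
    (\<exists>j. j + length ds \<le> length cs \<and> (\<forall>k < length ds. cs ! (j + k) = ds ! k))"
proof
  assume "\<exists>pre post. cs = pre @ ds @ post"
  then obtain pre post where "cs = pre @ ds @ post" by blast
  then show "\<exists>j. j + length ds \<le> length cs \<and> (\<forall>k < length ds. cs ! (j + k) = ds ! k)"
    by (intro exI[of _ "length pre"]) (auto simp: nth_append)
next
  assume "\<exists>j. j + length ds \<le> length cs \<and> (\<forall>k < length ds. cs ! (j + k) = ds ! k)"
  then obtain j where "j + length ds \<le> length cs" "\<forall>k < length ds. cs ! (j + k) = ds ! k" by blast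
  then have "take (length ds) (drop j cs) = ds" by (intro nth_equalityI) auto
  then have "cs = take j cs @ ds @ drop (length ds) (drop j cs)" by (metis append_take_drop_id)
  then show "\<exists>pre post. cs = pre @ ds @ post" by blast
qed

text \<open>Centres are numbered below all leaves, so a neighbour of centre \<open>i\<close> is a
  leaf, as are the vertices after it, and adjacency to a leaf determines its centre. What the
  formula asserts is thus the occurrence of a word in the list of centres.\<close>

lemma sat_tuple_fo_infix:
  assumes "wf_struct A" "\<forall>x \<in> set xs. 2 \<le> x" "i < offset A"
  shows "sat (star_struct A) \<sigma> (tuple_fo i xs) \<longleftrightarrow> (\<exists>pre post. leaves A = pre @ (i # map \<sigma> xs) @ post)"
proof -
  let ?L = "first_leaf A"
  have less: "leaves A ! j < ?L" if "j < length (leaves A)" for j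
    using centre_less[OF assms(1)] that by simp
  have i: "i < ?L" "i < star_order A" using assms(3) by (simp_all add: first_leaf_def star_order_def)
  have 1: "[i, y] \<in> set (star_edges A) \<longleftrightarrow> (\<exists>j < length (leaves A). y = ?L + j \<and> i = leaves A ! j)" for y
    using i(1) unfolding set_star_edges by (auto simp: star_order_def intro: exI[of _ "y - ?L"])
  have 2: "[v, ?L + j] \<in> set (star_edges A) \<longleftrightarrow> v = leaves A ! j" if "j < length (leaves A)" for v j
    using less[of "v - ?L"] that unfolding set_star_edges by (auto simp: star_order_def less_diff_conv2)
  have "sat (star_struct A) \<sigma> (tuple_fo i xs) \<longleftrightarrow>
      (\<exists>j. j + Suc (length xs) \<le> length (leaves A) \<and> leaves A ! j = i \<and>
        (\<forall>k < length xs. leaves A ! (j + Suc k) = \<sigma> (xs ! k)))" (is "_ \<longleftrightarrow> ?R")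
  proof
    assume "sat (star_struct A) \<sigma> (tuple_fo i xs)"
    then obtain y where y: "[i, y] \<in> set (star_edges A)" "y + length xs < star_order A"
      "\<And>k. k < length xs \<Longrightarrow> [\<sigma> (xs ! k), y + Suc k] \<in> set (star_edges A)"
      using sat_tuple_fo_edges[OF assms(2), of A \<sigma> i] i(2) by auto
    from y(1) obtain j where j: "j < length (leaves A)" "y = ?L + j" "i = leaves A ! j"
      unfolding 1 by blast
    have "leaves A ! (j + Suc k) = \<sigma> (xs ! k)" if "k < length xs" for k
      using y(2) y(3)[OF that] 2[of "j + Suc k" "\<sigma> (xs ! k)"] that by (simp add: j(2) star_order_def add.assoc)
    moreover have "j + Suc (length xs) \<le> length (leaves A)" using y(2) by (simp add: j(2) star_order_def)
    ultimately show ?R using j(3) by (intro exI[of _ j] conjI allI impI) (assumption | rule sym)+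
  next
    assume ?R
    then obtain j where j: "j + Suc (length xs) \<le> length (leaves A)" "leaves A ! j = i"
      "\<And>k. k < length xs \<Longrightarrow> leaves A ! (j + Suc k) = \<sigma> (xs ! k)" by blast
    have "[i, ?L + j] \<in> set (star_edges A)" unfolding 1 using j(1,2) by (intro exI[of _ j] conjI) simp_all
    moreover have "?L + j + length xs < star_order A" using j(1) by (simp add: star_order_def)
    moreover have "[\<sigma> (xs ! k), ?L + j + Suc k] \<in> set (star_edges A)" if "k < length xs" for k
      using 2[of "j + Suc k" "\<sigma> (xs ! k)"] j(1) j(3)[OF that] that by (simp add: add.assoc)
    ultimately have "\<exists>y. [i, y] \<in> set (star_edges A) \<and> y + length xs < star_order A \<and>
        (\<forall>k < length xs. [\<sigma> (xs ! k), y + Suc k] \<in> set (star_edges A))"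
      by (intro exI[of _ "?L + j"] conjI allI impI)
    with sat_tuple_fo_edges[OF assms(2), of A \<sigma> i] i(2) show "sat (star_struct A) \<sigma> (tuple_fo i xs)"
      by simp
  qed
  also have "\<dots> \<longleftrightarrow> (\<exists>pre post. leaves A = pre @ (i # map \<sigma> xs) @ post)"
    unfolding infix_iff_nth by (simp add: All_less_Suc2)
  finally show ?thesis .
qed

text \<open>Excludes occurrences that straddle blocks: within a block only the head can be below
  \<open>k\<close>, so the entry \<open>i\<close> has to be a head, and the length belonging to that
  head fixes where the occurrence ends.\<close>

lemma infix_of_blocks:
  fixes i :: nat
  assumes "concat bs = pre @ (i # vs) @ post" "i < k"
    and "\<And>b. b \<in> set bs \<Longrightarrow> b \<noteq> [] \<and> (\<forall>v \<in> set (tl b). k \<le> v)"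
    and "\<And>b. b \<in> set bs \<Longrightarrow> hd b = i \<Longrightarrow> length b = Suc (length vs)"
  shows "i # vs \<in> set bs"
  using assms
proof (induction bs arbitrary: pre)
  case Nil
  then show ?case by simp
next
  case (Cons b bs)
  obtain h t where b: "b = h # t" using Cons.prems(3)[of b] by (cases b) auto
  show ?case
  proof (cases pre)
    case Nil
    then show ?thesis using Cons.prems(1) Cons.prems(4)[of b] b by auto
  next
    case (Cons p pre1)
    then have eq: "t @ concat bs = pre1 @ (i # vs) @ post" using Cons.prems(1) b by simp
    have "i \<notin> set t" using Cons.prems(2) Cons.prems(3)[of b] b by (auto dest!: bspec[of _ _ i])
    from eq consider us where "t = pre1 @ us" "us @ concat bs = (i # vs) @ post"
      | us where "pre1 = t @ us" "concat bs = us @ (i # vs) @ post"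
      by (auto simp: append_eq_append_conv2)
    then obtain us where "concat bs = us @ (i # vs) @ post"
    proof cases
      case (1 us)
      with \<open>i \<notin> set t\<close> have "us = []" by (cases us) auto
      with 1(2) show ?thesis by (intro that[of "[]"]) simp
    qed
    then have "i # vs \<in> set bs"
      using Cons.prems(2) by (rule Cons.IH) (use Cons.prems(3,4) in auto)
    then show ?thesis by simp
  qed
qed


text \<open>Heads of blocks are below \<open>offset A\<close> and centres of elements are not, as
  \<open>infix_of_blocks\<close> requires. The hypotheses on the length of \<open>xs\<close> match
  it with the blocks headed by \<open>i\<close>: two entries for the universe, arity plus one for a
  relation.\<close>

lemma sat_tuple_fo:
  assumes A: "wf_struct A" and xs: "\<forall>x \<in> set xs. 2 \<le> x" and i: "i < offset A"
    and len: "i = 0 \<Longrightarrow> length xs = 1" "\<And>j. i = Suc j \<Longrightarrow> length xs = fst (rels A ! j)"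
  shows "sat (star_struct A) \<sigma> (tuple_fo i xs) \<longleftrightarrow>
    (\<exists>t. map \<sigma> xs = map ((+) (offset A)) t \<and>
      (case i of 0 \<Rightarrow> set t \<subseteq> {..<universe A} | Suc j \<Rightarrow> t \<in> set (snd (rels A ! j))))"
proof -
  let ?k = "offset A"
  define rel_blocks where "rel_blocks j R = map (\<lambda>t. Suc j # map ((+) ?k) t) (snd R)" for j and R :: "nat \<times> nat list list"
  define bs where "bs = map (\<lambda>e. [0, ?k + e]) [0..<universe A] @
    concat (map (\<lambda>(j, R). rel_blocks j R) (enumerate 0 (rels A)))"
  have leaves: "leaves A = concat bs"
  proof -
    have "concat (concat (map (\<lambda>(j, R). rel_blocks j R) xs)) = concat (map (\<lambda>(j, R). rel_leaves ?k j R) xs)" for xs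
      by (induction xs) (auto simp: rel_blocks_def rel_leaves_def)
    then show ?thesis by (simp add: leaves_def bs_def)
  qed
  have bs: "b \<in> set bs \<longleftrightarrow> (\<exists>e < universe A. b = [0, ?k + e]) \<or>
      (\<exists>j < length (rels A). \<exists>t \<in> set (snd (rels A ! j)). b = Suc j # map ((+) ?k) t)" for b
  proof -
    have "b \<in> set (concat (map (\<lambda>(j, R). rel_blocks j R) (enumerate 0 (rels A)))) \<longleftrightarrow>
        (\<exists>j R. (j, R) \<in> set (enumerate 0 (rels A)) \<and> b \<in> set (rel_blocks j R))"
      by (auto simp del: in_set_enumerate_eq UN_simps)
    also have "\<dots> \<longleftrightarrow> (\<exists>j < length (rels A). b \<in> set (rel_blocks j (rels A ! j)))"
      unfolding set_enumerate by auto
    finally show ?thesis unfolding bs_def set_append Un_iff by (auto simp: rel_blocks_def)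
  qed
  have "sat (star_struct A) \<sigma> (tuple_fo i xs) \<longleftrightarrow> (\<exists>pre post. concat bs = pre @ (i # map \<sigma> xs) @ post)"
    unfolding sat_tuple_fo_infix[OF A xs i] leaves ..
  also have "\<dots> \<longleftrightarrow> i # map \<sigma> xs \<in> set bs"
  proof
    assume "\<exists>pre post. concat bs = pre @ (i # map \<sigma> xs) @ post"
    then obtain pre post where "concat bs = pre @ (i # map \<sigma> xs) @ post" by blast
    then show "i # map \<sigma> xs \<in> set bs"
    proof (rule infix_of_blocks[OF _ i])
      show "b \<noteq> [] \<and> (\<forall>v \<in> set (tl b). ?k \<le> v)" if "b \<in> set bs" for b
        using that unfolding bs by auto
      show "length b = Suc (length (map \<sigma> xs))" if "b \<in> set bs" "hd b = i" for b
        using that(1) unfolding bs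
      proof (elim disjE exE conjE bexE)
        fix j t assume j: "j < length (rels A)" "t \<in> set (snd (rels A ! j))" "b = Suc j # map ((+) ?k) t"
        with that(2) len(2)[of j] wf_structD(1)[OF A nth_mem[OF j(1)] j(2)] show ?thesis by simp
      qed (use that(2) len(1) in auto)
    qed
  next
    assume "i # map \<sigma> xs \<in> set bs"
    then obtain bs1 bs2 where "bs = bs1 @ (i # map \<sigma> xs) # bs2" by (auto dest: split_list)
    then show "\<exists>pre post. concat bs = pre @ (i # map \<sigma> xs) @ post"
      by (intro exI[of _ "concat bs1"] exI[of _ "concat bs2"]) simp
  qed
  also have "\<dots> \<longleftrightarrow> (\<exists>t. map \<sigma> xs = map ((+) (offset A)) t \<and>
      (case i of 0 \<Rightarrow> set t \<subseteq> {..<universe A} | Suc j \<Rightarrow> t \<in> set (snd (rels A ! j))))"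
  proof (cases i)
    case 0
    with len(1) obtain x where x: "xs = [x]" by (cases xs) auto
    show ?thesis unfolding bs 0 x by (auto simp: map_eq_Cons_conv Cons_eq_map_conv)
  next
    case (Suc j)
    then have "j < length (rels A)" using i by (simp add: offset_def)
    then show ?thesis unfolding bs Suc by auto
  qed
  finally show ?thesis .
qed

lemma sat_universe_fo:
  assumes "wf_struct A"
  shows "sat (star_struct A) \<sigma> (tuple_fo 0 [x + 2]) \<longleftrightarrow> (\<exists>e < universe A. \<sigma> (x + 2) = offset A + e)"
  by (subst sat_tuple_fo[OF assms]) (auto simp: offset_def Cons_eq_map_conv)

text \<open>An element is represented by its centre. Only free variables have to correspond: under
  the assignment in \<open>models\<close> a variable denotes vertex 0, which represents no
  element.\<close>

lemma sat_star_fo: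
  assumes A: "wf_struct A" and "over_arities (map fst (rels A)) \<phi>"
    and "\<And>x. x \<in> free_vars \<phi> \<Longrightarrow> \<tau> (x + 2) = offset A + \<sigma> x"
  shows "sat (star_struct A) \<tau> (star_fo \<phi>) \<longleftrightarrow> sat A \<sigma> \<phi>"
  using assms(2,3)
proof (induction \<phi> arbitrary: \<sigma> \<tau>)
  case (Eq x y)
  then show ?case using Eq.prems(2)[of x] Eq.prems(2)[of y] by simp
next
  case (Rel i xs)
  have i: "i < length (rels A)" "length xs = fst (rels A ! i)" using Rel.prems(1) by simp_all
  have eq: "map \<tau> (map (\<lambda>x. x + 2) xs) = map ((+) (offset A)) (map \<sigma> xs)"
    using Rel.prems(2) by simp
  have "inj ((+) (offset A))" by simp
  then have "(map ((+) (offset A)) (map \<sigma> xs) = map ((+) (offset A)) t) \<longleftrightarrow> map \<sigma> xs = t" for t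
    by (rule inj_map_eq_map)
  note inj = this
  have "sat (star_struct A) \<tau> (tuple_fo (Suc i) (map (\<lambda>x. x + 2) xs)) \<longleftrightarrow>
      (\<exists>t. map \<tau> (map (\<lambda>x. x + 2) xs) = map ((+) (offset A)) t \<and> t \<in> set (snd (rels A ! i)))"
  proof (subst sat_tuple_fo[OF A])
    show "Suc i < offset A" using i(1) by (simp add: offset_def)
  qed (use i(2) in auto)
  also have "\<dots> \<longleftrightarrow> map \<sigma> xs \<in> set (snd (rels A ! i))" unfolding eq inj by simp
  finally show ?case by simp
next
  case (Neg \<phi>)
  have "sat (star_struct A) \<tau> (star_fo \<phi>) \<longleftrightarrow> sat A \<sigma> \<phi>" using Neg.prems by (intro Neg.IH) auto
  then show ?case by simp
next
  case (Conj \<phi> \<psi>)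
  have "sat (star_struct A) \<tau> (star_fo \<phi>) \<longleftrightarrow> sat A \<sigma> \<phi>" "sat (star_struct A) \<tau> (star_fo \<psi>) \<longleftrightarrow> sat A \<sigma> \<psi>"
    using Conj.prems by (auto intro!: Conj.IH)
  then show ?case by simp
next
  case (Disj \<phi> \<psi>)
  have "sat (star_struct A) \<tau> (star_fo \<phi>) \<longleftrightarrow> sat A \<sigma> \<phi>" "sat (star_struct A) \<tau> (star_fo \<psi>) \<longleftrightarrow> sat A \<sigma> \<psi>"
    using Disj.prems by (auto intro!: Disj.IH)
  then show ?case by simp
next
  case (Ex x \<phi>)
  have IH: "sat (star_struct A) (\<tau>(x + 2 := offset A + e)) (star_fo \<phi>) \<longleftrightarrow> sat A (\<sigma>(x := e)) \<phi>" for e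
    using Ex.prems by (intro Ex.IH) auto
  have less: "offset A + e < star_order A" if "e < universe A" for e
    using that by (simp add: star_order_def first_leaf_def)
  have "sat (star_struct A) \<tau> (star_fo (Ex x \<phi>)) \<longleftrightarrow>
      (\<exists>a < star_order A. (\<exists>e < universe A. a = offset A + e) \<and> sat (star_struct A) (\<tau>(x + 2 := a)) (star_fo \<phi>))"
    unfolding star_fo.simps sat.simps sat_universe_fo[OF A] by (simp add: star_struct_def)
  also have "\<dots> \<longleftrightarrow> (\<exists>e < universe A. sat (star_struct A) (\<tau>(x + 2 := offset A + e)) (star_fo \<phi>))"
    using less by blast
  finally show ?case unfolding IH by simp
next
  case (All x \<phi>)
  have IH: "sat (star_struct A) (\<tau>(x + 2 := offset A + e)) (star_fo \<phi>) \<longleftrightarrow> sat A (\<sigma>(x := e)) \<phi>" for e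
    using All.prems by (intro All.IH) auto
  have less: "offset A + e < star_order A" if "e < universe A" for e
    using that by (simp add: star_order_def first_leaf_def)
  have "sat (star_struct A) \<tau> (star_fo (All x \<phi>)) \<longleftrightarrow>
      (\<forall>a < star_order A. \<not> (\<exists>e < universe A. a = offset A + e) \<or> sat (star_struct A) (\<tau>(x + 2 := a)) (star_fo \<phi>))"
    unfolding star_fo.simps sat.simps sat_universe_fo[OF A] by (simp add: star_struct_def)
  also have "\<dots> \<longleftrightarrow> (\<forall>e < universe A. sat (star_struct A) (\<tau>(x + 2 := offset A + e)) (star_fo \<phi>))"
    using less by blast
  finally show ?case unfolding IH by simp
qed

lemma models_star:
  assumes "wf_struct A" "sentence_for A \<phi>"
  shows "star_struct A \<Turnstile> star_fo \<phi> \<longleftrightarrow> A \<Turnstile> \<phi>"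
  unfolding models_def using assms(2) by (intro sat_star_fo[OF assms(1)]) (auto simp: sentence_for_def)

section \<open>The star forest and its successor relation\<close>

definition star_graph :: "struct \<Rightarrow> ugraph" where
  "star_graph A = \<lparr>order = star_order A, adj = {(u, v). [u, v] \<in> set (star_edges A)}\<rparr>"

text \<open>Each leaf has its own number, and the two orientations of its edge differ because
  centres lie below leaves.\<close>

lemma distinct_star_edges:
  assumes "\<forall>c \<in> set cs. c < n"
  shows "distinct (concat (map (\<lambda>(j, c). [[c, j], [j, c]]) (enumerate n cs)))"
proof -
  \<comment> \<open>In the induction the numbering of the leaves moves up while the bound on the
    centres stays, so the start \<open>k\<close> is separated from \<open>n\<close>.\<close>
  have "distinct (concat (map (\<lambda>(j, c). [[c, j], [j, c]]) (enumerate k cs)))" if "n \<le> k" for k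
    using assms that
  proof (induction cs arbitrary: k)
    case (Cons c cs)
    have "[c, k] \<noteq> e \<and> [k, c] \<noteq> e"
      if "e \<in> set (concat (map (\<lambda>(j, c). [[c, j], [j, c]]) (enumerate (Suc k) cs)))" for e
    proof -
      from that obtain j c' where "(j, c') \<in> set (enumerate (Suc k) cs)" "e = [c', j] \<or> e = [j, c']"
        by (auto simp del: in_set_enumerate_eq)
      then have "Suc k \<le> j" "e = [c', j] \<or> e = [j, c']" by (auto simp: in_set_enumerate_eq)
      with Cons.prems show ?thesis by auto
    qed
    then have "[c, k] \<notin> set (concat (map (\<lambda>(j, c). [[c, j], [j, c]]) (enumerate (Suc k) cs)))"
      "[k, c] \<notin> set (concat (map (\<lambda>(j, c). [[c, j], [j, c]]) (enumerate (Suc k) cs)))" by blast+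
    moreover have "distinct (concat (map (\<lambda>(j, c). [[c, j], [j, c]]) (enumerate (Suc k) cs)))"
      using Cons.prems by (intro Cons.IH) auto
    moreover have "c \<noteq> k" using Cons.prems by auto
    ultimately show ?case by (simp del: set_concat)
  qed simp
  then show ?thesis by blast
qed

lemma star_forest_star_graph:
  assumes A: "wf_struct A"
  shows "star_forest (star_graph A)"
proof -
  let ?L = "first_leaf A" and ?N = "star_order A"
  \<comment> \<open>With every centre counted as its own, the stars are the fibres of this map; a
    centre without leaves gives a star with one vertex.\<close>
  define centre where "centre v = (if v < ?L then v else leaves A ! (v - ?L))" for v
  have centre: "centre v < ?L" if "v < ?N" for v
    using that centre_less[OF A, of "leaves A ! (v - ?L)"] by (auto simp: centre_def star_order_def)
  have edge: "[u, v] \<in> set (star_edges A) \<longleftrightarrow>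
      (v < ?N \<and> u = centre v \<and> v \<noteq> u) \<or> (u < ?N \<and> v = centre u \<and> v \<noteq> u)" for u v
    using centre[of u] centre[of v] unfolding set_star_edges by (auto simp: centre_def)
  have L: "?L \<le> ?N" by (simp add: star_order_def)
  have cc: "centre c = c" if "c < ?L" for c using that by (simp add: centre_def)
  define part where "part c = {v. v < ?N \<and> centre v = c}" for c
  \<comment> \<open>All vertices of a part have the same centre, so it does not matter which one is
    chosen.\<close>
  define cen where "cen S = centre (SOME v. v \<in> S)" for S
  have c_part: "c \<in> part c" if "c < ?L" for c using that L cc by (auto simp: part_def)
  have cen_part: "cen (part c) = c" if "c < ?L" for c
    using someI[of "\<lambda>v. v \<in> part c", OF c_part[OF that]] by (simp add: cen_def part_def)
  have "partition_on {..<?N} (part ` {..<?L})"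
  proof (rule partition_onI)
    show "\<Union> (part ` {..<?L}) = {..<?N}" using centre by (auto simp: part_def)
    show "disjnt p q" if "p \<in> part ` {..<?L}" "q \<in> part ` {..<?L}" "p \<noteq> q" for p q
      using that by (auto simp: disjnt_def part_def)
    show "{} \<notin> part ` {..<?L}" using c_part by auto
  qed
  moreover have "\<forall>S \<in> part ` {..<?L}. cen S \<in> S" using cen_part c_part by auto
  moreover have "adj (star_graph A) =
      (\<Union>S \<in> part ` {..<?L}. {cen S} \<times> (S - {cen S}) \<union> (S - {cen S}) \<times> {cen S})" (is "?l = ?r")
  proof (rule set_eqI)
    fix e :: "nat \<times> nat"
    obtain u v where e: "e = (u, v)" by fastforce
    have "e \<in> ?r \<longleftrightarrow> (\<exists>c < ?L. (u = c \<and> v \<in> part c \<and> v \<noteq> c) \<or> (v = c \<and> u \<in> part c \<and> u \<noteq> c))"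
      unfolding e using cen_part by auto
    also have "\<dots> \<longleftrightarrow> (u < ?L \<and> v \<in> part u \<and> v \<noteq> u) \<or> (v < ?L \<and> u \<in> part v \<and> u \<noteq> v)" by auto
    also have "\<dots> \<longleftrightarrow> e \<in> ?l"
      unfolding e star_graph_def using centre by (auto simp: edge part_def)
    finally show "e \<in> ?l \<longleftrightarrow> e \<in> ?r" ..
  qed
  moreover have "simple_graph (star_graph A)"
  proof -
    have "u < ?N \<and> v < ?N" if "[u, v] \<in> set (star_edges A)" for u v
      using that centre[of u] centre[of v] L unfolding edge by auto
    moreover have "0 < ?N" by (simp add: star_order_def first_leaf_def offset_def)
    moreover have "[u, v] \<in> set (star_edges A) \<longleftrightarrow> [v, u] \<in> set (star_edges A)" for u v
      unfolding edge by auto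
    moreover have "[u, u] \<notin> set (star_edges A)" for u unfolding edge by simp
    ultimately show ?thesis by (auto simp: simple_graph_def star_graph_def sym_def irrefl_def)
  qed
  ultimately show ?thesis unfolding star_forest_def by (auto simp: star_graph_def)
qed

definition path_rel :: "nat \<Rightarrow> nat rel" where
  "path_rel n = {(i, Suc i) | i. Suc i < n}"

lemma successor_path_rel: "successor_relation_of G (path_rel (order G))"
proof -
  let ?vs = "[0..<order G]"
  have "path_rel (order G) = {(?vs ! i, ?vs ! Suc i) | i. Suc i < length ?vs}"
    unfolding path_rel_def by (intro Collect_cong ex_cong1) auto
  then show ?thesis unfolding successor_relation_of_def
    by (intro exI[of _ ?vs]) (simp add: atLeast0LessThan)
qed

lemma lists_rel_path: "lists_rel (path_edges n) (path_rel n)"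
  by (auto simp: lists_rel_def path_edges_def path_rel_def distinct_map inj_on_def image_iff)

lemma star_struct_expansion:
  assumes "wf_struct A"
  shows "star_struct A \<in> expansions (star_graph A) (path_rel (order (star_graph A)))"
proof -
  have "\<exists>u v. e = [u, v]" if "e \<in> set (star_edges A)" for e
    using that by (auto simp: star_edges_def)
  then have "set (star_edges A) = (\<lambda>(u, v). [u, v]) ` adj (star_graph A)"
    by (force simp: star_graph_def image_iff)
  moreover have "distinct (star_edges A)"
    using distinct_star_edges[of "leaves A" "first_leaf A"] centre_less[OF assms] by (simp add: star_edges_def)
  ultimately have "lists_rel (star_edges A) (adj (star_graph A))" by (simp add: lists_rel_def)
  moreover have "order (star_graph A) = star_order A" by (simp add: star_graph_def)
  ultimately show ?thesis unfolding expansions_def star_struct_def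
    using lists_rel_path[of "star_order A"] by auto
qed


section \<open>The program for the star structure\<close>

definition const :: "nat \<Rightarrow> lexp" where "const k = (k, [], [])"
definition reg_plus :: "nat \<Rightarrow> nat \<Rightarrow> lexp" where "reg_plus k r = (k, [r], [])"
definition ctr_plus :: "nat \<Rightarrow> nat \<Rightarrow> lexp" where "ctr_plus k c = (k, [], [c])"

lemma leval_simps [simp]:
  "leval s (const k) = k" "leval s (reg_plus k r) = k + rv s r" "leval s (ctr_plus k c) = k + ct s c"
  "leval s (k, rs, cs) = k + sum_list (map (rv s) rs) + sum_list (map (ct s) cs)"
  by (simp_all add: leval_def const_def reg_plus_def ctr_plus_def)

lemma map_leval_const [simp]: "map (leval s \<circ> const) ns = ns"
  by (simp add: o_def)

text \<open>
  Counter 0 is the vertex created last, counter 1 the centre of the current relation, counter 2 the number of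
  edges, and counter 3 runs through the universe.  Read registers 0 and 1 hold the size of the universe and the
  number of relations.  Outputs 1, 3 and 4 are the edges, the successor relation and the formula;
  outputs 0 and 2 are the numbers in front of them.
\<close>

definition new_vertex :: prg where
  "new_vertex = Emit 3 [ctr_plus 0 0, ctr_plus 1 0] ;; Inc 0"

definition new_leaf :: "lexp \<Rightarrow> prg" where
  "new_leaf e = new_vertex ;; Emit 1 [e, ctr_plus 0 0, ctr_plus 0 0, e] ;; Inc 2 ;; Inc 2"

text \<open>The constant pieces of the token list of \<open>tuple_fo\<close>, cut where the program
  inserts repeated pieces or variables.\<close>

definition tuple_head :: "nat list" where
  "tuple_head = [5, 0, 3, 2, 5, 1, 1, 1, 2, 1, 0]"

definition walk_tokens :: "nat list" where
  "walk_tokens = [5, 1, 3, 1, 1, 2, 0, 1, 5, 0, 3, 0, 0, 1]"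

definition tuple_mid :: "nat list" where
  "tuple_mid = [5, 1, 3, 1, 0, 2, 0, 1, 5, 0, 3, 0, 0, 1]"

definition slot_head :: "nat list" where
  "slot_head = [5, 1, 3, 1, 1, 2, 0, 1, 3, 1, 0, 2]"

definition slot_tail :: "nat list" where
  "slot_tail = [1, 5, 0, 3, 0, 0, 1]"

lemma fo_tokens_walk: "fo_tokens (walk k \<phi>) = concat (replicate k walk_tokens) @ fo_tokens \<phi>"
  by (induction k) (auto simp: walk_tokens_def)

lemma fo_tokens_slots:
  "fo_tokens (slots xs) = concat (map (\<lambda>x. slot_head @ x # slot_tail) xs) @ [0, 0, 0]"
  by (induction xs) (auto simp: slot_head_def slot_tail_def)

lemma fo_tokens_tuple_fo:
  "fo_tokens (tuple_fo i xs) = tuple_head @ concat (replicate i walk_tokens) @ tuple_mid @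
     concat (map (\<lambda>x. slot_head @ x # slot_tail) xs) @ [0, 0, 0]"
  by (simp add: tuple_fo_def fo_tokens_walk fo_tokens_slots tuple_head_def tuple_mid_def)

definition universe_lexps :: "nat \<Rightarrow> lexp list" where
  "universe_lexps r = map const tuple_head @ map const tuple_mid @ map const slot_head @ reg_plus 2 r #
     map const slot_tail @ map const [0, 0, 0]"

lemma map_leval_universe [simp]:
  "map (leval s) (universe_lexps r) = fo_tokens (tuple_fo 0 [rv s r + 2])"
  by (simp add: universe_lexps_def fo_tokens_tuple_fo)

definition star_fo_step :: prg where
  "star_fo_step =
     IfLess (reg_plus 0 4) (const 1)
       (Read 5 ;; Read 6 ;; Emit 4 [const 0, reg_plus 2 5, reg_plus 2 6])
     (IfLess (reg_plus 0 4) (const 2)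
       (Read 5 ;; Read 6 ;; Emit 4 (map const tuple_head @ map const walk_tokens) ;;
        Repeat 5 (Emit 4 (map const walk_tokens)) ;; Emit 4 (map const tuple_mid) ;;
        Repeat 6 (Read 7 ;; Emit 4 (map const slot_head @ reg_plus 2 7 # map const slot_tail)) ;;
        Emit 4 (map const [0, 0, 0]))
     (IfLess (reg_plus 0 4) (const 5)
       (Emit 4 [reg_plus 0 4])
     (IfLess (reg_plus 0 4) (const 6)
       (Read 5 ;; Emit 4 ([const 5, reg_plus 2 5, const 3] @ universe_lexps 5))
       (Read 5 ;; Emit 4 ([const 6, reg_plus 2 5, const 4, const 2] @ universe_lexps 5)))))"

text \<open>Vertex 0 needs no creation, so the two loops over \<open>new_vertex\<close> supply the
  remaining centres. For the same reason counter 0 finally equals the number of successor pairs, one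
  less than the number of vertices. In the centres, 1 plus register 1 is
  \<open>offset A\<close>.\<close>

definition star_prg :: prg where
  "star_prg = Read 0 ;; Read 1 ;; Repeat 0 new_vertex ;; Repeat 1 new_vertex ;;
     Repeat 0 (new_leaf (const 0) ;; new_leaf (1, [1], [3]) ;; Inc 3) ;;
     Repeat 1 (Inc 1 ;; Read 2 ;; Read 3 ;;
       Repeat 3 (new_leaf (ctr_plus 0 1) ;; Repeat 2 (Read 4 ;; new_leaf (1, [1, 4], [])))) ;;
     WhileRead 4 star_fo_step ;;
     Emit 0 [ctr_plus 1 0, const 2, const 2, ctr_plus 0 2] ;; Emit 2 [const 2, ctr_plus 0 0]"

lemma funpow_Suc_apply: "(f ^^ Suc n) x = (f ^^ n) (f x)"
  by (simp add: funpow_swap1)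

text \<open>One round translates one tag with its arguments. Read registers are scratch and not
  mentioned; counters must survive, because the sizes they hold are written only after the
  formula.\<close>

definition emits :: "prg \<Rightarrow> st \<Rightarrow> nat list \<Rightarrow> nat list \<Rightarrow> bool" where
  "emits p s rest ns \<longleftrightarrow> inp (read_step 4 p s) = rest \<and> ct (read_step 4 p s) = ct s \<and>
     out (read_step 4 p s) = (out s)(4 := out s 4 @ ns)"

definition translates :: "prg \<Rightarrow> st \<Rightarrow> nat list \<Rightarrow> nat list \<Rightarrow> bool" where
  "translates p s rest ns \<longleftrightarrow> (\<exists>k. inp ((read_step 4 p ^^ k) s) = rest \<and> ct ((read_step 4 p ^^ k) s) = ct s \<and>
     out ((read_step 4 p ^^ k) s) = (out s)(4 := out s 4 @ ns))"

lemma sem_translates: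
  assumes "translates p s [] ns"
  shows "ct (sem (WhileRead 4 p) s) = ct s" "out (sem (WhileRead 4 p) s) = (out s)(4 := out s 4 @ ns)"
proof -
  from assms obtain k where "inp ((read_step 4 p ^^ k) s) = []" "ct ((read_step 4 p ^^ k) s) = ct s"
    "out ((read_step 4 p ^^ k) s) = (out s)(4 := out s 4 @ ns)"
    unfolding translates_def by blast
  then show "ct (sem (WhileRead 4 p) s) = ct s" "out (sem (WhileRead 4 p) s) = (out s)(4 := out s 4 @ ns)"
    by (simp_all only: read_steps_eq)
qed

text \<open>Common to both translations: connectives are copied, atoms are replaced at once, and a
  quantifier becomes a prefix independent of its scope. The number of rounds may stay existential,
  as \<open>read_steps_eq\<close> asks only that the input be exhausted.\<close>

lemma fo_steps:
  assumes "\<And>s rest x y. inp s = fo_tokens (Eq x y) @ rest \<Longrightarrow> emits p s rest (fo_tokens (T (Eq x y)))"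
    and "\<And>s rest i xs. inp s = fo_tokens (Rel i xs) @ rest \<Longrightarrow> over_arities as (Rel i xs) \<Longrightarrow>
      emits p s rest (fo_tokens (T (Rel i xs)))"
    and "\<And>s rest k. inp s = k # rest \<Longrightarrow> 2 \<le> k \<Longrightarrow> k < 5 \<Longrightarrow> emits p s rest [k]"
    and "\<And>s rest x. inp s = 5 # x # rest \<Longrightarrow> emits p s rest (ex x)"
    and "\<And>s rest x. inp s = 6 # x # rest \<Longrightarrow> emits p s rest (all x)"
    and T: "\<And>\<phi>. T (Neg \<phi>) = Neg (T \<phi>)" "\<And>\<phi> \<psi>. T (Conj \<phi> \<psi>) = Conj (T \<phi>) (T \<psi>)"
      "\<And>\<phi> \<psi>. T (Disj \<phi> \<psi>) = Disj (T \<phi>) (T \<psi>)"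
      "\<And>x \<phi>. fo_tokens (T (Ex x \<phi>)) = ex x @ fo_tokens (T \<phi>)"
      "\<And>x \<phi>. fo_tokens (T (All x \<phi>)) = all x @ fo_tokens (T \<phi>)"
    and "inp s = fo_tokens \<phi> @ rest" "over_arities as \<phi>"
  shows "translates p s rest (fo_tokens (T \<phi>))"
proof -
  let ?f = "read_step 4 p"
  define ok where "ok s rest ns k \<longleftrightarrow> inp ((?f ^^ k) s) = rest \<and> ct ((?f ^^ k) s) = ct s \<and>
    out ((?f ^^ k) s) = (out s)(4 := out s 4 @ ns)" for s rest ns k
  have one: "ok s rest ns 1" if "emits p s rest ns" for s rest ns
    using that by (simp add: emits_def ok_def)
  have inp: "inp ((?f ^^ k) s) = rest" if "ok s rest ns k" for s rest ns k
    using that by (simp add: ok_def)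
  have comp: "\<exists>k. ok s rest (ms @ ns) k" if "ok s rest' ms j" "\<exists>k. ok ((?f ^^ j) s) rest ns k" for s rest rest' ms ns j
  proof -
    from that(2) obtain k where k: "ok ((?f ^^ j) s) rest ns k" by blast
    have "(?f ^^ (k + j)) s = (?f ^^ k) ((?f ^^ j) s)" by (simp only: funpow_add o_apply)
    with that(1) k show ?thesis by (intro exI[of _ "k + j"]) (simp add: ok_def)
  qed
  have "\<exists>k. ok s rest (fo_tokens (T \<phi>)) k" using assms(11,12)
  proof (induction \<phi> arbitrary: s rest)
    case (Eq x y)
    show ?case using one[OF assms(1)[OF Eq.prems(1)]] by blast
  next
    case (Rel i xs)
    show ?case using one[OF assms(2)[OF Rel.prems]] by blast
  next
    case (Neg \<phi>)
    have 1: "ok s (fo_tokens \<phi> @ rest) [2] 1" by (rule one[OF assms(3)]) (use Neg.prems in simp_all)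
    from comp[OF 1 Neg.IH[OF inp[OF 1]]] Neg.prems show ?case by (simp add: T)
  next
    case (Conj \<phi> \<psi>)
    have 1: "ok s (fo_tokens \<phi> @ fo_tokens \<psi> @ rest) [3] 1" by (rule one[OF assms(3)]) (use Conj.prems in simp_all)
    from comp[OF 1 Conj.IH(1)[OF inp[OF 1]]] Conj.prems
    obtain j where j: "ok s (fo_tokens \<psi> @ rest) ([3] @ fo_tokens (T \<phi>)) j" by auto
    from comp[OF j Conj.IH(2)[OF inp[OF j]]] Conj.prems show ?case by (simp add: T)
  next
    case (Disj \<phi> \<psi>)
    have 1: "ok s (fo_tokens \<phi> @ fo_tokens \<psi> @ rest) [4] 1" by (rule one[OF assms(3)]) (use Disj.prems in simp_all)
    from comp[OF 1 Disj.IH(1)[OF inp[OF 1]]] Disj.prems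
    obtain j where j: "ok s (fo_tokens \<psi> @ rest) ([4] @ fo_tokens (T \<phi>)) j" by auto
    from comp[OF j Disj.IH(2)[OF inp[OF j]]] Disj.prems show ?case by (simp add: T)
  next
    case (Ex x \<phi>)
    have 1: "ok s (fo_tokens \<phi> @ rest) (ex x) 1" by (rule one[OF assms(4)]) (use Ex.prems in simp)
    from comp[OF 1 Ex.IH[OF inp[OF 1]]] Ex.prems show ?case by (simp add: T)
  next
    case (All x \<phi>)
    have 1: "ok s (fo_tokens \<phi> @ rest) (all x) 1" by (rule one[OF assms(5)]) (use All.prems in simp)
    from comp[OF 1 All.IH[OF inp[OF 1]]] All.prems show ?case by (simp add: T)
  qed
  then show ?thesis unfolding ok_def translates_def .
qed

lemma emits_star_Rel:
  assumes "inp s = fo_tokens (Rel i xs) @ rest"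
  shows "emits star_fo_step s rest (fo_tokens (star_fo (Rel i xs)))"
proof -
  define s1 where "s1 = sem (Emit 4 (map const tuple_mid)) (sem (Repeat 5 (Emit 4 (map const walk_tokens)))
    (sem (Emit 4 (map const tuple_head @ map const walk_tokens)) (read 6 (read 5 (read 4 s)))))"
  have rep: "(sem (Emit 4 (map const ns)) ^^ k) t = t\<lparr>out := (out t)(4 := out t 4 @ concat (replicate k ns))\<rparr>" for ns k t
    by (induction k arbitrary: t) (simp_all add: funpow_Suc_apply del: funpow.simps(2))
  have s1: "inp s1 = xs @ rest" "ct s1 = ct s" "rv s1 6 = length xs"
    "out s1 = (out s)(4 := out s 4 @ tuple_head @ concat (replicate (Suc i) walk_tokens) @ tuple_mid)"
    using assms by (simp_all add: s1_def read_def rep del: sem.simps(4)) (simp_all add: fun_eq_iff)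
  define slot where "slot = sem (Read 7 ;; Emit 4 (map const slot_head @ reg_plus 2 7 # map const slot_tail))"
  have slots: "inp ((slot ^^ length ys) t) = rest \<and> ct ((slot ^^ length ys) t) = ct t \<and>
      out ((slot ^^ length ys) t) = (out t)(4 := out t 4 @ concat (map (\<lambda>x. slot_head @ x # slot_tail) (map (\<lambda>x. x + 2) ys)))"
    if "inp t = ys @ rest" for ys t
    using that
  proof (induction ys arbitrary: t)
    case (Cons y ys)
    have "inp (slot t) = ys @ rest" "ct (slot t) = ct t"
      "out (slot t) = (out t)(4 := out t 4 @ slot_head @ (y + 2) # slot_tail)"
      using Cons.prems by (simp_all add: slot_def read_def)
    with Cons.IH[of "slot t"] show ?case by (simp add: funpow_Suc_apply fun_eq_iff del: funpow.simps(2))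
  qed simp
  have "read_step 4 star_fo_step s = sem (Emit 4 (map const [0, 0, 0])) ((slot ^^ rv s1 6) s1)"
    using assms unfolding slot_def s1_def
    by (simp add: read_step_def star_fo_step_def read_def del: sem.simps(4,6)) simp
  with slots[OF s1(1)] s1 show ?thesis by (simp add: emits_def fo_tokens_tuple_fo)
qed

lemma star_fo_steps:
  assumes "inp s = fo_tokens \<phi> @ rest" "over_arities as \<phi>"
  shows "translates star_fo_step s rest (fo_tokens (star_fo \<phi>))"
proof (rule fo_steps[where T = star_fo and as = as and ex = "\<lambda>x. [5, x + 2, 3] @ fo_tokens (tuple_fo 0 [x + 2])"
      and all = "\<lambda>x. [6, x + 2, 4, 2] @ fo_tokens (tuple_fo 0 [x + 2])"])
  show "emits star_fo_step s rest (fo_tokens (star_fo (Rel i xs)))" if "inp s = fo_tokens (Rel i xs) @ rest" for s rest i xs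
    using that by (rule emits_star_Rel)
  show "emits star_fo_step s rest (fo_tokens (star_fo (Eq x y)))" if "inp s = fo_tokens (Eq x y) @ rest" for s rest x y
    using that by (simp add: emits_def read_step_def read_def star_fo_step_def)
  show "emits star_fo_step s rest [k]" if "inp s = k # rest" "2 \<le> k" "k < 5" for s rest k
    using that by (simp add: emits_def read_step_def read_def star_fo_step_def)
  show "emits star_fo_step s rest ([5, x + 2, 3] @ fo_tokens (tuple_fo 0 [x + 2]))" if "inp s = 5 # x # rest" for s rest x
    using that by (simp add: emits_def read_step_def read_def star_fo_step_def)
  show "emits star_fo_step s rest ([6, x + 2, 4, 2] @ fo_tokens (tuple_fo 0 [x + 2]))" if "inp s = 6 # x # rest" for s rest x
    using that by (simp add: emits_def read_step_def read_def star_fo_step_def)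
qed (use assms in simp_all)

text \<open>\<open>cs\<close> lists the centres of the leaves added between two states. Counter 0 is
  the last vertex, so their numbers start at its successor; the edge count rises by two per leaf,
  one for each orientation.\<close>

definition grown :: "nat list \<Rightarrow> st \<Rightarrow> st \<Rightarrow> bool" where
  "grown cs s s' \<longleftrightarrow> ct s' 0 = ct s 0 + length cs \<and> ct s' 2 = ct s 2 + 2 * length cs \<and>
     out s' = (out s)(3 := out s 3 @ concat (map (\<lambda>i. [i, Suc i]) [ct s 0..<ct s 0 + length cs]),
       1 := out s 1 @ concat (map (\<lambda>(j, c). [c, j, j, c]) (enumerate (Suc (ct s 0)) cs)))"

lemma grown_Nil: "ct s' 0 = ct s 0 \<Longrightarrow> ct s' 2 = ct s 2 \<Longrightarrow> out s' = out s \<Longrightarrow> grown [] s s'"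
  by (simp add: grown_def)

lemma grown_append:
  assumes "grown cs s s'" "grown ds s' s''"
  shows "grown (cs @ ds) s s''"
proof -
  have "enumerate n (cs @ ds) = enumerate n cs @ enumerate (n + length cs) ds" for n
    by (simp add: enumerate_append_eq)
  moreover have "[i..<i + (j + k)] = [i..<i + j] @ [i + j..<i + j + k]" for i j k :: nat
    using upt_add_eq_append[of i "i + j" k] by (simp add: add.assoc)
  ultimately show ?thesis using assms by (simp add: grown_def fun_eq_iff)
qed

lemma grown_cong:
  assumes "grown cs s s'" "ct t 0 = ct s 0" "ct t 2 = ct s 2" "out t = out s"
    "ct t' 0 = ct s' 0" "ct t' 2 = ct s' 2" "out t' = out s'"
  shows "grown cs t t'"
  using assms by (simp add: grown_def)

lemma sem_new_leaf:
  assumes "e = const c \<or> e = ctr_plus 0 1 \<or> e = (1, rs, []) \<or> e = (1, rs, [3])"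
  shows "inp (sem (new_leaf e) s) = inp s" "rv (sem (new_leaf e) s) = rv s"
    "ct (sem (new_leaf e) s) 1 = ct s 1" "ct (sem (new_leaf e) s) 3 = ct s 3"
    "grown [leval s e] s (sem (new_leaf e) s)"
  using assms by (auto simp: new_leaf_def new_vertex_def grown_def fun_eq_iff)

lemma sem_universe_leaves:
  fixes s defines "f \<equiv> sem (new_leaf (const 0) ;; new_leaf (1, [1], [3]) ;; Inc 3)"
  shows "inp ((f ^^ n) s) = inp s \<and> rv ((f ^^ n) s) = rv s \<and> ct ((f ^^ n) s) 1 = ct s 1 \<and>
    ct ((f ^^ n) s) 3 = ct s 3 + n \<and>
    grown (concat (map (\<lambda>e. [0, Suc (rv s 1) + e]) [ct s 3..<ct s 3 + n])) s ((f ^^ n) s)"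
proof (induction n)
  case 0
  show ?case by (simp add: grown_Nil)
next
  case (Suc n)
  let ?s = "(f ^^ n) s"
  let ?s1 = "sem (new_leaf (const 0)) ?s"
  let ?s2 = "sem (new_leaf (1, [1], [3])) ?s1"
  have eq: "f ?s = sem (Inc 3) ?s2" by (simp add: f_def)
  note l1 = sem_new_leaf[where e = "const 0" and s = ?s and c = 0, simplified]
  note l2 = sem_new_leaf[where e = "(1, [1], [3])" and s = ?s1 and rs = "[1]", simplified]
  have "grown ([0] @ [Suc (rv s 1) + (ct s 3 + n)]) ?s ?s2"
    using l1 l2 Suc by (intro grown_append[of _ _ ?s1]) simp_all
  then have "grown ([0] @ [Suc (rv s 1) + (ct s 3 + n)]) ?s (f ?s)"
    unfolding eq by (rule grown_cong) simp_all
  with Suc have "grown (concat (map (\<lambda>e. [0, Suc (rv s 1) + e]) [ct s 3..<ct s 3 + n]) @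
      [0, Suc (rv s 1) + (ct s 3 + n)]) s (f ?s)"
    by (intro grown_append[of _ _ ?s]) simp_all
  moreover have "inp (f ?s) = inp ?s" "rv (f ?s) = rv ?s" "ct (f ?s) 1 = ct ?s 1" "ct (f ?s) 3 = Suc (ct ?s 3)"
    using l1 l2 unfolding eq by simp_all
  ultimately show ?case using Suc by simp
qed

lemma sem_tuple_leaves:
  fixes s defines "f \<equiv> sem (Read 4 ;; new_leaf (1, [1, 4], []))"
  assumes "inp s = t @ rest"
  shows "inp ((f ^^ length t) s) = rest \<and> (\<forall>i<4. rv ((f ^^ length t) s) i = rv s i) \<and>
    ct ((f ^^ length t) s) 1 = ct s 1 \<and> grown (map ((+) (Suc (rv s 1))) t) s ((f ^^ length t) s)"
  using assms(2)
proof (induction t arbitrary: s)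
  case Nil
  then show ?case by (simp add: grown_Nil)
next
  case (Cons e t)
  let ?s1 = "read 4 s"
  have s1: "inp ?s1 = t @ rest" "rv ?s1 = (rv s)(4 := e)" "ct ?s1 = ct s" "out ?s1 = out s"
    using Cons.prems by (simp_all add: read_def)
  have f: "f s = sem (new_leaf (1, [1, 4], [])) ?s1" by (simp add: f_def)
  note l = sem_new_leaf[where e = "(1, [1, 4], [])" and s = ?s1 and rs = "[1, 4]", simplified]
  have "grown [Suc (rv s 1) + e] ?s1 (f s)" using l(5) s1 unfolding f by simp
  then have g: "grown [Suc (rv s 1) + e] s (f s)" by (rule grown_cong) (simp_all add: s1)
  have fs: "inp (f s) = t @ rest" "rv (f s) = (rv s)(4 := e)" "ct (f s) 1 = ct s 1"
    using l(1-3) s1 unfolding f by simp_all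
  have rv1: "rv (f s) 1 = rv s 1" by (simp add: fs(2))
  note IH = Cons.IH[OF fs(1), unfolded rv1 fs(3)]
  have "grown ([Suc (rv s 1) + e] @ map ((+) (Suc (rv s 1))) t) s ((f ^^ length t) (f s))"
    by (rule grown_append[OF g]) (use IH in blast)
  with IH fs(2) show ?case by (simp add: funpow_Suc_apply del: funpow.simps(2) add_Suc)
qed

lemma sem_relation_leaves:
  fixes s defines "f \<equiv> sem (new_leaf (ctr_plus 0 1) ;; Repeat 2 (Read 4 ;; new_leaf (1, [1, 4], [])))"
  assumes "inp s = concat ts @ rest" "\<forall>t \<in> set ts. length t = rv s 2"
  shows "inp ((f ^^ length ts) s) = rest \<and> (\<forall>i<4. rv ((f ^^ length ts) s) i = rv s i) \<and>
    ct ((f ^^ length ts) s) 1 = ct s 1 \<and>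
    grown (concat (map (\<lambda>t. ct s 1 # map ((+) (Suc (rv s 1))) t) ts)) s ((f ^^ length ts) s)"
  using assms(2,3)
proof (induction ts arbitrary: s)
  case Nil
  then show ?case by (simp add: grown_Nil)
next
  case (Cons t ts)
  let ?s1 = "sem (new_leaf (ctr_plus 0 1)) s"
  let ?g = "sem (Read 4 ;; new_leaf (1, [1, 4], []))"
  note l = sem_new_leaf[where e = "ctr_plus 0 1" and s = s, simplified]
  have f: "f s = (?g ^^ length t) ?s1" using l Cons.prems(2) by (simp add: f_def)
  have "inp ?s1 = t @ concat ts @ rest" using l Cons.prems(1) by simp
  note t = sem_tuple_leaves[OF this, folded f]
  have "grown ([ct s 1] @ map ((+) (Suc (rv s 1))) t) s (f s)"
    using t l by (intro grown_append[of _ _ ?s1]) simp_all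
  moreover have fs: "inp (f s) = concat ts @ rest" "\<forall>i<4. rv (f s) i = rv s i" "ct (f s) 1 = ct s 1"
    using t l by simp_all
  moreover have "rv (f s) 2 = rv s 2" "rv (f s) 1 = rv s 1" using fs(2) by simp_all
  ultimately have g: "grown ([ct s 1] @ map ((+) (Suc (rv s 1))) t) s (f s)"
    and fs: "inp (f s) = concat ts @ rest" "\<forall>i<4. rv (f s) i = rv s i" "ct (f s) 1 = ct s 1"
      "rv (f s) 2 = rv s 2" "rv (f s) 1 = rv s 1" by blast+
  have "\<forall>t \<in> set ts. length t = rv (f s) 2" using Cons.prems(2) fs(4) by simp
  note IH = Cons.IH[OF fs(1) this, unfolded fs(3,5)]
  have "grown (([ct s 1] @ map ((+) (Suc (rv s 1))) t) @ concat (map (\<lambda>t. ct s 1 # map ((+) (Suc (rv s 1))) t) ts))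
      s ((f ^^ length ts) (f s))"
    by (rule grown_append[OF g]) (use IH in blast)
  with IH fs(2) show ?case by (simp add: funpow_Suc_apply del: funpow.simps(2) add_Suc)
qed

text \<open>Counter 1 is raised before a relation is read, which yields the centre
  \<open>Suc i\<close> for the relation with index \<open>i\<close>; the enumeration therefore
  starts at the old value.\<close>

lemma sem_relations_leaves:
  fixes s defines "f \<equiv> sem (Inc 1 ;; Read 2 ;; Read 3 ;;
       Repeat 3 (new_leaf (ctr_plus 0 1) ;; Repeat 2 (Read 4 ;; new_leaf (1, [1, 4], []))))"
  assumes "inp s = concat (map (\<lambda>(r, ts). r # length ts # concat ts) Rs) @ rest"
    and "\<forall>(r, ts) \<in> set Rs. \<forall>t \<in> set ts. length t = r"
  shows "inp ((f ^^ length Rs) s) = rest \<and> rv ((f ^^ length Rs) s) 1 = rv s 1 \<and>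
    grown (concat (map (\<lambda>(i, R). rel_leaves (Suc (rv s 1)) i R) (enumerate (ct s 1) Rs))) s ((f ^^ length Rs) s)"
  using assms(2,3)
proof (induction Rs arbitrary: s)
  case Nil
  then show ?case by (simp add: grown_Nil)
next
  case (Cons R Rs)
  obtain r ts where R: "R = (r, ts)" by fastforce
  define s1 where "s1 = read 3 (read 2 (sem (Inc 1) s))"
  define g where "g = sem (new_leaf (ctr_plus 0 1) ;; Repeat 2 (Read 4 ;; new_leaf (1, [1, 4], [])))"
  define rest1 where "rest1 = concat (map (\<lambda>(r, ts). r # length ts # concat ts) Rs) @ rest"
  have s1: "inp s1 = concat ts @ rest1" "rv s1 = (rv s)(2 := r, 3 := length ts)" "ct s1 = (ct s)(1 := Suc (ct s 1))"
    "out s1 = out s"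
    using Cons.prems(1) by (simp_all add: s1_def read_def R rest1_def)
  have "f s = (g ^^ rv s1 3) s1" by (simp add: f_def g_def s1_def)
  then have f: "f s = (g ^^ length ts) s1" by (simp add: s1(2))
  have "\<forall>t \<in> set ts. length t = rv s1 2" using Cons.prems(2) by (simp add: s1 R)
  note t = sem_relation_leaves[OF s1(1) this, folded g_def f]
  have rv1: "rv s1 1 = rv s 1" "ct s1 1 = Suc (ct s 1)" by (simp_all add: s1)
  from t have "grown (concat (map (\<lambda>t. Suc (ct s 1) # map ((+) (Suc (rv s 1))) t) ts)) s1 (f s)"
    unfolding rv1 by blast
  then have "grown (concat (map (\<lambda>t. Suc (ct s 1) # map ((+) (Suc (rv s 1))) t) ts)) s (f s)"
    by (rule grown_cong) (simp_all add: s1)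
  then have g: "grown (rel_leaves (Suc (rv s 1)) (ct s 1) R) s (f s)"
    by (simp add: rel_leaves_def R)
  have fs: "inp (f s) = rest1" "rv (f s) 1 = rv s 1" "ct (f s) 1 = Suc (ct s 1)"
    using t by (simp_all add: s1)
  have "\<forall>(r, ts) \<in> set Rs. \<forall>t \<in> set ts. length t = r" using Cons.prems(2) by simp
  note IH = Cons.IH[OF fs(1)[unfolded rest1_def] this, unfolded fs(2,3)]
  have "grown (rel_leaves (Suc (rv s 1)) (ct s 1) R @
      concat (map (\<lambda>(i, R). rel_leaves (Suc (rv s 1)) i R) (enumerate (Suc (ct s 1)) Rs))) s ((f ^^ length Rs) (f s))"
    by (rule grown_append[OF g]) (use IH in blast)
  with IH show ?case by (simp add: funpow_Suc_apply del: funpow.simps(2))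
qed

lemma sem_new_vertices:
  "(sem new_vertex ^^ n) s = s\<lparr>ct := (ct s)(0 := ct s 0 + n),
     out := (out s)(3 := out s 3 @ concat (map (\<lambda>i. [i, Suc i]) [ct s 0..<ct s 0 + n]))\<rparr>"
proof (induction n)
  case (Suc n)
  then show ?case by (auto intro!: st.equality simp: new_vertex_def fun_eq_iff)
qed simp

lemma result_star_prg:
  assumes "wf_struct A" "over_arities as \<phi>"
  shows "result 5 star_prg (struct_tokens A @ fo_tokens \<phi>) =
    struct_tokens (star_struct A) @ fo_tokens (star_fo \<phi>)"
proof -
  let ?n = "universe A" and ?m = "length (rels A)" and ?L = "first_leaf A"
  let ?Rs = "concat (map (\<lambda>(r, ts). r # length ts # concat ts) (rels A))"
  define s0 where "s0 = sem (Read 0 ;; Read 1 ;; Repeat 0 new_vertex ;; Repeat 1 new_vertex)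
    (st_init (struct_tokens A @ fo_tokens \<phi>))"
  have s0: "inp s0 = ?Rs @ fo_tokens \<phi>" "rv s0 0 = ?n" "rv s0 1 = ?m" "ct s0 = (\<lambda>_. 0)(0 := ?n + ?m)"
    "out s0 = (\<lambda>_. [])(3 := concat (map (\<lambda>i. [i, Suc i]) [0..<?n + ?m]))"
    unfolding s0_def by (simp_all add: sem_new_vertices read_def st_init_def struct_tokens_def)
      (simp_all add: fun_eq_iff upt_add_eq_append[of 0 ?n ?m, simplified])
  define s1 where "s1 = (sem (new_leaf (const 0) ;; new_leaf (1, [1], [3]) ;; Inc 3) ^^ ?n) s0"
  have s1: "inp s1 = ?Rs @ fo_tokens \<phi>" "rv s1 1 = ?m" "ct s1 1 = 0"
    "grown (concat (map (\<lambda>e. [0, offset A + e]) [0..<?n])) s0 s1"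
    using sem_universe_leaves[of ?n s0] s0 by (simp_all add: s1_def offset_def)
  define f2 where "f2 = sem (Inc 1 ;; Read 2 ;; Read 3 ;;
       Repeat 3 (new_leaf (ctr_plus 0 1) ;; Repeat 2 (Read 4 ;; new_leaf (1, [1, 4], []))))"
  define s2 where "s2 = (f2 ^^ ?m) s1"
  have "\<forall>(r, ts) \<in> set (rels A). \<forall>t \<in> set ts. length t = r"
    using wf_structD(1)[OF assms(1)] by fastforce
  from sem_relations_leaves[OF s1(1) this, folded f2_def] s1(2,3)
  have s2: "inp s2 = fo_tokens \<phi>"
    "grown (concat (map (\<lambda>(i, R). rel_leaves (offset A) i R) (enumerate 0 (rels A)))) s1 s2"
    by (simp_all add: s2_def offset_def)
  from grown_append[OF s1(4) s2(2)] have g: "grown (leaves A) s0 s2" by (simp add: leaves_def)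
  define s3 where "s3 = sem (WhileRead 4 star_fo_step) s2"
  have "translates star_fo_step s2 [] (fo_tokens (star_fo \<phi>))"
    using s2(1) assms(2) by (intro star_fo_steps) simp_all
  note s3 = sem_translates[OF this, folded s3_def]
  have prg: "sem star_prg (st_init (struct_tokens A @ fo_tokens \<phi>)) =
      sem (Emit 0 [ctr_plus 1 0, const 2, const 2, ctr_plus 0 2] ;; Emit 2 [const 2, ctr_plus 0 0]) s3"
  proof -
    have "sem star_prg (st_init (struct_tokens A @ fo_tokens \<phi>)) =
      sem (Emit 0 [ctr_plus 1 0, const 2, const 2, ctr_plus 0 2] ;; Emit 2 [const 2, ctr_plus 0 0])
        (sem (WhileRead 4 star_fo_step) ((f2 ^^ rv s1 1) s1))" if "s1 = (sem (new_leaf (const 0) ;; new_leaf (1, [1], [3]) ;; Inc 3) ^^ rv s0 0) s0"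
      unfolding that unfolding s0_def f2_def star_prg_def sem.simps ..
    then show ?thesis using s0(2) s1(2) by (simp only: s1_def s2_def s3_def)
  qed
  \<comment> \<open>The last centre is the value of counter 0 when the leaves begin, so the first
    leaf has the next number.\<close>
  have L: "?L = Suc (?n + ?m)" by (simp add: first_leaf_def offset_def)
  have "result 5 star_prg (struct_tokens A @ fo_tokens \<phi>) =
      [star_order A, 2, 2, length (star_edges A)] @ concat (star_edges A) @
      [2, star_order A - 1] @ concat (path_edges (star_order A)) @ fo_tokens (star_fo \<phi>)"
  proof -
    have "concat (map (\<lambda>(j, c). [c, j, j, c]) xs) = concat (concat (map (\<lambda>(j, c). [[c, j], [j, c]]) xs))" for xs :: "(nat \<times> nat) list"
      by (induction xs) auto
    then have E: "concat (map (\<lambda>(j, c). [c, j, j, c]) (enumerate ?L (leaves A))) = concat (star_edges A)"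
      by (simp add: star_edges_def)
    have "length (concat (map (\<lambda>(j, c). [[c, j], [j, c]]) xs)) = 2 * length xs" for xs :: "(nat \<times> nat) list"
      by (induction xs) auto
    then have len: "length (star_edges A) = 2 * length (leaves A)" by (simp add: star_edges_def)
    have P: "concat (map (\<lambda>i. [i, Suc i]) [0..<?n + ?m]) @
        concat (map (\<lambda>i. [i, Suc i]) [?n + ?m..<?n + ?m + length (leaves A)]) = concat (path_edges (star_order A))"
      using upt_add_eq_append[of 0 "?n + ?m" "length (leaves A)"]
      by (simp add: path_edges_def star_order_def L)
    have "[0..<5] = [0, 1, 2, 3, 4 :: nat]" by (simp add: upt_rec)
    then show ?thesis using g s0 s3 E len P
      by (simp add: result_def prg grown_def L star_order_def)
  qed
  then show ?thesis by (simp add: struct_tokens_def star_struct_def path_edges_def)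
qed


section \<open>Graphs with a successor relation as ordered matchings\<close>

text \<open>
  A vertex \<open>v\<close> of a graph with \<open>N\<close> vertices becomes an interval of \<open>N + 2\<close> vertices: its first two
  vertices are matched, which marks the beginning of an interval, and the vertex
  number \<open>2 + u\<close> is matched with the vertex number \<open>2 + v\<close> of the interval for \<open>u\<close> if \<open>u\<close> and \<open>v\<close> are adjacent.
\<close>

definition match_edges :: "nat \<Rightarrow> nat list list \<Rightarrow> nat list list" where
  "match_edges N es = concat (map (\<lambda>v. [[v * (N + 2), v * (N + 2) + 1], [v * (N + 2) + 1, v * (N + 2)]]) [0..<N]) @
     map (\<lambda>e. [e ! 0 * (N + 2) + 2 + e ! 1, e ! 1 * (N + 2) + 2 + e ! 0]) es"

definition order_edges :: "nat \<Rightarrow> nat list list" where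
  "order_edges n = concat (map (\<lambda>j. map (\<lambda>i. [i, j]) [0..<j]) [0..<n])"

definition succ_struct :: "nat \<Rightarrow> nat list list \<Rightarrow> struct" where
  "succ_struct N es = \<lparr>universe = N, rels = [(2, es), (2, path_edges N)]\<rparr>"

definition match_struct :: "nat \<Rightarrow> nat list list \<Rightarrow> struct" where
  "match_struct N es = \<lparr>universe = N * (N + 2),
     rels = [(2, match_edges N es), (2, order_edges (N * (N + 2)))]\<rparr>"

text \<open>The adjacency lists of simple graphs on \<open>{..<N}\<close>; their symmetry makes the
  edges between intervals symmetric.\<close>

definition sym_edges :: "nat \<Rightarrow> nat list list \<Rightarrow> bool" where
  "sym_edges N es \<longleftrightarrow> distinct es \<and>
    (\<forall>e \<in> set es. \<exists>u v. e = [u, v] \<and> u < N \<and> v < N \<and> u \<noteq> v \<and> [v, u] \<in> set es)"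

text \<open>Says that \<open>z\<close> is matched with its immediate successor in the order. That
  only the beginnings of intervals have this property is shown in \<open>sat_marker\<close>.\<close>

definition marker_fo :: "nat \<Rightarrow> fo" where
  "marker_fo z = Ex 3 (Conj (Rel 0 [z, 3]) (Conj (Rel 1 [z, 3]) (Neg (Ex 4 (Conj (Rel 1 [z, 4]) (Rel 1 [4, 3]))))))"

definition interval_fo :: "nat \<Rightarrow> nat \<Rightarrow> fo" where
  "interval_fo x a = Conj (Rel 1 [x, a]) (Neg (Ex 2 (Conj (marker_fo 2) (Conj (Rel 1 [x, 2]) (Neg (Rel 1 [a, 2]))))))"

definition edge_fo :: "nat \<Rightarrow> nat \<Rightarrow> fo" where
  "edge_fo x y = Ex 0 (Ex 1 (Conj (Rel 0 [0, 1]) (Conj (interval_fo x 0) (interval_fo y 1))))"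

definition succ_fo :: "nat \<Rightarrow> nat \<Rightarrow> fo" where
  "succ_fo x y = Conj (Rel 1 [x, y]) (Neg (Ex 2 (Conj (marker_fo 2) (Conj (Rel 1 [x, 2]) (Rel 1 [2, y])))))"

text \<open>Variables 0 to 4 are reserved for the auxiliary formulas, hence the shift by five. It is
  applied to formulas over two binary symbols, for which the two argument positions exist.\<close>

primrec match_fo :: "fo \<Rightarrow> fo" where
  "match_fo (Eq x y) = Eq (x + 5) (y + 5)"
| "match_fo (Rel i xs) = (if i = 0 then edge_fo else succ_fo) (xs ! 0 + 5) (xs ! 1 + 5)"
| "match_fo (Neg \<phi>) = Neg (match_fo \<phi>)"
| "match_fo (Conj \<phi> \<psi>) = Conj (match_fo \<phi>) (match_fo \<psi>)"
| "match_fo (Disj \<phi> \<psi>) = Disj (match_fo \<phi>) (match_fo \<psi>)"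
| "match_fo (Ex x \<phi>) = Ex (x + 5) (Conj (marker_fo (x + 5)) (match_fo \<phi>))"
| "match_fo (All x \<phi>) = All (x + 5) (Disj (Neg (marker_fo (x + 5))) (match_fo \<phi>))"

lemma free_vars_match_fo:
  "over_arities [2, 2] \<phi> \<Longrightarrow> free_vars (match_fo \<phi>) \<subseteq> (\<lambda>x. x + 5) ` free_vars \<phi>"
proof (induction \<phi>)
  case (Rel i xs)
  then have "length xs = 2" by (auto simp: less_Suc_eq)
  then obtain x y where "xs = [x, y]" by (auto simp: numeral_2_eq_2 length_Suc_conv)
  then show ?case by (auto simp: edge_fo_def succ_fo_def interval_fo_def marker_fo_def)
next
  case (Ex x \<phi>)
  then show ?case by (auto simp: marker_fo_def)
next
  case (All x \<phi>)
  then show ?case by (auto simp: marker_fo_def)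
qed auto

lemma over_arities_match_fo: "over_arities [2, 2] (match_fo \<phi>)"
  by (induction \<phi>) (auto simp: edge_fo_def succ_fo_def interval_fo_def marker_fo_def)

lemma sentence_match:
  assumes "sentence_for (succ_struct N es) \<phi>"
  shows "sentence_for (match_struct N es) (match_fo \<phi>)"
  using assms free_vars_match_fo[of \<phi>]
  by (auto simp: sentence_for_def succ_struct_def match_struct_def over_arities_match_fo)

lemma set_order_edges: "[i, j] \<in> set (order_edges n) \<longleftrightarrow> i < j \<and> j < n"
  by (auto simp: order_edges_def image_iff intro!: bexI[of _ j])

lemma set_match_edges:
  assumes "sym_edges N es"
  shows "[p, q] \<in> set (match_edges N es) \<longleftrightarrow>
    (\<exists>v < N. p = v * (N + 2) \<and> q = v * (N + 2) + 1 \<or> p = v * (N + 2) + 1 \<and> q = v * (N + 2)) \<or>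
    (\<exists>u v. [u, v] \<in> set es \<and> p = u * (N + 2) + 2 + v \<and> q = v * (N + 2) + 2 + u)"
proof -
  have "[p, q] \<in> (\<lambda>e. [e ! 0 * (N + 2) + 2 + e ! 1, e ! 1 * (N + 2) + 2 + e ! 0]) ` set es \<longleftrightarrow>
      (\<exists>u v. [u, v] \<in> set es \<and> p = u * (N + 2) + 2 + v \<and> q = v * (N + 2) + 2 + u)"
  proof
    assume "[p, q] \<in> (\<lambda>e. [e ! 0 * (N + 2) + 2 + e ! 1, e ! 1 * (N + 2) + 2 + e ! 0]) ` set es"
    then obtain e where e: "e \<in> set es" "p = e ! 0 * (N + 2) + 2 + e ! 1" "q = e ! 1 * (N + 2) + 2 + e ! 0" by auto
    moreover from assms e(1) obtain u v where "e = [u, v]" unfolding sym_edges_def by blast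
    ultimately show "\<exists>u v. [u, v] \<in> set es \<and> p = u * (N + 2) + 2 + v \<and> q = v * (N + 2) + 2 + u" by auto
  next
    assume "\<exists>u v. [u, v] \<in> set es \<and> p = u * (N + 2) + 2 + v \<and> q = v * (N + 2) + 2 + u"
    then obtain u v where "[u, v] \<in> set es" "p = u * (N + 2) + 2 + v" "q = v * (N + 2) + 2 + u" by blast
    then show "[p, q] \<in> (\<lambda>e. [e ! 0 * (N + 2) + 2 + e ! 1, e ! 1 * (N + 2) + 2 + e ! 0]) ` set es"
      by (intro image_eqI[of _ _ "[u, v]"]) auto
  qed
  then show ?thesis unfolding match_edges_def set_append Un_iff set_map[symmetric] by auto
qed

lemma sym_edgesD:
  assumes "sym_edges N es" "[u, v] \<in> set es"
  shows "u < N" "v < N" "u \<noteq> v" "[v, u] \<in> set es"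
  using assms unfolding sym_edges_def by force+

lemma div_interval: "r < K \<Longrightarrow> (w * K + r) div K = w" for K w r :: nat
  by simp

lemma mod_interval: "r < K \<Longrightarrow> (w * K + r) mod K = r" for K w r :: nat
  by simp

text \<open>Quotient and remainder modulo \<open>N + 2\<close> are interval and position. Together
  they determine the partner of a vertex, which is where the degree bound comes from.\<close>

lemma match_edges_fun:
  assumes es: "sym_edges N es" and pq: "[p, q] \<in> set (match_edges N es)"
  defines "K \<equiv> N + 2"
  shows "p < N * K" "q < N * K" "p \<noteq> q" "[q, p] \<in> set (match_edges N es)"
    "q = (if p mod K = 0 then p + 1 else if p mod K = 1 then p - 1 else (p mod K - 2) * K + 2 + p div K)"
proof -
  have K: "2 \<le> K" by (simp add: K_def)
  have less: "v * K + r < N * K" if "v < N" "r < K" for v r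
  proof -
    have "v * K + r < Suc v * K" using that(2) by simp
    also have "\<dots> \<le> N * K" using that(1) by (intro mult_le_mono1) simp
    finally show ?thesis .
  qed
  from pq consider v where "v < N" "p = v * K" "q = v * K + 1" | v where "v < N" "p = v * K + 1" "q = v * K"
    | u v where "[u, v] \<in> set es" "p = u * K + (2 + v)" "q = v * K + (2 + u)"
    unfolding set_match_edges[OF es] K_def by (auto simp: add.assoc)
  then have "p < N * K \<and> q < N * K \<and> p \<noteq> q \<and> [q, p] \<in> set (match_edges N es) \<and>
    q = (if p mod K = 0 then p + 1 else if p mod K = 1 then p - 1 else (p mod K - 2) * K + 2 + p div K)"
  proof cases
    case (1 v)
    have "[q, p] \<in> set (match_edges N es)" unfolding set_match_edges[OF es] K_def[symmetric] using 1 by blast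
    moreover have "p mod K = 0" by (simp add: 1)
    ultimately show ?thesis using 1 K less[of v 0] less[of v 1] by simp
  next
    case (2 v)
    have "[q, p] \<in> set (match_edges N es)" unfolding set_match_edges[OF es] K_def[symmetric] using 2 by blast
    moreover have "p mod K = 1" unfolding 2 by (rule mod_interval) (use K in simp)
    ultimately show ?thesis using 2 K less[of v 0] less[of v 1] by simp
  next
    case (3 u v)
    note uv = sym_edgesD[OF es 3(1)]
    have vK: "2 + v < K" and uK: "2 + u < K" using uv by (simp_all add: K_def)
    have pm: "p mod K = 2 + v" unfolding 3(2) by (rule mod_interval[OF vK])
    have pd: "p div K = u" unfolding 3(2) by (rule div_interval[OF vK])
    have qd: "q div K = v" unfolding 3(3) by (rule div_interval[OF uK])
    have "[q, p] \<in> set (match_edges N es)" unfolding set_match_edges[OF es] K_def[symmetric]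
      using uv(4) 3 by (auto simp: add.assoc)
    moreover have "p \<noteq> q" using pd qd uv(3) by auto
    moreover have "p < N * K" unfolding 3(2) by (rule less[OF uv(1) vK])
    moreover have "q < N * K" unfolding 3(3) by (rule less[OF uv(2) uK])
    ultimately show ?thesis using pm pd 3(3) by simp
  qed
  then show "p < N * K" "q < N * K" "p \<noteq> q" "[q, p] \<in> set (match_edges N es)"
    "q = (if p mod K = 0 then p + 1 else if p mod K = 1 then p - 1 else (p mod K - 2) * K + 2 + p div K)"
    by blast+
qed

section \<open>Evaluation of the translated formulas in the ordered matching\<close>

lemma sat_Rel0: "sat (match_struct N es) \<sigma> (Rel 0 [x, y]) \<longleftrightarrow> [\<sigma> x, \<sigma> y] \<in> set (match_edges N es)"
  by (simp add: match_struct_def)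

lemma sat_Rel1:
  "sat (match_struct N es) \<sigma> (Rel 1 [x, y]) \<longleftrightarrow> \<sigma> x < \<sigma> y \<and> \<sigma> y < N * (N + 2)"
  "sat (match_struct N es) \<sigma> (Rel (Suc 0) [x, y]) \<longleftrightarrow> \<sigma> x < \<sigma> y \<and> \<sigma> y < N * (N + 2)"
  by (simp_all add: match_struct_def set_order_edges del: mult_Suc_right)

lemma universe_match: "universe (match_struct N es) = N * (N + 2)"
  by (simp add: match_struct_def)

lemma sat_marker:
  assumes es: "sym_edges N es" and z: "z \<noteq> 3" "z \<noteq> 4"
  shows "sat (match_struct N es) \<sigma> (marker_fo z) \<longleftrightarrow> (\<exists>v < N. \<sigma> z = v * (N + 2))"
proof -
  let ?K = "N + 2"
  have "sat (match_struct N es) \<sigma> (marker_fo z) \<longleftrightarrow>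
      (\<exists>w < N * ?K. [\<sigma> z, w] \<in> set (match_edges N es) \<and> \<sigma> z < w \<and>
        \<not> (\<exists>v < N * ?K. \<sigma> z < v \<and> v < w))"
    using z by (auto simp: marker_fo_def sat_Rel0 sat_Rel1 universe_match simp del: sat.simps(2) mult_Suc_right add_2_eq_Suc')
  also have "\<dots> \<longleftrightarrow> [\<sigma> z, \<sigma> z + 1] \<in> set (match_edges N es)"
  proof
    assume "\<exists>w < N * ?K. [\<sigma> z, w] \<in> set (match_edges N es) \<and> \<sigma> z < w \<and>
        \<not> (\<exists>v < N * ?K. \<sigma> z < v \<and> v < w)"
    then obtain w where w: "w < N * ?K" "[\<sigma> z, w] \<in> set (match_edges N es)" "\<sigma> z < w"
      "\<not> (\<sigma> z < \<sigma> z + 1 \<and> \<sigma> z + 1 < w)"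
      by (meson less_trans)
    then have "w = \<sigma> z + 1" by simp
    with w(2) show "[\<sigma> z, \<sigma> z + 1] \<in> set (match_edges N es)" by simp
  next
    assume a: "[\<sigma> z, \<sigma> z + 1] \<in> set (match_edges N es)"
    from match_edges_fun(2)[OF es this] a show "\<exists>w < N * ?K. [\<sigma> z, w] \<in> set (match_edges N es) \<and> \<sigma> z < w \<and>
        \<not> (\<exists>v < N * ?K. \<sigma> z < v \<and> v < w)" by (intro exI[of _ "\<sigma> z + 1"]) auto
  qed
  also have "\<dots> \<longleftrightarrow> (\<exists>v < N. \<sigma> z = v * ?K)"
  proof
    assume a: "[\<sigma> z, \<sigma> z + 1] \<in> set (match_edges N es)"
    have False if uv: "[u, v] \<in> set es" "\<sigma> z = u * ?K + 2 + v" "\<sigma> z + 1 = v * ?K + 2 + u" for u v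
    proof -
      \<comment> \<open>An adjacency edge between consecutive vertices would give this equation, but
        its sides differ modulo \<open>N + 1\<close>, as \<open>N\<close> is positive.\<close>
      have eq: "u * (N + 1) + 1 = v * (N + 1)" using uv(2,3) by simp
      have "u < v \<or> v \<le> u" by auto
      then show False
      proof
        assume "u < v"
        then have "(u + 1) * (N + 1) \<le> v * (N + 1)" by (intro mult_le_mono1) simp
        with eq sym_edgesD[OF es uv(1)] show False by simp
      next
        assume "v \<le> u"
        then have "v * (N + 1) \<le> u * (N + 1)" by (rule mult_le_mono1)
        with eq show False by simp
      qed
    qed
    with a[unfolded set_match_edges[OF es]] show "\<exists>v < N. \<sigma> z = v * ?K"
      by (elim disjE exE conjE) (blast, simp, blast)
  next
    assume "\<exists>v < N. \<sigma> z = v * ?K"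
    then obtain v where "v < N" "\<sigma> z = v * ?K" by blast
    then show "[\<sigma> z, \<sigma> z + 1] \<in> set (match_edges N es)" unfolding set_match_edges[OF es]
      by (intro disjI1 exI[of _ v] conjI) simp_all
  qed
  finally show ?thesis .
qed

text \<open>Behind the last interval there is no marker; there the bound \<open>a < N * K\<close>
  takes its place.\<close>

lemma no_marker_between:
  fixes K :: nat
  assumes "v < N" "a < N * K"
  shows "v * K < a \<and> \<not> (\<exists>w < N. v * K < w * K \<and> w * K \<le> a) \<longleftrightarrow> v * K < a \<and> a < (v + 1) * K"
proof -
  have K: "0 < K" using assms(2) by (cases K) auto
  have "(\<exists>w < N. v * K < w * K \<and> w * K \<le> a) \<longleftrightarrow> (v + 1) * K \<le> a"
  proof
    assume "\<exists>w < N. v * K < w * K \<and> w * K \<le> a"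
    then obtain w where w: "v * K < w * K" "w * K \<le> a" by blast
    then have "v + 1 \<le> w" by simp
    then have "(v + 1) * K \<le> w * K" by (rule mult_le_mono1)
    with w(2) show "(v + 1) * K \<le> a" by simp
  next
    assume a: "(v + 1) * K \<le> a"
    then have "(v + 1) * K < N * K" using assms(2) by simp
    then have "v + 1 < N" by (simp only: mult_less_cancel2)
    with a K show "\<exists>w < N. v * K < w * K \<and> w * K \<le> a" by (intro exI[of _ "v + 1"]) simp
  qed
  then show ?thesis by auto
qed

lemma sat_interval:
  assumes es: "sym_edges N es" and xa: "x \<noteq> 2" "a \<noteq> 2" and v: "v < N" "\<sigma> x = v * (N + 2)"
    and a: "\<sigma> a < N * (N + 2)"
  shows "sat (match_struct N es) \<sigma> (interval_fo x a) \<longleftrightarrow> \<sigma> x < \<sigma> a \<and> \<sigma> a < (v + 1) * (N + 2)"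
proof -
  let ?K = "N + 2"
  have "sat (match_struct N es) \<sigma> (interval_fo x a) \<longleftrightarrow> v * ?K < \<sigma> a \<and>
      \<not> (\<exists>z < N * ?K. (\<exists>w < N. z = w * ?K) \<and> v * ?K < z \<and> z \<le> \<sigma> a)"
    using xa v a by (auto simp: interval_fo_def sat_marker[OF es] sat_Rel1 universe_match
      simp del: sat.simps(2) mult_Suc_right add_2_eq_Suc')
  also have "\<dots> \<longleftrightarrow> v * ?K < \<sigma> a \<and> \<not> (\<exists>w < N. v * ?K < w * ?K \<and> w * ?K \<le> \<sigma> a)"
  proof -
    have "w * ?K < N * ?K" if "w < N" for w using that by (intro mult_less_mono1) simp_all
    then show ?thesis by blast
  qed
  finally show ?thesis unfolding no_marker_between[OF v(1) a] v(2) .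
qed

text \<open>Both witnesses lie strictly behind the beginnings of their intervals, which excludes
  marker edges, as one end of those is a beginning. Any other edge gives back both vertices as
  quotients, so the formula need not specify the positions.\<close>

lemma sat_edge_fo:
  assumes es: "sym_edges N es" and xy: "5 \<le> x" "5 \<le> y"
    and u: "u < N" "\<sigma> x = u * (N + 2)" and v: "v < N" "\<sigma> y = v * (N + 2)"
  shows "sat (match_struct N es) \<sigma> (edge_fo x y) \<longleftrightarrow> [u, v] \<in> set es"
proof -
  let ?K = "N + 2"
  have int: "sat (match_struct N es) (\<sigma>(0 := a, 1 := b)) (interval_fo x 0) \<longleftrightarrow> u * ?K < a \<and> a < (u + 1) * ?K"
    "sat (match_struct N es) (\<sigma>(0 := a, 1 := b)) (interval_fo y 1) \<longleftrightarrow> v * ?K < b \<and> b < (v + 1) * ?K"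
    if "a < N * ?K" "b < N * ?K" for a b
    using sat_interval[OF es, of x 0 u "\<sigma>(0 := a, 1 := b)"] sat_interval[OF es, of y 1 v "\<sigma>(0 := a, 1 := b)"]
      that xy u v by simp_all
  have "sat (match_struct N es) \<sigma> (edge_fo x y) \<longleftrightarrow> (\<exists>a < N * ?K. \<exists>b < N * ?K. [a, b] \<in> set (match_edges N es) \<and>
      sat (match_struct N es) (\<sigma>(0 := a, 1 := b)) (interval_fo x 0) \<and>
      sat (match_struct N es) (\<sigma>(0 := a, 1 := b)) (interval_fo y 1))"
    unfolding edge_fo_def sat.simps(4,6) sat_Rel0 universe_match by simp
  also have "\<dots> \<longleftrightarrow> [u, v] \<in> set es"
  proof
    assume "\<exists>a < N * ?K. \<exists>b < N * ?K. [a, b] \<in> set (match_edges N es) \<and>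
      sat (match_struct N es) (\<sigma>(0 := a, 1 := b)) (interval_fo x 0) \<and>
      sat (match_struct N es) (\<sigma>(0 := a, 1 := b)) (interval_fo y 1)"
    then obtain a b where ab: "[a, b] \<in> set (match_edges N es)" "u * ?K < a" "a < (u + 1) * ?K"
      "v * ?K < b" "b < (v + 1) * ?K" using int by blast
    define r r' where "r = a - u * ?K" and "r' = b - v * ?K"
    have r: "a = u * ?K + r" "0 < r" "r < ?K" and r': "b = v * ?K + r'" "0 < r'" "r' < ?K"
      using ab by (simp_all add: r_def r'_def)
    have a: "a div ?K = u" unfolding r(1) by (rule div_interval[OF r(3)])
    have am: "a mod ?K = r" unfolding r(1) by (rule mod_interval[OF r(3)])
    have b: "b div ?K = v" unfolding r'(1) by (rule div_interval[OF r'(3)])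
    have bm: "b mod ?K = r'" unfolding r'(1) by (rule mod_interval[OF r'(3)])
    from ab(1) consider w where "a = w * ?K \<or> b = w * ?K" | s t where "[s, t] \<in> set es" "a = s * ?K + (2 + t)" "b = t * ?K + (2 + s)"
      unfolding set_match_edges[OF es] by (auto simp: add.assoc)
    then show "[u, v] \<in> set es"
    proof cases
      case (1 w)
      then have "a mod ?K = 0 \<or> b mod ?K = 0" by (elim disjE) (simp_all only: mod_mult_self2_is_0 simp_thms)
      with am bm r(2) r'(2) show ?thesis by simp
    next
      case (2 s t)
      have less: "2 + t < ?K" "2 + s < ?K" using sym_edgesD[OF es 2(1)] by simp_all
      have "a div ?K = s" unfolding 2(2) by (rule div_interval[OF less(1)])
      moreover have "b div ?K = t" unfolding 2(3) by (rule div_interval[OF less(2)])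
      ultimately show ?thesis using a b 2(1) by simp
    qed
  next
    assume e: "[u, v] \<in> set es"
    then have m: "[u * ?K + 2 + v, v * ?K + 2 + u] \<in> set (match_edges N es)"
      unfolding set_match_edges[OF es] by blast
    note less = match_edges_fun(1,2)[OF es m]
    show "\<exists>a < N * ?K. \<exists>b < N * ?K. [a, b] \<in> set (match_edges N es) \<and>
      sat (match_struct N es) (\<sigma>(0 := a, 1 := b)) (interval_fo x 0) \<and>
      sat (match_struct N es) (\<sigma>(0 := a, 1 := b)) (interval_fo y 1)"
      by (rule exI[of _ "u * ?K + 2 + v"], rule conjI, rule less, rule exI[of _ "v * ?K + 2 + u"], rule conjI, rule less)
        (use m int[OF less] u(1) v(1) in simp)
  qed
  finally show ?thesis .
qed

lemma sat_succ_fo: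
  assumes es: "sym_edges N es" and xy: "5 \<le> x" "5 \<le> y"
    and u: "u < N" "\<sigma> x = u * (N + 2)" and v: "v < N" "\<sigma> y = v * (N + 2)"
  shows "sat (match_struct N es) \<sigma> (succ_fo x y) \<longleftrightarrow> v = Suc u"
proof -
  let ?K = "N + 2"
  have less: "v * ?K < N * ?K" using v(1) by (intro mult_less_mono1) simp_all
  have "sat (match_struct N es) \<sigma> (succ_fo x y) \<longleftrightarrow> u * ?K < v * ?K \<and>
      \<not> (\<exists>z < N * ?K. (\<exists>w < N. z = w * ?K) \<and> u * ?K < z \<and> z < v * ?K)"
    using xy u v less by (auto simp: succ_fo_def sat_marker[OF es] sat_Rel1 universe_match
      simp del: sat.simps(2) mult_Suc_right add_2_eq_Suc')
  also have "\<dots> \<longleftrightarrow> u * ?K < v * ?K \<and> \<not> (\<exists>w < N. u * ?K < w * ?K \<and> w * ?K < v * ?K)"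
  proof -
    have "w * ?K < N * ?K" if "w < N" for w using that by (intro mult_less_mono1) simp_all
    then show ?thesis by blast
  qed
  also have "\<dots> \<longleftrightarrow> u < v \<and> \<not> (\<exists>w < N. u < w \<and> w < v)"
    by (simp only: mult_less_cancel2) simp
  also have "\<dots> \<longleftrightarrow> v = Suc u" using v(1) by (auto dest!: spec[of _ "Suc u"])
  finally show ?thesis .
qed

lemma sat_match_fo:
  assumes es: "sym_edges N es" and "over_arities [2, 2] \<phi>"
    and "\<And>x. x \<in> free_vars \<phi> \<Longrightarrow> \<sigma> x < N \<and> \<tau> (x + 5) = \<sigma> x * (N + 2)"
  shows "sat (match_struct N es) \<tau> (match_fo \<phi>) \<longleftrightarrow> sat (succ_struct N es) \<sigma> \<phi>"
  using assms(2,3)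
proof (induction \<phi> arbitrary: \<sigma> \<tau>)
  case (Eq x y)
  have "\<tau> (x + 5) = \<sigma> x * (N + 2)" "\<tau> (y + 5) = \<sigma> y * (N + 2)" using Eq.prems(2) by simp_all
  then show ?case by (simp only: match_fo.simps sat.simps mult_cancel2) simp
next
  case (Rel i xs)
  have i: "i = 0 \<or> i = 1" "length xs = 2" using Rel.prems(1) by (auto simp: less_Suc_eq)
  then obtain x y where xs: "xs = [x, y]" by (auto simp: numeral_2_eq_2 length_Suc_conv)
  have x: "\<sigma> x < N" "\<tau> (x + 5) = \<sigma> x * (N + 2)" and y: "\<sigma> y < N" "\<tau> (y + 5) = \<sigma> y * (N + 2)"
    using Rel.prems(2)[of x] Rel.prems(2)[of y] by (simp_all add: xs)
  from i(1) show ?case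
  proof
    assume "i = 0"
    then show ?thesis using sat_edge_fo[where x = "x + 5" and y = "y + 5", OF es _ _ x(1) x(2) y(1) y(2)] by (simp add: xs succ_struct_def)
  next
    assume "i = 1"
    then show ?thesis using sat_succ_fo[where x = "x + 5" and y = "y + 5", OF es _ _ x(1) x(2) y(1) y(2)] y(1) by (simp add: xs succ_struct_def set_path_edges)
  qed
next
  case (Neg \<phi>)
  have "sat (match_struct N es) \<tau> (match_fo \<phi>) \<longleftrightarrow> sat (succ_struct N es) \<sigma> \<phi>"
    using Neg.prems by (intro Neg.IH) auto
  then show ?case by simp
next
  case (Conj \<phi> \<psi>)
  have "sat (match_struct N es) \<tau> (match_fo \<phi>) \<longleftrightarrow> sat (succ_struct N es) \<sigma> \<phi>"
    "sat (match_struct N es) \<tau> (match_fo \<psi>) \<longleftrightarrow> sat (succ_struct N es) \<sigma> \<psi>"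
    using Conj.prems by (auto intro!: Conj.IH)
  then show ?case by simp
next
  case (Disj \<phi> \<psi>)
  have "sat (match_struct N es) \<tau> (match_fo \<phi>) \<longleftrightarrow> sat (succ_struct N es) \<sigma> \<phi>"
    "sat (match_struct N es) \<tau> (match_fo \<psi>) \<longleftrightarrow> sat (succ_struct N es) \<sigma> \<psi>"
    using Disj.prems by (auto intro!: Disj.IH)
  then show ?case by simp
next
  case (Ex x \<phi>)
  let ?K = "N + 2"
  have IH: "sat (match_struct N es) (\<tau>(x + 5 := v * ?K)) (match_fo \<phi>) \<longleftrightarrow> sat (succ_struct N es) (\<sigma>(x := v)) \<phi>"
    if "v < N" for v
    using Ex.prems that by (intro Ex.IH) auto
  have less: "v * ?K < N * ?K" if "v < N" for v using that by (intro mult_less_mono1) simp_all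
  have "sat (match_struct N es) \<tau> (match_fo (Ex x \<phi>)) \<longleftrightarrow>
      (\<exists>a < N * ?K. (\<exists>v < N. a = v * ?K) \<and> sat (match_struct N es) (\<tau>(x + 5 := a)) (match_fo \<phi>))"
    by (simp add: sat_marker[OF es] universe_match del: mult_Suc_right add_2_eq_Suc')
  also have "\<dots> \<longleftrightarrow> (\<exists>v < N. sat (match_struct N es) (\<tau>(x + 5 := v * ?K)) (match_fo \<phi>))"
    using less by blast
  also have "\<dots> \<longleftrightarrow> (\<exists>v < N. sat (succ_struct N es) (\<sigma>(x := v)) \<phi>)" using IH by blast
  finally show ?case by (simp add: succ_struct_def)
next
  case (All x \<phi>)
  let ?K = "N + 2"
  have IH: "sat (match_struct N es) (\<tau>(x + 5 := v * ?K)) (match_fo \<phi>) \<longleftrightarrow> sat (succ_struct N es) (\<sigma>(x := v)) \<phi>"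
    if "v < N" for v
    using All.prems that by (intro All.IH) auto
  have less: "v * ?K < N * ?K" if "v < N" for v using that by (intro mult_less_mono1) simp_all
  have "sat (match_struct N es) \<tau> (match_fo (All x \<phi>)) \<longleftrightarrow>
      (\<forall>a < N * ?K. \<not> (\<exists>v < N. a = v * ?K) \<or> sat (match_struct N es) (\<tau>(x + 5 := a)) (match_fo \<phi>))"
    by (simp add: sat_marker[OF es] universe_match del: mult_Suc_right add_2_eq_Suc')
  also have "\<dots> \<longleftrightarrow> (\<forall>v < N. sat (match_struct N es) (\<tau>(x + 5 := v * ?K)) (match_fo \<phi>))"
    using less by blast
  also have "\<dots> \<longleftrightarrow> (\<forall>v < N. sat (succ_struct N es) (\<sigma>(x := v)) \<phi>)" using IH by blast
  finally show ?case by (simp add: succ_struct_def)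
qed

lemma models_match:
  assumes "sym_edges N es" "sentence_for (succ_struct N es) \<phi>"
  shows "match_struct N es \<Turnstile> match_fo \<phi> \<longleftrightarrow> succ_struct N es \<Turnstile> \<phi>"
  unfolding models_def using assms(2)
  by (intro sat_match_fo[OF assms(1)]) (auto simp: sentence_for_def succ_struct_def)

section \<open>The matching and its linear order\<close>

definition match_graph :: "nat \<Rightarrow> nat list list \<Rightarrow> ugraph" where
  "match_graph N es = \<lparr>order = N * (N + 2), adj = {(u, v). [u, v] \<in> set (match_edges N es)}\<rparr>"

lemma partial_matching_match_graph:
  assumes es: "sym_edges N es" and N: "0 < N"
  shows "partial_matching (match_graph N es)"
proof -
  note m = match_edges_fun[OF es]
  have "simple_graph (match_graph N es)"
  proof -
    have "[u, u] \<notin> set (match_edges N es)" for u using m(3)[of u u] by blast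
    with m(1,2,4) N show ?thesis by (auto simp: simple_graph_def match_graph_def sym_def irrefl_def)
  qed
  moreover have "card {u. (v, u) \<in> adj (match_graph N es)} \<le> 1" for v
  proof -
    have "{u. (v, u) \<in> adj (match_graph N es)} \<subseteq> {if v mod (N + 2) = 0 then v + 1 else if v mod (N + 2) = 1 then v - 1
      else (v mod (N + 2) - 2) * (N + 2) + 2 + v div (N + 2)}"
    proof
      fix u assume "u \<in> {u. (v, u) \<in> adj (match_graph N es)}"
      then have "[v, u] \<in> set (match_edges N es)" by (simp add: match_graph_def)
      from m(5)[OF this] show "u \<in> {if v mod (N + 2) = 0 then v + 1 else if v mod (N + 2) = 1 then v - 1
        else (v mod (N + 2) - 2) * (N + 2) + 2 + v div (N + 2)}" by (simp only: singleton_iff)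
    qed
    from card_mono[OF _ this] show ?thesis by simp
  qed
  ultimately show ?thesis by (simp add: partial_matching_def)
qed

lemma distinct_match_edges:
  assumes es: "sym_edges N es"
  shows "distinct (match_edges N es)"
proof -
  let ?K = "N + 2"
  let ?f = "\<lambda>v. [[v * ?K, v * ?K + 1], [v * ?K + 1, v * ?K]]"
  let ?g = "\<lambda>e. [e ! 0 * ?K + 2 + e ! 1, e ! 1 * ?K + 2 + e ! 0]"
  have inj: "v = w" if "v * ?K + r = w * ?K + r'" "r < ?K" "r' < ?K" for v w r r'
    using that div_interval[of r ?K v] div_interval[of r' ?K w] by simp
  have "distinct (concat (map ?f [0..<N]))"
  proof (rule distinct_concat)
    have "inj_on ?f {0..<N}"
    proof (rule inj_onI)
      fix v w assume "?f v = ?f w"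
      then have "v * ?K + 0 = w * ?K + 0" by simp
      then show "v = w" by (rule inj) simp_all
    qed
    then show "distinct (map ?f [0..<N])" by (simp add: distinct_map)
    show "distinct ys" if "ys \<in> set (map ?f [0..<N])" for ys using that by auto
    show "set ys \<inter> set zs = {}" if "ys \<in> set (map ?f [0..<N])" "zs \<in> set (map ?f [0..<N])" "ys \<noteq> zs" for ys zs
    proof -
      obtain v w where vw: "ys = ?f v" "zs = ?f w" using \<open>ys \<in> _\<close> \<open>zs \<in> _\<close> by auto
      with \<open>ys \<noteq> zs\<close> have "v \<noteq> w" by auto
      then have "v * ?K \<noteq> w * ?K" "v * ?K \<noteq> w * ?K + 1" "v * ?K + 1 \<noteq> w * ?K"
        using inj[of v 0 w 0] inj[of v 0 w 1] inj[of v 1 w 0] by auto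
      then show ?thesis unfolding vw by (simp del: add_2_eq_Suc')
    qed
  qed
  moreover have "distinct (map ?g es)"
  proof -
    have "inj_on ?g (set es)"
    proof (rule inj_onI)
      fix e e' assume e: "e \<in> set es" "e' \<in> set es" "?g e = ?g e'"
      obtain u v where uv: "e = [u, v]" "u < N" "v < N" using es e(1) unfolding sym_edges_def by blast
      obtain u' v' where uv': "e' = [u', v']" "u' < N" "v' < N" using es e(2) unfolding sym_edges_def by blast
      have "u * ?K + (2 + v) = u' * ?K + (2 + v')" "v * ?K + (2 + u) = v' * ?K + (2 + u')"
        using e(3) uv uv' by simp_all
      then have "u = u'" "v = v'" using inj[of u "2 + v" u' "2 + v'"] inj[of v "2 + u" v' "2 + u'"] uv uv' by simp_all
      then show "e = e'" by (simp add: uv uv')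
    qed
    then show ?thesis using es by (simp add: distinct_map sym_edges_def)
  qed
  moreover have "set (concat (map ?f [0..<N])) \<inter> set (map ?g es) = {}"
  proof -
    have False if e: "e \<in> set (concat (map ?f [0..<N]))" "e' \<in> set es" "e = ?g e'" for e e'
    proof -
      obtain u v where uv: "e' = [u, v]" "u < N" "v < N" using es e(2) unfolding sym_edges_def by blast
      from e(1) obtain w where "e = [w * ?K, w * ?K + 1] \<or> e = [w * ?K + 1, w * ?K]" by auto
      \<comment> \<open>Marker edges start at remainder 0 or 1, adjacency edges at remainder 2 or
        more.\<close>
      then have "hd e mod ?K \<le> 1"
        using mod_interval[of 0 ?K w] mod_interval[of 1 ?K w] by auto
      moreover have "hd e = u * ?K + (2 + v)" using e(3) uv by simp
      then have "hd e mod ?K = 2 + v" using mod_interval[of "2 + v" ?K u] uv by simp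
      ultimately show False by simp
    qed
    then show ?thesis by (auto simp del: set_concat)
  qed
  ultimately show ?thesis unfolding match_edges_def distinct_append by blast
qed

definition less_rel :: "nat \<Rightarrow> nat rel" where
  "less_rel n = {(i, j). i < j \<and> j < n}"

lemma linear_order_less_rel: "linear_order_of G (less_rel (order G))"
  by (auto simp: linear_order_of_def less_rel_def strict_linear_order_on_def trans_def irrefl_def total_on_def)

lemma lists_rel_order: "lists_rel (order_edges n) (less_rel n)"
proof -
  let ?f = "\<lambda>j. map (\<lambda>i. [i, j]) [0..<j]"
  have "distinct (order_edges n)" unfolding order_edges_def
  proof (rule distinct_concat)
    have "inj ?f"
    proof (rule injI)
      show "j = k" if "?f j = ?f k" for j k using arg_cong[OF that, of length] by simp
    qed
    then show "distinct (map ?f [0..<n])" by (simp add: distinct_map inj_on_subset[OF _ subset_UNIV])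
    show "distinct ys" if "ys \<in> set (map ?f [0..<n])" for ys
      using that by (auto simp: distinct_map inj_on_def)
    show "set ys \<inter> set zs = {}" if "ys \<in> set (map ?f [0..<n])" "zs \<in> set (map ?f [0..<n])" "ys \<noteq> zs" for ys zs
      using that by auto
  qed
  moreover have "set (order_edges n) = (\<lambda>(i, j). [i, j]) ` less_rel n"
    by (auto simp: order_edges_def less_rel_def image_iff)
  ultimately show ?thesis by (simp add: lists_rel_def)
qed

lemma match_struct_expansion:
  assumes es: "sym_edges N es"
  shows "match_struct N es \<in> expansions (match_graph N es) (less_rel (order (match_graph N es)))"
proof -
  have "\<exists>u v. e = [u, v]" if "e \<in> set (match_edges N es)" for e
    using that by (auto simp: match_edges_def)
  then have "set (match_edges N es) = (\<lambda>(u, v). [u, v]) ` adj (match_graph N es)"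
    by (force simp: match_graph_def image_iff)
  then have "lists_rel (match_edges N es) (adj (match_graph N es))"
    using distinct_match_edges[OF es] by (simp add: lists_rel_def)
  moreover have "order (match_graph N es) = N * (N + 2)" by (simp add: match_graph_def)
  ultimately show ?thesis unfolding expansions_def match_struct_def
    using lists_rel_order[of "N * (N + 2)"] by (auto simp del: mult_Suc_right add_2_eq_Suc')
qed


section \<open>The program for the ordered matching\<close>

definition marker_lexps :: "lexp \<Rightarrow> lexp list" where
  "marker_lexps z = map const [5, 3, 3, 1, 0, 2] @ z # map const [3, 3, 1, 1, 2] @ z #
     map const [3, 2, 5, 4, 3, 1, 1, 2] @ z # map const [4, 1, 1, 2, 4, 3]"

definition interval_lexps :: "lexp \<Rightarrow> lexp \<Rightarrow> lexp list" where
  "interval_lexps x a = map const [3, 1, 1, 2] @ x # a # map const [2, 5, 2, 3] @ marker_lexps (const 2) @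
     map const [3, 1, 1, 2] @ x # map const [2, 2, 1, 1, 2] @ [a, const 2]"

definition edge_lexps :: "lexp \<Rightarrow> lexp \<Rightarrow> lexp list" where
  "edge_lexps x y = map const [5, 0, 5, 1, 3, 1, 0, 2, 0, 1, 3] @ interval_lexps x (const 0) @ interval_lexps y (const 1)"

definition succ_lexps :: "lexp \<Rightarrow> lexp \<Rightarrow> lexp list" where
  "succ_lexps x y = map const [3, 1, 1, 2] @ x # y # map const [2, 5, 2, 3] @ marker_lexps (const 2) @
     map const [3, 1, 1, 2] @ x # map const [2, 1, 1, 2, 2] @ [y]"

lemma map_leval_marker [simp]: "map (leval s) (marker_lexps z) = fo_tokens (marker_fo (leval s z))"
  by (simp add: marker_lexps_def marker_fo_def)

lemma map_leval_interval [simp]: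
  "map (leval s) (interval_lexps x a) = fo_tokens (interval_fo (leval s x) (leval s a))"
  by (simp add: interval_lexps_def interval_fo_def)

lemma map_leval_edge [simp]: "map (leval s) (edge_lexps x y) = fo_tokens (edge_fo (leval s x) (leval s y))"
  by (simp add: edge_lexps_def edge_fo_def)

lemma map_leval_succ [simp]: "map (leval s) (succ_lexps x y) = fo_tokens (succ_fo (leval s x) (leval s y))"
  by (simp add: succ_lexps_def succ_fo_def)

definition match_fo_step :: prg where
  "match_fo_step =
     IfLess (reg_plus 0 4) (const 1)
       (Read 5 ;; Read 6 ;; Emit 4 [const 0, reg_plus 5 5, reg_plus 5 6])
     (IfLess (reg_plus 0 4) (const 2)
       (Read 5 ;; Read 6 ;; Read 6 ;; Read 7 ;;
        IfLess (reg_plus 0 5) (const 1) (Emit 4 (edge_lexps (reg_plus 5 6) (reg_plus 5 7)))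
          (Emit 4 (succ_lexps (reg_plus 5 6) (reg_plus 5 7))))
     (IfLess (reg_plus 0 4) (const 5)
       (Emit 4 [reg_plus 0 4])
     (IfLess (reg_plus 0 4) (const 6)
       (Read 5 ;; Emit 4 ([const 5, reg_plus 5 5, const 3] @ marker_lexps (reg_plus 5 5)))
       (Read 5 ;; Emit 4 ([const 6, reg_plus 5 5, const 4, const 2] @ marker_lexps (reg_plus 5 5))))))"

lemma match_fo_steps:
  assumes "inp s = fo_tokens \<phi> @ rest" "over_arities [2, 2] \<phi>"
  shows "translates match_fo_step s rest (fo_tokens (match_fo \<phi>))"
proof (rule fo_steps[where T = match_fo and as = "[2, 2]" and ex = "\<lambda>x. [5, x + 5, 3] @ fo_tokens (marker_fo (x + 5))"
      and all = "\<lambda>x. [6, x + 5, 4, 2] @ fo_tokens (marker_fo (x + 5))"])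
  show "emits match_fo_step s rest (fo_tokens (match_fo (Eq x y)))" if "inp s = fo_tokens (Eq x y) @ rest" for s rest x y
    using that by (simp add: emits_def read_step_def read_def match_fo_step_def add.commute)
  show "emits match_fo_step s rest (fo_tokens (match_fo (Rel i xs)))"
    if "inp s = fo_tokens (Rel i xs) @ rest" "over_arities [2, 2] (Rel i xs)" for s rest i xs
  proof -
    have "length xs = 2" using that(2) by (auto simp: less_Suc_eq)
    then obtain x y where xs: "xs = [x, y]" by (auto simp: numeral_2_eq_2 length_Suc_conv)
    show ?thesis using that(1) by (simp add: xs emits_def read_step_def read_def match_fo_step_def add.commute)
  qed
  show "emits match_fo_step s rest [k]" if "inp s = k # rest" "2 \<le> k" "k < 5" for s rest k
    using that by (simp add: emits_def read_step_def read_def match_fo_step_def)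
  show "emits match_fo_step s rest ([5, x + 5, 3] @ fo_tokens (marker_fo (x + 5)))" if "inp s = 5 # x # rest" for s rest x
    using that by (simp add: emits_def read_step_def read_def match_fo_step_def add.commute)
  show "emits match_fo_step s rest ([6, x + 5, 4, 2] @ fo_tokens (marker_fo (x + 5)))" if "inp s = 6 # x # rest" for s rest x
    using that by (simp add: emits_def read_step_def read_def match_fo_step_def add.commute)
qed (use assms in simp_all)

text \<open>
  Read register 0 holds the number \<open>N\<close> of vertices.  Counter 0 is the number of vertices created so far,
  counter 1 runs through them, and counters 2 and 3 are the numbers of edges and of pairs in the order.
  Counters 4 to 6 hold positions of intervals.
\<close>

definition interval_prg :: "nat \<Rightarrow> nat \<Rightarrow> prg" where
  "interval_prg c r = Clear c ;; Repeat r (Inc c ;; Inc c ;; Repeat 0 (Inc c))"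

text \<open>Only read registers control repetitions and none holds \<open>N * (N + 2)\<close>, so
  that many rounds are obtained by nesting loops over \<open>N\<close>.\<close>

definition vertices_prg :: "prg \<Rightarrow> prg" where
  "vertices_prg p = Repeat 0 (p ;; p ;; Repeat 0 p)"

definition marker_prg :: prg where
  "marker_prg = Emit 1 [ctr_plus 0 4, ctr_plus 1 4, ctr_plus 1 4, ctr_plus 0 4] ;; Inc 2 ;; Inc 2 ;;
     Inc 4 ;; Inc 4 ;; Repeat 0 (Inc 4)"

definition edge_prg :: prg where
  "edge_prg = Read 2 ;; Read 3 ;; interval_prg 5 2 ;; interval_prg 6 3 ;;
     Emit 1 [(2, [3], [5]), (2, [2], [6])] ;; Inc 2"

text \<open>The current vertex is held in a counter, which cannot bound a loop. Hence all vertices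
  are run through and the smaller ones selected by a comparison; \<open>Emit 3 []\<close> stands for
  doing nothing.\<close>

definition less_prg :: prg where
  "less_prg = IfLess (ctr_plus 0 1) (ctr_plus 0 0) (Emit 3 [ctr_plus 0 1, ctr_plus 0 0] ;; Inc 3) (Emit 3 []) ;; Inc 1"

text \<open>The reads into register 1 at the start pass over the number of relations and the first
  arity and keep the number of edges. The successor pairs are skipped: they form the path 0, 1, 2
  and so on, which the intervals follow anyway.\<close>

definition match_prg :: prg where
  "match_prg = Read 0 ;; Read 1 ;; Read 1 ;; Read 1 ;; Repeat 0 marker_prg ;; Repeat 1 edge_prg ;;
     Read 1 ;; Read 1 ;; Repeat 1 (Read 2 ;; Read 2) ;;
     vertices_prg (Clear 1 ;; vertices_prg less_prg ;; Inc 0) ;;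
     WhileRead 4 match_fo_step ;;
     Emit 0 [ctr_plus 0 0, const 2, const 2, ctr_plus 0 2] ;; Emit 2 [const 2, ctr_plus 0 3]"

lemma sem_Inc_funpow: "(sem (Inc c) ^^ n) s = s\<lparr>ct := (ct s)(c := ct s c + n)\<rparr>"
  by (induction n) (auto intro!: st.equality simp: fun_eq_iff)

lemma sem_Repeat_Inc: "sem (Repeat r (Inc c)) s = s\<lparr>ct := (ct s)(c := ct s c + rv s r)\<rparr>"
  by (simp only: sem.simps(6) sem_Inc_funpow)

lemma funpow_rv:
  fixes f :: "st \<Rightarrow> st"
  assumes "\<And>s. rv (f s) = rv s"
  shows "rv ((f ^^ n) s) = rv s"
  by (induction n) (simp_all add: assms)

lemma sem_vertices:
  assumes "\<And>s. rv (sem p s) = rv s"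
  shows "sem (vertices_prg p) s = (sem p ^^ (rv s 0 * (rv s 0 + 2))) s"
proof -
  let ?N = "rv s 0"
  let ?g = "sem (p ;; p ;; Repeat 0 p)"
  have g: "?g t = (sem p ^^ (?N + 2)) t" if "rv t = rv s" for t
  proof -
    have "rv (sem p (sem p t)) 0 = ?N" using assms that by simp
    then have "?g t = (sem p ^^ ?N) (sem p (sem p t))" by simp
    also have "\<dots> = (sem p ^^ (?N + 2)) t" by (simp only: funpow_add o_apply) (simp add: numeral_2_eq_2)
    finally show ?thesis .
  qed
  have "(?g ^^ n) s = (sem p ^^ (n * (?N + 2))) s" for n
  proof (induction n)
    case (Suc n)
    have "(?g ^^ Suc n) s = ?g ((sem p ^^ (n * (?N + 2))) s)" by (simp add: Suc)
    also have "\<dots> = (sem p ^^ (?N + 2)) ((sem p ^^ (n * (?N + 2))) s)"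
      by (rule g) (simp add: funpow_rv assms)
    also have "\<dots> = (sem p ^^ (Suc n * (?N + 2))) s" by (simp only: mult_Suc funpow_add o_apply)
    finally show ?case .
  qed simp
  then show ?thesis by (simp add: vertices_prg_def)
qed

lemma sem_interval:
  "sem (interval_prg c r) s = s\<lparr>ct := (ct s)(c := rv s r * (rv s 0 + 2))\<rparr>"
proof -
  let ?f = "sem (Inc c ;; Inc c ;; Repeat 0 (Inc c))"
  have "(?f ^^ n) s = s\<lparr>ct := (ct s)(c := ct s c + n * (rv s 0 + 2))\<rparr>" for n s
  proof (induction n)
    case (Suc n)
    have "(?f ^^ Suc n) s = ?f ((?f ^^ n) s)" by (simp only: funpow.simps o_apply)
    also have "\<dots> = ?f (s\<lparr>ct := (ct s)(c := ct s c + n * (rv s 0 + 2))\<rparr>)" by (simp only: Suc)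
    also have "\<dots> = s\<lparr>ct := (ct s)(c := ct s c + Suc n * (rv s 0 + 2))\<rparr>"
      by (auto intro!: st.equality simp: sem_Repeat_Inc fun_eq_iff simp del: sem.simps(6))
    finally show ?case .
  qed simp
  note this[of "rv s r" "sem (Clear c) s"]
  then have "sem (interval_prg c r) s = (sem (Clear c) s)\<lparr>ct := (ct (sem (Clear c) s))(c := ct (sem (Clear c) s) c +
      rv s r * (rv (sem (Clear c) s) 0 + 2))\<rparr>"
    unfolding interval_prg_def sem.simps(5)[of "Clear c"] sem.simps(6)[of r] by simp
  then show ?thesis by simp
qed

lemma sem_markers:
  assumes "rv s 0 = N" "ct s 4 = 0"
  shows "inp ((sem marker_prg ^^ n) s) = inp s \<and> rv ((sem marker_prg ^^ n) s) = rv s \<and>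
    ct ((sem marker_prg ^^ n) s) = (ct s)(2 := ct s 2 + 2 * n, 4 := n * (N + 2)) \<and>
    out ((sem marker_prg ^^ n) s) = (out s)(1 := out s 1 @
      concat (map (\<lambda>v. [v * (N + 2), v * (N + 2) + 1, v * (N + 2) + 1, v * (N + 2)]) [0..<n]))"
proof (induction n)
  case 0
  show ?case using assms(2) by (simp add: fun_eq_iff)
next
  case (Suc n)
  let ?s = "(sem marker_prg ^^ n) s"
  have step: "sem marker_prg t = t\<lparr>ct := (ct t)(2 := ct t 2 + 2, 4 := ct t 4 + 2 + rv t 0),
      out := (out t)(1 := out t 1 @ [ct t 4, ct t 4 + 1, ct t 4 + 1, ct t 4])\<rparr>" for t
    by (auto intro!: st.equality simp: marker_prg_def sem_Repeat_Inc fun_eq_iff simp del: sem.simps(6))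
  show ?case using Suc assms(1) by (simp add: step fun_eq_iff)
qed

lemma sem_edges:
  assumes "inp s = concat es @ rest" "\<forall>e \<in> set es. \<exists>u v. e = [u, v]" "rv s 0 = N"
  shows "inp ((sem edge_prg ^^ length es) s) = rest \<and> rv ((sem edge_prg ^^ length es) s) 0 = N \<and>
    (\<forall>i \<in> {0, 1, 3}. ct ((sem edge_prg ^^ length es) s) i = ct s i) \<and>
    ct ((sem edge_prg ^^ length es) s) 2 = ct s 2 + length es \<and>
    out ((sem edge_prg ^^ length es) s) = (out s)(1 := out s 1 @
      concat (map (\<lambda>e. [e ! 0 * (N + 2) + 2 + e ! 1, e ! 1 * (N + 2) + 2 + e ! 0]) es))"
  using assms
proof (induction es arbitrary: s)
  case (Cons e es)
  obtain u v where e: "e = [u, v]" using Cons.prems(2) by auto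
  let ?s = "sem edge_prg s"
  have s: "inp ?s = concat es @ rest" "rv ?s 0 = N" "\<forall>i \<in> {0, 1, 3}. ct ?s i = ct s i" "ct ?s 2 = Suc (ct s 2)"
    "out ?s = (out s)(1 := out s 1 @ [u * (N + 2) + 2 + v, v * (N + 2) + 2 + u])"
    using Cons.prems by (simp_all add: edge_prg_def sem_interval read_def e add_ac)
  from Cons.IH[OF s(1) _ s(2)] Cons.prems(2) s show ?case
    by (simp add: funpow_Suc_apply fun_eq_iff e del: funpow.simps(2))
qed simp

lemma sem_skip:
  assumes "inp s = concat es @ rest" "\<forall>e \<in> set es. \<exists>u v. e = [u, v]"
  shows "inp ((sem (Read 2 ;; Read 2) ^^ length es) s) = rest \<and> rv ((sem (Read 2 ;; Read 2) ^^ length es) s) 0 = rv s 0 \<and>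
    ct ((sem (Read 2 ;; Read 2) ^^ length es) s) = ct s \<and> out ((sem (Read 2 ;; Read 2) ^^ length es) s) = out s"
  using assms
proof (induction es arbitrary: s)
  case (Cons e es)
  obtain u v where e: "e = [u, v]" using Cons.prems(2) by auto
  let ?s = "sem (Read 2 ;; Read 2) s"
  have s: "inp ?s = concat es @ rest" "rv ?s 0 = rv s 0" "ct ?s = ct s" "out ?s = out s"
    using Cons.prems by (simp_all add: read_def e)
  from Cons.IH[OF s(1)] Cons.prems(2) s show ?case
    by (simp add: funpow_Suc_apply del: funpow.simps(2) sem.simps)
qed simp

lemma sem_less:
  assumes "ct s 1 = 0"
  shows "inp ((sem less_prg ^^ n) s) = inp s \<and> rv ((sem less_prg ^^ n) s) = rv s \<and>
    ct ((sem less_prg ^^ n) s) = (ct s)(1 := n, 3 := ct s 3 + min n (ct s 0)) \<and>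
    out ((sem less_prg ^^ n) s) = (out s)(3 := out s 3 @ concat (map (\<lambda>i. [i, ct s 0]) [0..<min n (ct s 0)]))"
proof (induction n)
  case 0
  show ?case using assms by (simp add: fun_eq_iff)
next
  case (Suc n)
  show ?case
  proof (cases "n < ct s 0")
    case True
    then have "min n (ct s 0) = n" "min (Suc n) (ct s 0) = Suc n" by simp_all
    with Suc True show ?thesis by (simp add: less_prg_def fun_eq_iff)
  next
    case False
    then have "min n (ct s 0) = ct s 0" "min (Suc n) (ct s 0) = ct s 0" by simp_all
    with Suc False show ?thesis by (simp add: less_prg_def fun_eq_iff)
  qed
qed

lemma rv_vertices: "(\<And>s. rv (sem p s) = rv s) \<Longrightarrow> rv (sem (vertices_prg p) s) = rv s"
  by (simp only: sem_vertices funpow_rv)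

lemma rv_less: "rv (sem less_prg s) = rv s"
  by (simp add: less_prg_def)

lemma sem_order:
  fixes s defines "f \<equiv> sem (Clear 1 ;; vertices_prg less_prg ;; Inc 0)" and "M \<equiv> rv s 0 * (rv s 0 + 2)"
  assumes "ct s 0 = 0" "n \<le> M"
  shows "inp ((f ^^ n) s) = inp s \<and> rv ((f ^^ n) s) = rv s \<and> ct ((f ^^ n) s) 0 = n \<and>
    ct ((f ^^ n) s) 2 = ct s 2 \<and> ct ((f ^^ n) s) 3 = ct s 3 + length (order_edges n) \<and>
    out ((f ^^ n) s) = (out s)(3 := out s 3 @ concat (order_edges n))"
  using assms(4)
proof (induction n)
  case 0
  then show ?case using assms(3) by (simp add: order_edges_def)
next
  case (Suc n)
  let ?s = "(f ^^ n) s"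
  define t where "t = sem (Clear 1) ?s"
  have IH: "inp ?s = inp s" "rv ?s = rv s" "ct ?s 0 = n" "ct ?s 2 = ct s 2" "ct ?s 3 = ct s 3 + length (order_edges n)"
    "out ?s = (out s)(3 := out s 3 @ concat (order_edges n))"
    using Suc.IH[OF Suc_leD[OF Suc.prems]] by blast+
  have t: "inp t = inp s" "rv t = rv s" "ct t = (ct ?s)(1 := 0)" "out t = out ?s" by (simp_all add: t_def IH)
  have "f ?s = sem (Inc 0) (sem (vertices_prg less_prg) t)" by (simp add: f_def t_def)
  also have "sem (vertices_prg less_prg) t = (sem less_prg ^^ M) t"
    by (simp add: sem_vertices[OF rv_less] t(2) M_def)
  finally have f: "f ?s = sem (Inc 0) ((sem less_prg ^^ M) t)" .
  \<comment> \<open>The inner loop runs through \<open>M\<close> vertices, enough to meet every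
    vertex below \<open>n\<close>.\<close>
  have min: "min M n = n" using Suc.prems by simp
  have order: "order_edges (Suc n) = order_edges n @ map (\<lambda>i. [i, n]) [0..<n]" by (simp add: order_edges_def)
  have "ct t 1 = 0" "ct t 0 = n" by (simp_all add: t IH)
  with sem_less[of t M] show ?case by (simp add: f min order t IH fun_eq_iff)
qed

lemma result_match_prg:
  assumes es: "sym_edges N es" and "0 < N" "over_arities [2, 2] \<phi>"
  shows "result 5 match_prg (struct_tokens (succ_struct N es) @ fo_tokens \<phi>) =
    struct_tokens (match_struct N es) @ fo_tokens (match_fo \<phi>)"
proof -
  let ?M = "N * (N + 2)"
  let ?in = "struct_tokens (succ_struct N es) @ fo_tokens \<phi>"
  have input: "?in = N # 2 # 2 # length es # concat es @ 2 # length (path_edges N) # concat (path_edges N) @ fo_tokens \<phi>"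
    by (simp add: struct_tokens_def succ_struct_def)
  have pairs: "\<forall>e \<in> set es. \<exists>u v. e = [u, v]" using es unfolding sym_edges_def by blast
  define s0 where "s0 = sem (Read 0 ;; Read 1 ;; Read 1 ;; Read 1) (st_init ?in)"
  have s0: "inp s0 = concat es @ 2 # length (path_edges N) # concat (path_edges N) @ fo_tokens \<phi>"
    "rv s0 0 = N" "rv s0 1 = length es" "ct s0 = (\<lambda>_. 0)" "out s0 = (\<lambda>_. [])"
    by (simp_all add: s0_def read_def st_init_def input)
  define s1 where "s1 = (sem marker_prg ^^ N) s0"
  have s1: "inp s1 = inp s0" "rv s1 = rv s0" "ct s1 = (\<lambda>_. 0)(2 := 2 * N, 4 := ?M)"
    "out s1 = (\<lambda>_. [])(1 := concat (map (\<lambda>v. [v * (N + 2), v * (N + 2) + 1, v * (N + 2) + 1, v * (N + 2)]) [0..<N]))"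
    using sem_markers[of s0 N N] s0 by (simp_all add: s1_def)
  define s2 where "s2 = (sem edge_prg ^^ length es) s1"
  have s2: "inp s2 = 2 # length (path_edges N) # concat (path_edges N) @ fo_tokens \<phi>" "rv s2 0 = N"
    "\<forall>i \<in> {0, 1, 3}. ct s2 i = ct s1 i" "ct s2 2 = ct s1 2 + length es"
    "out s2 = (out s1)(1 := out s1 1 @ concat (map (\<lambda>e. [e ! 0 * (N + 2) + 2 + e ! 1, e ! 1 * (N + 2) + 2 + e ! 0]) es))"
    using sem_edges[OF s1(1)[unfolded s0(1)] pairs, of N] s0 s1(2) by (simp_all add: s2_def)
  define s3 where "s3 = sem (Read 1 ;; Read 1) s2"
  have s3: "inp s3 = concat (path_edges N) @ fo_tokens \<phi>" "rv s3 0 = N" "rv s3 1 = length (path_edges N)"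
    "ct s3 = ct s2" "out s3 = out s2"
    using s2(1,2) by (simp_all add: s3_def read_def)
  define s4 where "s4 = (sem (Read 2 ;; Read 2) ^^ length (path_edges N)) s3"
  have "\<forall>e \<in> set (path_edges N). \<exists>u v. e = [u, v]" by (auto simp: path_edges_def)
  from sem_skip[OF s3(1) this] have s4: "inp s4 = fo_tokens \<phi>" "rv s4 0 = N" "ct s4 = ct s2" "out s4 = out s2"
    by (simp_all add: s4_def s3 del: sem.simps)
  define f where "f = sem (Clear 1 ;; vertices_prg less_prg ;; Inc 0)"
  define s5 where "s5 = (f ^^ ?M) s4"
  have "ct s4 0 = 0" "ct s4 3 = 0" using s2(3) s1(3) by (simp_all add: s4)
  with sem_order[of s4 ?M, folded f_def] s4 have s5: "inp s5 = fo_tokens \<phi>" "ct s5 0 = ?M"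
    "ct s5 2 = ct s2 2" "ct s5 3 = length (order_edges ?M)"
    "out s5 = (out s2)(3 := out s2 3 @ concat (order_edges ?M))"
    by (simp_all add: s5_def del: mult_Suc_right add_2_eq_Suc')
  define s6 where "s6 = sem (WhileRead 4 match_fo_step) s5"
  have "translates match_fo_step s5 [] (fo_tokens (match_fo \<phi>))"
    using s5(1) assms(3) by (intro match_fo_steps) simp_all
  note s6 = sem_translates[OF this, folded s6_def]
  have rv: "rv (sem (Clear 1 ;; vertices_prg less_prg ;; Inc 0) s) = rv s" for s
    using rv_vertices[OF rv_less, of "sem (Clear 1) s"] by simp
  have prg: "sem match_prg (st_init ?in) =
      sem (Emit 0 [ctr_plus 0 0, const 2, const 2, ctr_plus 0 2] ;; Emit 2 [const 2, ctr_plus 0 3]) s6"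
  proof -
    have "sem (Repeat 0 marker_prg) s0 = s1" using s0(2) by (simp add: s1_def)
    moreover have "sem (Repeat 1 edge_prg) s1 = s2" using s0(3) s1(2) by (simp add: s2_def)
    moreover have "sem (Repeat 1 (Read 2 ;; Read 2)) s3 = s4" using s3(3) by (simp add: s4_def del: sem.simps(5))
    moreover have "sem (vertices_prg (Clear 1 ;; vertices_prg less_prg ;; Inc 0)) s4 = s5"
      using sem_vertices[OF rv] s4(2) by (simp only: s5_def f_def)
    ultimately show ?thesis
      unfolding match_prg_def s6_def by (simp only: sem.simps(5) s0_def s3_def)
  qed
  have "concat (map (\<lambda>v. [v * (N + 2), v * (N + 2) + 1, v * (N + 2) + 1, v * (N + 2)]) vs) =
      concat (concat (map (\<lambda>v. [[v * (N + 2), v * (N + 2) + 1], [v * (N + 2) + 1, v * (N + 2)]]) vs))" for vs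
    by (induction vs) simp_all
  then have E: "out s6 1 = concat (match_edges N es)"
    by (simp add: s6 s5 s2 s1 match_edges_def)
  have "length (concat (map (\<lambda>v. [[v * (N + 2), v * (N + 2) + 1], [v * (N + 2) + 1, v * (N + 2)]]) vs)) = 2 * length vs" for vs
    by (induction vs) simp_all
  then have len: "ct s6 2 = length (match_edges N es)"
    by (simp add: s6 s5 s2 s1 match_edges_def)
  have outs: "ct s6 0 = ?M" "ct s6 3 = length (order_edges ?M)" "out s6 0 = []" "out s6 2 = []"
    "out s6 3 = concat (order_edges ?M)" "out s6 4 = fo_tokens (match_fo \<phi>)"
    using s0 s1 s2 s5 s6 by (simp_all del: mult_Suc_right add_2_eq_Suc')
  have "[0..<5] = [0, 1, 2, 3, 4 :: nat]" by (simp add: upt_rec)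
  then have "result 5 match_prg ?in = [?M, 2, 2, length (match_edges N es)] @ concat (match_edges N es) @
      [2, length (order_edges ?M)] @ concat (order_edges ?M) @ fo_tokens (match_fo \<phi>)"
    using outs E len by (simp add: result_def prg del: mult_Suc_right add_2_eq_Suc')
  then show ?thesis by (simp add: struct_tokens_def match_struct_def del: mult_Suc_right add_2_eq_Suc')
qed


section \<open>The reductions\<close>

lemma length_code_nats: "length (code_nats ns) = sum_list ns + length ns"
  by (induction ns) (simp_all add: code_nats_simps)

lemma fo_length_tokens: "fo_length \<phi> = sum_list (fo_tokens \<phi>) + length (fo_tokens \<phi>)"
  by (simp add: fo_length_def length_code_nats)

text \<open>A token contributes its value plus one. In this way a walk step amounts to 37, and a
  slot to 50 plus its variable.\<close>

lemma fo_length_tuple_fo: "fo_length (tuple_fo i xs) = 71 + 37 * i + 50 * length xs + sum_list xs"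
proof -
  have "sum_list (concat (map (\<lambda>x. slot_head @ x # slot_tail) xs)) = 30 * length xs + sum_list xs"
    "length (concat (map (\<lambda>x. slot_head @ x # slot_tail) xs)) = 20 * length xs"
    by (induction xs) (simp_all add: slot_head_def slot_tail_def)
  moreover have "sum_list (concat (replicate i walk_tokens)) = 23 * i" "length (concat (replicate i walk_tokens)) = 14 * i"
    by (induction i) (simp_all add: walk_tokens_def)
  ultimately show ?thesis
    by (simp add: fo_length_tokens fo_tokens_tuple_fo tuple_head_def tuple_mid_def)
qed

lemma fo_length_simps:
  "fo_length (Eq x y) = 3 + x + y" "fo_length (Rel i xs) = 4 + i + 2 * length xs + sum_list xs"
  "fo_length (Neg \<phi>) = 3 + fo_length \<phi>" "fo_length (Conj \<phi> \<psi>) = 4 + fo_length \<phi> + fo_length \<psi>"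
  "fo_length (Disj \<phi> \<psi>) = 5 + fo_length \<phi> + fo_length \<psi>"
  "fo_length (Ex x \<phi>) = 7 + x + fo_length \<phi>" "fo_length (All x \<phi>) = 8 + x + fo_length \<phi>"
  by (simp_all add: fo_length_tokens)

text \<open>Linear because the walk for a relation symbol replaces a token that is itself written in
  unary; the factor is a generous one.\<close>

lemma fo_length_star_fo: "fo_length (star_fo \<phi>) \<le> 200 * fo_length \<phi>"
proof (induction \<phi>)
  case (Rel i xs)
  have "sum_list (map (\<lambda>x. x + 2) xs) = sum_list xs + 2 * length xs" by (induction xs) simp_all
  then show ?case by (simp add: fo_length_simps fo_length_tuple_fo)
qed (simp_all add: fo_length_simps fo_length_tuple_fo)

lemma fo_length_match_fo: "over_arities [2, 2] \<phi> \<Longrightarrow> fo_length (match_fo \<phi>) \<le> 1000 * fo_length \<phi>"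
proof (induction \<phi>)
  case (Rel i xs)
  then have "length xs = 2" by (auto simp: less_Suc_eq)
  then obtain x y where "xs = [x, y]" by (auto simp: numeral_2_eq_2 length_Suc_conv)
  then show ?case
    by (simp add: fo_length_simps edge_fo_def succ_fo_def interval_fo_def marker_fo_def)
qed (simp_all add: fo_length_simps marker_fo_def)

section \<open>Instances of model checking and a criterion for hardness\<close>

lemma MC_FO_simps:
  assumes "K \<subseteq> {A. wf_struct A}" "A \<in> K" "sentence_for A \<phi>"
  shows "mc_code (A, \<phi>) \<in> instances (MC_FO K)"
    "mc_code (A, \<phi>) \<in> yes_instances (MC_FO K) \<longleftrightarrow> A \<Turnstile> \<phi>"
    "parameter (MC_FO K) (mc_code (A, \<phi>)) = fo_length \<phi>"
proof -
  let ?I = "{(A, \<phi>). A \<in> K \<and> sentence_for A \<phi>}"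
  have inj: "inj_on mc_code ?I" using assms(1) by (intro inj_on_subset[OF mc_code_inj]) auto
  have I: "(A, \<phi>) \<in> ?I" using assms by simp
  show "mc_code (A, \<phi>) \<in> instances (MC_FO K)"
    using I by (auto simp: MC_FO_def coded_problem_def)
  have "mc_code (A, \<phi>) \<in> mc_code ` {i \<in> ?I. case i of (A, \<phi>) \<Rightarrow> A \<Turnstile> \<phi>} \<longleftrightarrow>
      (A, \<phi>) \<in> {i \<in> ?I. case i of (A, \<phi>) \<Rightarrow> A \<Turnstile> \<phi>}"
    by (rule inj_on_image_mem_iff[OF inj I]) auto
  with I show "mc_code (A, \<phi>) \<in> yes_instances (MC_FO K) \<longleftrightarrow> A \<Turnstile> \<phi>"
    by (simp add: MC_FO_def coded_problem_def)
  have "inv_into ?I mc_code (mc_code (A, \<phi>)) = (A, \<phi>)" by (rule inv_into_f_f[OF inj I])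
  then show "parameter (MC_FO K) (mc_code (A, \<phi>)) = fo_length \<phi>"
    by (simp add: MC_FO_def coded_problem_def)
qed

lemma MC_FO_instanceE:
  assumes "x \<in> instances (MC_FO K)"
  obtains A \<phi> where "A \<in> K" "sentence_for A \<phi>" "x = mc_code (A, \<phi>)"
  using assms by (auto simp: MC_FO_def coded_problem_def)

lemma fpt_computable_on_cong:
  assumes "fpt_computable_on I \<kappa> R" "\<And>x. x \<in> I \<Longrightarrow> R x = R' x"
  shows "fpt_computable_on I \<kappa> R'"
proof -
  from assms(1) obtain M f c where M: "wf_tm M" "computable f"
    "\<And>x. x \<in> I \<Longrightarrow> tm_computes M x (R x) (f (\<kappa> x) * (length x + 1) ^ c)"
    unfolding fpt_computable_on_def by blast
  have "\<forall>x\<in>I. tm_computes M x (R' x) (f (\<kappa> x) * (length x + 1) ^ c)"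
    using M(3) assms(2) by simp
  with M(1,2) show ?thesis unfolding fpt_computable_on_def by blast
qed

text \<open>A problem in the class comes with a reduction to model checking on all structures. The
  token transformation \<open>G\<close> is appended to the machine of that reduction, which is what
  the last hypothesis provides, so the composed map is a single fpt reduction.\<close>

lemma AW_star_hardI:
  fixes F :: "struct \<Rightarrow> struct" and T :: "fo \<Rightarrow> fo"
  assumes K: "K \<subseteq> {A. wf_struct A}"
    and F: "\<And>A. wf_struct A \<Longrightarrow> F A \<in> K"
    and T: "\<And>A \<phi>. wf_struct A \<Longrightarrow> sentence_for A \<phi> \<Longrightarrow> sentence_for (F A) (T \<phi>)"
    and sat: "\<And>A \<phi>. wf_struct A \<Longrightarrow> sentence_for A \<phi> \<Longrightarrow> F A \<Turnstile> T \<phi> \<longleftrightarrow> A \<Turnstile> \<phi>"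
    and len: "\<And>\<phi>. fo_length (T \<phi>) \<le> c * fo_length \<phi>"
    and G: "\<And>A \<phi>. wf_struct A \<Longrightarrow> sentence_for A \<phi> \<Longrightarrow>
      G (struct_tokens A @ fo_tokens \<phi>) = struct_tokens (F A) @ fo_tokens (T \<phi>)"
    and fpt: "\<And>I \<kappa> R. fpt_computable_on I \<kappa> (\<lambda>x. code_nats (R x)) \<Longrightarrow>
      fpt_computable_on I \<kappa> (\<lambda>x. code_nats (G (R x)))"
  shows "AW_star_hard (MC_FO K)"
  unfolding AW_star_hard_def
proof
  fix P assume "P \<in> AW_star"
  then obtain R g where R: "\<And>x. x \<in> instances P \<Longrightarrow> R x \<in> instances (MC_FO {A. wf_struct A})"
    "\<And>x. x \<in> instances P \<Longrightarrow> x \<in> yes_instances P \<longleftrightarrow> R x \<in> yes_instances (MC_FO {A. wf_struct A})"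
    "fpt_computable_on (instances P) (parameter P) R"
    and g: "computable g"
      "\<And>x. x \<in> instances P \<Longrightarrow> parameter (MC_FO {A. wf_struct A}) (R x) \<le> g (parameter P x)"
    unfolding AW_star_def fpt_reducible_def fpt_reduction_def by blast
  have "\<forall>x \<in> instances P. \<exists>i. wf_struct (fst i) \<and> sentence_for (fst i) (snd i) \<and> R x = mc_code i"
  proof
    fix x assume "x \<in> instances P"
    from R(1)[OF this] obtain A \<phi> where "A \<in> {A. wf_struct A}" "sentence_for A \<phi>" "R x = mc_code (A, \<phi>)"
      by (rule MC_FO_instanceE)
    then show "\<exists>i. wf_struct (fst i) \<and> sentence_for (fst i) (snd i) \<and> R x = mc_code i"
      by (intro exI[of _ "(A, \<phi>)"]) simp
  qed
  \<comment> \<open>Outside the instances of \<open>P\<close> the value of \<open>R\<close> need not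
    code anything, so the decoding is chosen on instances only;
    \<open>fpt_computable_on_cong\<close> disregards the rest.\<close>
  from bchoice[OF this] obtain q where
    q: "\<forall>x \<in> instances P. wf_struct (fst (q x)) \<and> sentence_for (fst (q x)) (snd (q x)) \<and> R x = mc_code (q x)" ..
  define A \<phi> where "A x = fst (q x)" and "\<phi> x = snd (q x)" for x
  have A: "wf_struct (A x)" "sentence_for (A x) (\<phi> x)" "R x = mc_code (A x, \<phi> x)" if "x \<in> instances P" for x
    using bspec[OF q that] by (simp_all add: A_def \<phi>_def)
  let ?tokens = "\<lambda>x. struct_tokens (A x) @ fo_tokens (\<phi> x)"
  have "fpt_computable_on (instances P) (parameter P) (\<lambda>x. code_nats (?tokens x))"
    using R(3) by (rule fpt_computable_on_cong) (simp add: A(3) mc_code_def)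
  then have "fpt_computable_on (instances P) (parameter P) (\<lambda>x. code_nats (G (?tokens x)))" by (rule fpt)
  then have "fpt_computable_on (instances P) (parameter P) (\<lambda>x. mc_code (F (A x), T (\<phi> x)))"
    by (rule fpt_computable_on_cong) (simp add: G A(1,2) mc_code_def)
  moreover have "mc_code (F (A x), T (\<phi> x)) \<in> instances (MC_FO K) \<and>
      (x \<in> yes_instances P \<longleftrightarrow> mc_code (F (A x), T (\<phi> x)) \<in> yes_instances (MC_FO K)) \<and>
      parameter (MC_FO K) (mc_code (F (A x), T (\<phi> x))) \<le> c * (g (parameter P x) + 0) ^ 1" if x: "x \<in> instances P" for x
  proof -
    have wf: "wf_struct (A x)" "sentence_for (A x) (\<phi> x)" "R x = mc_code (A x, \<phi> x)" using A[OF x] .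
    have "A x \<in> {A. wf_struct A}" using wf(1) by simp
    note all = MC_FO_simps[OF subset_refl this wf(2)]
    note new = MC_FO_simps[OF K F[OF wf(1)] T[OF wf(1,2)]]
    have "fo_length (\<phi> x) \<le> g (parameter P x)" using g(2)[OF x] all(3) wf(3) by simp
    then have "c * fo_length (\<phi> x) \<le> c * g (parameter P x)" by (rule mult_le_mono2)
    with len[of "\<phi> x"] have "fo_length (T (\<phi> x)) \<le> c * g (parameter P x)" by (rule le_trans)
    then show ?thesis using new R(2)[OF x] all(2) wf(3) sat[OF wf(1,2)] by simp
  qed
  \<comment> \<open>The summand 0 and the exponent 1 bring the bound into the form of
    \<open>computable_poly\<close>.\<close>
  moreover have "computable (\<lambda>k. c * (g k + 0) ^ 1)" by (rule computable_poly[OF g(1)])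
  ultimately have "fpt_reduction (\<lambda>x. mc_code (F (A x), T (\<phi> x))) P (MC_FO K)"
    unfolding fpt_reduction_def by blast
  then show "P \<le>\<^sub>f\<^sub>p\<^sub>t MC_FO K" unfolding fpt_reducible_def by blast
qed

lemma wf_expansion:
  assumes "simple_graph G" "X \<subseteq> {..<order G} \<times> {..<order G}" "B \<in> expansions G X"
  shows "wf_struct B"
proof -
  have "length t = 2 \<and> set t \<subseteq> {..<order G}" if "lists_rel ts Y" "Y \<subseteq> {..<order G} \<times> {..<order G}" "t \<in> set ts" for t ts Y
    using that by (auto simp: lists_rel_def)
  note pairs = this
  from assms(3) obtain es xs where B: "B = \<lparr>universe = order G, rels = [(2, es), (2, xs)]\<rparr>"
    and es: "lists_rel es (adj G)" and xs: "lists_rel xs X" unfolding expansions_def by blast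
  have G: "0 < order G" "adj G \<subseteq> {..<order G} \<times> {..<order G}" using assms(1) by (simp_all add: simple_graph_def)
  have "distinct es" "distinct xs" using es xs by (simp_all add: lists_rel_def)
  with G(1) pairs[OF es G(2)] pairs[OF xs assms(2)] show ?thesis by (simp add: wf_struct_def B)
qed

lemma successor_relation_subset:
  assumes "successor_relation_of G S"
  shows "S \<subseteq> {..<order G} \<times> {..<order G}"
proof -
  from assms obtain vs where vs: "set vs = {..<order G}" and S: "S = {(vs ! i, vs ! Suc i) | i. Suc i < length vs}"
    unfolding successor_relation_of_def by blast
  have "vs ! i \<in> {..<order G}" if "i < length vs" for i using nth_mem[OF that] by (simp only: vs)
  then show ?thesis unfolding S by fastforce
qed

lemma sym_edges_star:
  assumes "wf_struct A"
  shows "sym_edges (star_order A) (star_edges A)"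
proof -
  have "simple_graph (star_graph A)" using star_forest_star_graph[OF assms] by (simp add: star_forest_def)
  then have *: "u < star_order A \<and> v < star_order A \<and> u \<noteq> v \<and> [v, u] \<in> set (star_edges A)"
    if "[u, v] \<in> set (star_edges A)" for u v
    using that by (auto simp: simple_graph_def star_graph_def sym_def irrefl_def)
  have "\<exists>u v. e = [u, v]" if "e \<in> set (star_edges A)" for e
    using that by (auto simp: star_edges_def)
  moreover have "distinct (star_edges A)"
    using distinct_star_edges[of "leaves A" "first_leaf A"] centre_less[OF assms] by (simp add: star_edges_def)
  ultimately show ?thesis unfolding sym_edges_def using * by blast
qed

theorem theorem3p1:
  fixes C :: "ugraph set"
  assumes "\<forall>G\<in>C. simple_graph G"
  shows "({G. partial_matching G} \<subseteq> C \<longrightarrow> AW_star_hard (MC_FO_order C)) \<and>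
    ({G. star_forest G} \<subseteq> C \<longrightarrow> AW_star_hard (MC_FO_succ C))"
proof (intro conjI impI)
  assume C: "{G. star_forest G} \<subseteq> C"
  show "AW_star_hard (MC_FO_succ C)" unfolding MC_FO_succ_def
  proof (rule AW_star_hardI[where F = star_struct and T = star_fo and G = "result 5 star_prg" and c = 200])
    show "(\<Union>G\<in>C. \<Union>S\<in>{S. successor_relation_of G S}. expansions G S) \<subseteq> {A. wf_struct A}"
      using assms by (auto intro: wf_expansion dest: successor_relation_subset)
    show "star_struct A \<in> (\<Union>G\<in>C. \<Union>S\<in>{S. successor_relation_of G S}. expansions G S)" if "wf_struct A" for A
      using star_struct_expansion[OF that] star_forest_star_graph[OF that] successor_path_rel C by blast
    show "result 5 star_prg (struct_tokens A @ fo_tokens \<phi>) = struct_tokens (star_struct A) @ fo_tokens (star_fo \<phi>)"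
      if "wf_struct A" "sentence_for A \<phi>" for A \<phi>
      using result_star_prg[OF that(1)] that(2) unfolding sentence_for_def by blast
    show "star_struct A \<Turnstile> star_fo \<phi> \<longleftrightarrow> A \<Turnstile> \<phi>" if "wf_struct A" "sentence_for A \<phi>" for A \<phi>
      using that by (rule models_star)
  qed (intro sentence_star fo_length_star_fo fpt_computable_transducer; assumption)+
next
  assume C: "{G. partial_matching G} \<subseteq> C"
  \<comment> \<open>The matching is built from the star structure instead of from \<open>A\<close>,
    because there the vocabulary is already reduced to a symmetric relation and a path, the only
    relations that intervals and their order represent.\<close>
  let ?F = "\<lambda>A. match_struct (star_order A) (star_edges A)"
  have star: "star_struct A = succ_struct (star_order A) (star_edges A)" for A
    by (simp add: star_struct_def succ_struct_def)
  have pos: "0 < star_order A" for A by (simp add: star_order_def first_leaf_def offset_def)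
  show "AW_star_hard (MC_FO_order C)" unfolding MC_FO_order_def
  proof (rule AW_star_hardI[where F = ?F and T = "\<lambda>\<phi>. match_fo (star_fo \<phi>)" and c = "1000 * 200"
        and G = "\<lambda>ns. result 5 match_prg (result 5 star_prg ns)"])
    show "(\<Union>G\<in>C. \<Union>L\<in>{L. linear_order_of G L}. expansions G L) \<subseteq> {A. wf_struct A}"
      using assms by (auto intro: wf_expansion simp: linear_order_of_def)
    show "?F A \<in> (\<Union>G\<in>C. \<Union>L\<in>{L. linear_order_of G L}. expansions G L)" if "wf_struct A" for A
      using match_struct_expansion[OF sym_edges_star[OF that]] partial_matching_match_graph[OF sym_edges_star[OF that] pos]
        linear_order_less_rel C by blast
    show "sentence_for (?F A) (match_fo (star_fo \<phi>))" if "wf_struct A" "sentence_for A \<phi>" for A \<phi>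
      using sentence_match[OF sentence_star[OF that(2), unfolded star]] .
    show "?F A \<Turnstile> match_fo (star_fo \<phi>) \<longleftrightarrow> A \<Turnstile> \<phi>" if "wf_struct A" "sentence_for A \<phi>" for A \<phi>
      using models_match[OF sym_edges_star[OF that(1)] sentence_star[OF that(2), unfolded star]] models_star[OF that]
      by (simp add: star)
    show "fo_length (match_fo (star_fo \<phi>)) \<le> 1000 * 200 * fo_length \<phi>" for \<phi>
      using fo_length_match_fo[OF over_arities_star_fo[of \<phi>]] fo_length_star_fo[of \<phi>] by simp
    show "result 5 match_prg (result 5 star_prg (struct_tokens A @ fo_tokens \<phi>)) =
        struct_tokens (?F A) @ fo_tokens (match_fo (star_fo \<phi>))" if "wf_struct A" "sentence_for A \<phi>" for A \<phi>
    proof -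
      have "over_arities (map fst (rels A)) \<phi>" using that(2) by (simp add: sentence_for_def)
      then show ?thesis
        by (simp only: result_star_prg[OF that(1)] star result_match_prg[OF sym_edges_star[OF that(1)] pos over_arities_star_fo])
    qed
  qed (intro fpt_computable_transducer)
qed

end
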